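(* The action $\gamma\mapsto\theta_\gamma$ of the group $GL_2(R)\subset S$ and the action $m\mapsto\theta_m$ of the semigroup $M_2(\mathbb{Z})^+\subset S$ assemble to an action of the group $S=\mathbb{Q}^*\backslash GL_2(\mathbb{A}_f)$ as symmetries of the dynamical system $(A,\sigma_t)$.
   Context: Notation. $R=\prod_p\mathbb{Z}_p$, $\mathbb{A}_f=R\otimes\mathbb{Q}$ is the ring of finite adeles of $\mathbb{Q}$, $\Gamma=SL_2(\mathbb{Z})$, $\mathbb{H}$ is the upper half plane, and $GL_2^+(\mathbb{Q})$, $M_2(\mathbb{Z})^+$ are the rational, resp. integral, $2\times2$ matrices of positive determinant. $\mathbb{Q}^*$ is viewed as the scalar matrices in $GL_2(\mathbb{A}_f)$, and $M_2(\mathbb{Z})^+$ is embedded diagonally in $GL_2(\mathbb{A}_f)$; the notation $GL_2(R)\subset S$, $M_2(\mathbb{Z})^+\subset S$ refers to the maps to the quotient $S$. $Y=M_2(R)\times\mathbb{H}$. For $g=\begin{bmatrix}a&b\\c&d\end{bmatrix}\in GL_2^+(\mathbb{Q})$ and $y=(\rho,\tau)\in Y$, $gy=(g\rho,\frac{a\tau+b}{c\tau+d})$ with $g\rho\in M_2(\mathbb{A}_f)$; "$gy\in Y$" means $g\rho\in M_2(R)$. The dynamical system. Let $Z$ be the locally compact quotient of $\{(g,y)\in GL_2^+(\mathbb{Q})\times Y: gy\in Y\}$ by the action $(g,y)\mapsto(\gamma_1g\gamma_2^{-1},\gamma_2y)$ of $\Gamma\times\Gamma$. Functions on $Z$ are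 viewed as functions $f(g,y)$ with $f(\gamma g,y)=f(g,y)$ and $f(g\gamma,y)=f(g,\gamma y)$ for $\gamma\in\Gamma$. $\mathcal{A}=C_c(Z)$ has the product $(f_1*f_2)(g,y)=\sum_{h\in\Gamma\backslash GL_2^+(\mathbb{Q}),\,hy\in Y}f_1(gh^{-1},hy)f_2(h,y)$ and adjoint $f^*(g,y)=\overline{f(g^{-1},gy)}$. $A$ is the $C^*$-completion of $\mathcal{A}$ for $\|f\|=\sup_{y\in Y}\|\pi_y(f)\|$, where $(\pi_y(f)\xi)(g)=\sum_{h\in\Gamma\backslash G_y}f(gh^{-1},hy)\xi(h)$ on $\ell^2(\Gamma\backslash G_y)$, $G_y=\{g\in GL_2^+(\mathbb{Q}):gy\in Y\}$. The time evolution is $\sigma_t(f)(g,y)=(\mathrm{Det}\,g)^{it}f(g,y)$. $M(A)$ is the multiplier algebra of $A$. Symmetries. An endomorphism of $(A,\sigma_t)$ is a $*$-homomorphism $A\to A$ commuting with $\sigma_t$. An endomorphism is inner if it has the form $x\mapsto uxu^*$ with $u\in M(A)$ an isometry ($u^*u=1$) such that, for some $\lambda\in\mathbb{R}^*_+$, $\sigma_t(u)=\lambda^{it}u$ for all $t\in\mathbb{R}$. Symmetries of $(A,\sigma_t)$ are understood in the generalized sense of actions by endomorphisms, taken modulo inner ones (inner endomorphisms act trivially on KMS$_\beta$ states). This extends the notion of an action modulo inner of a group $G$ by automorphisms, i.e. a map $\alpha:G\to\mathrm{Aut}(A,\sigma_t)$ for which each $\alpha(g_1g_2)\alpha(g_2)^{-1}\alpha(g_1)^{-1}$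 is inner. The two actions. For $\gamma\in GL_2(R)$, $\theta_\gamma$ is the automorphism of $(A,\sigma_t)$ given by $\theta_\gamma(f)(g,(\rho,\tau))=f(g,(\rho\gamma,\tau))$. For $m\in M_2(\mathbb{Z})^+$ put $\tilde m=\mathrm{Det}(m)\,m^{-1}$ and $R_m=M_2(R)\tilde m\subset M_2(R)$; then $\theta_m$ is the endomorphism of $(A,\sigma_t)$ given by $\theta_m(f)(g,(\rho,\tau))=f(g,(\rho\tilde m^{-1},\tau))$ for $\rho\in R_m$ and $\theta_m(f)(g,(\rho,\tau))=0$ for $\rho\notin R_m$. *)

theory Defs
  imports "HOL-Analysis.Analysis" "HOL-Algebra.Coset" "HOL-Number_Theory.Cong"
begin

section \<open>The profinite integers\<close>

text \<open>The ring of \<open>p\<close>-adic integers as the inverse limit of the rings \<open>\<int>/p^n\<close>, with residues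
  in \<open>{0..<p^n}\<close>.\<close>

definition padic_ints :: "nat \<Rightarrow> (nat \<Rightarrow> int) set" where
  "padic_ints p = {x. \<forall>n. x n \<in> {0..<int p ^ n} \<and> x (Suc n) mod int p ^ n = x n}"

definition padic_reduce :: "nat \<Rightarrow> (nat \<Rightarrow> int) \<Rightarrow> nat \<Rightarrow> int" where
  "padic_reduce p x = (\<lambda>n. x n mod int p ^ n)"

lemma padic_reduce_in:
  assumes "prime p" "\<And>n. [x (Suc n) = x n] (mod int p ^ n)"
  shows "padic_reduce p x \<in> padic_ints p"
proof -
  have p: "int p > 0" using assms(1) prime_gt_0_nat by auto
  have "x (Suc n) mod int p ^ Suc n mod int p ^ n = x n mod int p ^ n" for n
    using assms(2)[of n] by (simp add: cong_def mod_mod_cancel)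
  then show ?thesis using p by (auto simp: padic_ints_def padic_reduce_def)
qed

lemma padic_ints_cong: "x \<in> padic_ints p \<Longrightarrow> [x (Suc n) = x n] (mod int p ^ n)"
  by (auto simp: padic_ints_def cong_def)

lemma padic_reduce_closed:
  assumes "prime p" "x \<in> padic_ints p" "y \<in> padic_ints p"
  shows "padic_reduce p (\<lambda>n. x n + y n) \<in> padic_ints p"
    and "padic_reduce p (\<lambda>n. x n - y n) \<in> padic_ints p"
    and "padic_reduce p (\<lambda>n. x n * y n) \<in> padic_ints p"
    and "padic_reduce p (\<lambda>n. - x n) \<in> padic_ints p"
  using padic_ints_cong[OF assms(2)] padic_ints_cong[OF assms(3)]
  by (auto intro!: padic_reduce_in assms(1) cong_add cong_diff cong_mult simp: cong_minus_minus_iff)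

lemma padic_ints_mod: "x \<in> padic_ints p \<Longrightarrow> x n mod int p ^ n = x n"
  by (auto simp: padic_ints_def)

typedef zhat = "\<Pi>\<^sub>E p\<in>{p::nat. prime p}. padic_ints p"
  morphisms zcomp Abs_zhat
proof -
  have "(\<lambda>p\<in>{p. prime p}. \<lambda>n. 0) \<in> (\<Pi>\<^sub>E p\<in>{p::nat. prime p}. padic_ints p)"
    by (auto simp: padic_ints_def prime_gt_0_nat)
  then show ?thesis by blast
qed

setup_lifting type_definition_zhat

instantiation zhat :: comm_ring_1
begin

lift_definition zero_zhat :: zhat is "\<lambda>p\<in>{p. prime p}. padic_reduce p (\<lambda>n. 0)"
  by (intro PiE_I) (auto intro!: padic_reduce_in)

lift_definition one_zhat :: zhat is "\<lambda>p\<in>{p. prime p}. padic_reduce p (\<lambda>n. 1)"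
  by (intro PiE_I) (auto intro!: padic_reduce_in)

lift_definition plus_zhat :: "zhat \<Rightarrow> zhat \<Rightarrow> zhat"
  is "\<lambda>x y. \<lambda>p\<in>{p. prime p}. padic_reduce p (\<lambda>n. x p n + y p n)"
  by (intro PiE_I) (auto intro!: padic_reduce_closed)

lift_definition minus_zhat :: "zhat \<Rightarrow> zhat \<Rightarrow> zhat"
  is "\<lambda>x y. \<lambda>p\<in>{p. prime p}. padic_reduce p (\<lambda>n. x p n - y p n)"
  by (intro PiE_I) (auto intro!: padic_reduce_closed)

lift_definition uminus_zhat :: "zhat \<Rightarrow> zhat"
  is "\<lambda>x. \<lambda>p\<in>{p. prime p}. padic_reduce p (\<lambda>n. - x p n)"
  by (intro PiE_I) (auto intro!: padic_reduce_closed)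

lift_definition times_zhat :: "zhat \<Rightarrow> zhat \<Rightarrow> zhat"
  is "\<lambda>x y. \<lambda>p\<in>{p. prime p}. padic_reduce p (\<lambda>n. x p n * y p n)"
  by (intro PiE_I) (auto intro!: padic_reduce_closed)

instance
proof
  fix a b c :: zhat
  show "a * b * c = a * (b * c)"
    by transfer (auto simp: fun_eq_iff padic_reduce_def mod_simps algebra_simps)
  show "a * b = b * a"
    by transfer (auto simp: fun_eq_iff padic_reduce_def mult.commute)
  show "1 * a = a"
    by transfer (auto simp: fun_eq_iff padic_reduce_def mod_simps padic_ints_mod PiE_iff extensional_def)
  show "a + b + c = a + (b + c)"
    by transfer (auto simp: fun_eq_iff padic_reduce_def mod_simps algebra_simps)
  show "a + b = b + a"
    by transfer (auto simp: fun_eq_iff padic_reduce_def add.commute)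
  show "0 + a = a"
    by transfer (auto simp: fun_eq_iff padic_reduce_def mod_simps padic_ints_mod PiE_iff extensional_def)
  show "- a + a = 0"
    by transfer (auto simp: fun_eq_iff padic_reduce_def mod_simps)
  show "a - b = a + - b"
    by transfer (auto simp: fun_eq_iff padic_reduce_def mod_simps)
  show "(a + b) * c = a * c + b * c"
    by transfer (auto simp: fun_eq_iff padic_reduce_def mod_simps algebra_simps)
  show "(0::zhat) \<noteq> 1"
  proof
    assume "(0::zhat) = 1"
    then have "zcomp 0 2 1 = zcomp 1 2 1" by simp
    then show False by (simp add: zero_zhat.rep_eq one_zhat.rep_eq padic_reduce_def)
  qed
qed

end

text \<open>The product over \<open>p\<close> of the \<open>p\<close>-adic topologies; \<open>int\<close> is discrete and function types carry
  the product topology.\<close>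

instantiation zhat :: topological_space
begin

definition open_zhat :: "zhat set \<Rightarrow> bool" where
  "open_zhat U \<longleftrightarrow> (\<exists>V. open V \<and> U = zcomp -` V)"

instance
proof
  show "open (UNIV :: zhat set)" unfolding open_zhat_def by (intro exI[of _ UNIV]) auto
next
  fix S T :: "zhat set" assume "open S" "open T"
  then obtain V W where "open V" "S = zcomp -` V" "open W" "T = zcomp -` W"
    unfolding open_zhat_def by blast
  then show "open (S \<inter> T)"
    unfolding open_zhat_def by (intro exI[of _ "V \<inter> W"]) auto
next
  fix K :: "zhat set set" assume "\<forall>S\<in>K. open S"
  then obtain V where V: "\<And>S. S \<in> K \<Longrightarrow> open (V S) \<and> S = zcomp -` V S"
    unfolding open_zhat_def by metis
  then show "open (\<Union>K)"
    unfolding open_zhat_def by (intro exI[of _ "\<Union>(V ` K)"]) auto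
qed

end

lemma zcomp_of_nat: "prime p \<Longrightarrow> zcomp (of_nat k) p n = int k mod int p ^ n"
  by (induction k) (auto simp: zero_zhat.rep_eq one_zhat.rep_eq plus_zhat.rep_eq padic_reduce_def mod_simps)

lemma zcomp_of_int: "prime p \<Longrightarrow> zcomp (of_int k) p n = k mod int p ^ n"
proof (cases k rule: int_cases2)
  case (nonpos m)
  assume "prime p"
  then show ?thesis
    using nonpos by (simp add: uminus_zhat.rep_eq padic_reduce_def zcomp_of_nat mod_simps)
qed (simp add: zcomp_of_nat)

lemma zhat_torsion_free:
  assumes "of_int d * (x::zhat) = 0" "d \<noteq> 0"
  shows "x = 0"
proof -
  have "zcomp x p n = 0" if p: "prime p" for p n
  proof -
    have pi: "prime (int p)" using p by simp
    define v where "v = multiplicity (int p) d"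
    obtain e where e: "d = int p ^ v * e" "\<not> int p dvd e"
      unfolding v_def using multiplicity_decompose'[of d "int p"] assms(2) pi
      by (metis not_prime_unit)
    have xp: "zcomp x p \<in> padic_ints p" using zcomp[of x] p by auto
    have red: "zcomp x p (n + k) mod int p ^ n = zcomp x p n" for k
    proof (induction k)
      case 0
      then show ?case using padic_ints_mod[OF xp] by simp
    next
      case (Suc k)
      have "zcomp x p (n + Suc k) mod int p ^ (n + k) mod int p ^ n = zcomp x p (n + Suc k) mod int p ^ n"
        by (simp add: mod_mod_cancel le_imp_power_dvd)
      then show ?case using Suc xp by (auto simp: padic_ints_def)
    qed
    have "zcomp (of_int d * x) p (n + v) = 0"
      using assms(1) p by (simp add: zero_zhat.rep_eq padic_reduce_def)
    then have "int p ^ (n + v) dvd d * zcomp x p (n + v)"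
      using p by (simp add: times_zhat.rep_eq padic_reduce_def zcomp_of_int mod_simps mod_eq_0_iff_dvd)
    then have "int p ^ n dvd e * zcomp x p (n + v)"
      using e(1) p by (simp add: power_add mult.assoc mult.commute[of "int p ^ n"] prime_gt_0_nat)
    moreover have "coprime (int p ^ n) e"
      using e(2) pi by (simp add: prime_imp_coprime)
    ultimately have "int p ^ n dvd zcomp x p (n + v)"
      by (simp add: coprime_dvd_mult_right_iff)
    then show ?thesis using red[of v] by auto
  qed
  then have "zcomp x = zcomp 0"
    using zcomp[of x] by (auto simp: fun_eq_iff zero_zhat.rep_eq padic_reduce_def PiE_iff extensional_def)
  then show ?thesis by (simp add: zcomp_inject)
qed

section \<open>The finite adeles\<close>

text \<open>\<open>R \<otimes> \<rat>\<close> as the localization of \<open>R\<close> at the nonzero integers.\<close>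

definition adelerel :: "zhat \<times> int \<Rightarrow> zhat \<times> int \<Rightarrow> bool" where
  "adelerel x y \<longleftrightarrow> snd x \<noteq> 0 \<and> snd y \<noteq> 0 \<and> fst x * of_int (snd y) = fst y * of_int (snd x)"

lemma part_equivp_adelerel: "part_equivp adelerel"
proof (rule part_equivpI)
  show "\<exists>x. adelerel x x" by (intro exI[of _ "(0, 1)"]) (simp add: adelerel_def)
  show "symp adelerel" by (auto simp: symp_def adelerel_def)
  show "transp adelerel"
  proof (rule transpI)
    fix x y z assume *: "adelerel x y" "adelerel y z"
    have "of_int (snd y) * (fst x * of_int (snd z) - fst z * of_int (snd x)) = 0"
    proof -
      have "of_int (snd y) * (fst x * of_int (snd z)) = (fst x * of_int (snd y)) * of_int (snd z)"
        by (simp add: ac_simps)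
      also have "\<dots> = (fst y * of_int (snd x)) * of_int (snd z)"
        using * by (simp add: adelerel_def)
      also have "\<dots> = (fst y * of_int (snd z)) * of_int (snd x)"
        by (simp add: ac_simps)
      also have "\<dots> = (fst z * of_int (snd y)) * of_int (snd x)"
        using * by (simp add: adelerel_def)
      also have "\<dots> = of_int (snd y) * (fst z * of_int (snd x))"
        by (simp add: ac_simps)
      finally show ?thesis by (simp add: algebra_simps)
    qed
    then show "adelerel x z"
      using * zhat_torsion_free by (fastforce simp: adelerel_def)
  qed
qed

lifting_forget zhat.lifting

quotient_type adele = "zhat \<times> int" / partial: adelerel
  by (rule part_equivp_adelerel)

instantiation adele :: comm_ring_1
begin

lift_definition zero_adele :: adele is "(0, 1)" by (simp add: adelerel_def)

lift_definition one_adele :: adele is "(1, 1)" by (simp add: adelerel_def)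

lift_definition plus_adele :: "adele \<Rightarrow> adele \<Rightarrow> adele"
  is "\<lambda>x y. (fst x * of_int (snd y) + fst y * of_int (snd x), snd x * snd y)"
proof -
  fix a a' b b' assume *: "adelerel a a'" "adelerel b b'"
  have "fst a * of_int (snd b) * (of_int (snd a') * of_int (snd b'))
      = (fst a * of_int (snd a')) * (of_int (snd b) * of_int (snd b'))" by (simp add: ac_simps)
  also have "\<dots> = fst a' * of_int (snd b') * (of_int (snd a) * of_int (snd b))"
    using * by (simp add: adelerel_def ac_simps)
  finally have 1: "fst a * of_int (snd b) * (of_int (snd a') * of_int (snd b'))
      = fst a' * of_int (snd b') * (of_int (snd a) * of_int (snd b))" .
  have "fst b * of_int (snd a) * (of_int (snd a') * of_int (snd b'))
      = (fst b * of_int (snd b')) * (of_int (snd a) * of_int (snd a'))" by (simp add: ac_simps)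
  also have "\<dots> = fst b' * of_int (snd a') * (of_int (snd a) * of_int (snd b))"
    using * by (simp add: adelerel_def ac_simps)
  finally have 2: "fst b * of_int (snd a) * (of_int (snd a') * of_int (snd b'))
      = fst b' * of_int (snd a') * (of_int (snd a) * of_int (snd b))" .
  show "adelerel (fst a * of_int (snd b) + fst b * of_int (snd a), snd a * snd b)
      (fst a' * of_int (snd b') + fst b' * of_int (snd a'), snd a' * snd b')"
    using * 1 2 by (simp add: adelerel_def distrib_right)
qed

lift_definition uminus_adele :: "adele \<Rightarrow> adele" is "\<lambda>x. (- fst x, snd x)"
  by (simp add: adelerel_def)

definition minus_adele :: "adele \<Rightarrow> adele \<Rightarrow> adele" where
  "minus_adele x y = x + - y"

lift_definition times_adele :: "adele \<Rightarrow> adele \<Rightarrow> adele"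
  is "\<lambda>x y. (fst x * fst y, snd x * snd y)"
proof -
  fix a a' b b' assume *: "adelerel a a'" "adelerel b b'"
  have "fst a * fst b * (of_int (snd a') * of_int (snd b'))
      = (fst a * of_int (snd a')) * (fst b * of_int (snd b'))" by (simp add: ac_simps)
  also have "\<dots> = fst a' * fst b' * (of_int (snd a) * of_int (snd b))"
    using * by (simp add: adelerel_def ac_simps)
  finally show "adelerel (fst a * fst b, snd a * snd b) (fst a' * fst b', snd a' * snd b')"
    using * by (simp add: adelerel_def)
qed

instance
proof
  fix a b c :: adele
  show "a * b * c = a * (b * c)" by transfer (simp add: adelerel_def ac_simps)
  show "a * b = b * a" by transfer (simp add: adelerel_def ac_simps)
  show "1 * a = a" by transfer (simp add: adelerel_def)
  show "a + b + c = a + (b + c)" by transfer (simp add: adelerel_def algebra_simps)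
  show "a + b = b + a" by transfer (simp add: adelerel_def algebra_simps)
  show "0 + a = a" by transfer (simp add: adelerel_def)
  show "- a + a = 0" by transfer (simp add: adelerel_def)
  show "a - b = a + - b" by (simp add: minus_adele_def)
  show "(a + b) * c = a * c + b * c" by transfer (simp add: adelerel_def algebra_simps)
  show "(0::adele) \<noteq> 1" by transfer (simp add: adelerel_def)
qed

end

lift_definition adele_frac :: "zhat \<Rightarrow> int \<Rightarrow> adele"
  is "\<lambda>x n. if n = 0 then (0, 1) else (x, n)"
  by (simp add: adelerel_def)

definition adele_of_zhat :: "zhat \<Rightarrow> adele" where
  "adele_of_zhat x = adele_frac x 1"

definition adele_of_rat :: "rat \<Rightarrow> adele" where
  "adele_of_rat q = (case quotient_of q of (a, b) \<Rightarrow> adele_frac (of_int a) b)"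

text \<open>The locally compact topology of the finite adeles is the inductive limit of the topologies of
  the subgroups \<open>(1/n) R\<close>.\<close>

instantiation adele :: topological_space
begin

definition open_adele :: "adele set \<Rightarrow> bool" where
  "open_adele U \<longleftrightarrow> (\<forall>n>0. open ((\<lambda>x. adele_frac x n) -` U))"

instance
proof
  show "open (UNIV :: adele set)" by (simp add: open_adele_def)
next
  fix S T :: "adele set" assume "open S" "open T"
  then show "open (S \<inter> T)" by (simp add: open_adele_def vimage_Int open_Int)
next
  fix K :: "adele set set" assume "\<forall>S\<in>K. open S"
  then show "open (\<Union>K)" by (auto simp: open_adele_def vimage_Union intro!: open_UN)
qed

end

lemma adele_frac_eq_iff:
  "a \<noteq> 0 \<Longrightarrow> b \<noteq> 0 \<Longrightarrow> adele_frac x a = adele_frac y b \<longleftrightarrow> x * of_int b = y * of_int a"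
  by transfer (simp add: adelerel_def)

lemma adele_frac_mult:
  "a \<noteq> 0 \<Longrightarrow> b \<noteq> 0 \<Longrightarrow> adele_frac x a * adele_frac y b = adele_frac (x * y) (a * b)"
  by transfer (simp add: adelerel_def)

lemma adele_of_rat_Fract: "b \<noteq> 0 \<Longrightarrow> adele_of_rat (Fract a b) = adele_frac (of_int a) b"
proof -
  assume b: "b \<noteq> 0"
  obtain c d where cd: "quotient_of (Fract a b) = (c, d)" by fastforce
  have "d > 0" using quotient_of_denom_pos[OF cd] .
  moreover have "Fract a b = Fract c d"
    using quotient_of_div[OF cd] by (simp add: Fract_of_int_quotient)
  ultimately have "a * d = c * b" "d \<noteq> 0" using b by (auto simp: eq_rat)
  then show ?thesis
    using b by (simp add: adele_of_rat_def cd adele_frac_eq_iff flip: of_int_mult)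
qed

lemma adele_of_rat_1: "adele_of_rat 1 = 1"
  unfolding One_rat_def by (subst adele_of_rat_Fract) (simp, transfer, simp add: adelerel_def)

lemma adele_of_rat_mult: "adele_of_rat (p * q) = adele_of_rat p * adele_of_rat q"
  by (cases p, cases q) (simp add: adele_of_rat_Fract adele_frac_mult)

section \<open>The group \<open>S\<close>\<close>

definition GL2Af :: "(adele^2^2) monoid" where
  "GL2Af = \<lparr>carrier = {x. invertible x}, mult = (**), one = mat 1\<rparr>"

definition Qstar :: "(adele^2^2) set" where
  "Qstar = {mat (adele_of_rat q) | q. q \<noteq> 0}"

definition S_group :: "(adele^2^2) set monoid" where
  "S_group = GL2Af Mod Qstar"

definition S_class :: "adele^2^2 \<Rightarrow> (adele^2^2) set" where
  "S_class x = Qstar #>\<^bsub>GL2Af\<^esub> x"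

lemma group_GL2Af: "group GL2Af"
proof (rule groupI)
  fix x assume "x \<in> carrier GL2Af"
  then obtain y where "y ** x = mat 1" "x ** y = mat 1" by (auto simp: GL2Af_def invertible_def)
  then show "\<exists>y\<in>carrier GL2Af. y \<otimes>\<^bsub>GL2Af\<^esub> x = \<one>\<^bsub>GL2Af\<^esub>"
    by (auto simp: GL2Af_def invertible_def)
qed (auto simp: GL2Af_def invertible_mult matrix_mul_assoc invertible_def[of "mat 1"])

lemma mat_mult_mat: "mat a ** mat b = (mat (a * b) :: adele^2^2)"
  by (auto simp: matrix_matrix_mult_def mat_def vec_eq_iff sum_2 forall_2)

lemma mat_commute: "mat a ** x = x ** mat a" for x :: "adele^2^2"
  by (auto simp: matrix_matrix_mult_def mat_def vec_eq_iff sum_2 forall_2 mult.commute)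

lemma Qstar_mult_inverse: "q \<noteq> 0 \<Longrightarrow>
  (mat (adele_of_rat q) :: adele^2^2) ** mat (adele_of_rat (inverse q)) = mat 1"
  by (simp add: mat_mult_mat adele_of_rat_1 flip: adele_of_rat_mult)

lemma Qstar_subset: "Qstar \<subseteq> carrier GL2Af"
proof
  fix x assume "x \<in> Qstar"
  then obtain q where q: "q \<noteq> 0" "x = mat (adele_of_rat q)" by (auto simp: Qstar_def)
  then have "x ** mat (adele_of_rat (inverse q)) = mat 1" using Qstar_mult_inverse by blast
  then show "x \<in> carrier GL2Af"
    using mat_commute[of "adele_of_rat (inverse q)" x] by (auto simp: GL2Af_def invertible_def)
qed

lemma Qstar_normal: "Qstar \<lhd> GL2Af"
proof -
  interpret group GL2Af by (rule group_GL2Af)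
  have "subgroup Qstar GL2Af"
  proof (rule subgroupI)
    show "Qstar \<subseteq> carrier GL2Af" by (rule Qstar_subset)
    show "Qstar \<noteq> {}" by (auto simp: Qstar_def intro: exI[of _ 1])
  next
    fix x assume x: "x \<in> Qstar"
    then obtain q where q: "q \<noteq> 0" "x = mat (adele_of_rat q)" by (auto simp: Qstar_def)
    define y where "y = (mat (adele_of_rat (inverse q)) :: adele^2^2)"
    have y: "y \<in> Qstar" using q by (auto simp: Qstar_def y_def)
    have "x ** y = mat 1" using q Qstar_mult_inverse by (simp add: y_def)
    then have "inv\<^bsub>GL2Af\<^esub> x = y"
      using x y Qstar_subset mat_commute[of "adele_of_rat q" y]
      by (intro inv_equality) (auto simp: GL2Af_def q)
    then show "inv\<^bsub>GL2Af\<^esub> x \<in> Qstar" using y by simp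
  next
    fix x y assume "x \<in> Qstar" "y \<in> Qstar"
    then obtain p q where "p \<noteq> 0" "q \<noteq> 0" "x = mat (adele_of_rat p)" "y = mat (adele_of_rat q)"
      by (auto simp: Qstar_def)
    then show "x \<otimes>\<^bsub>GL2Af\<^esub> y \<in> Qstar"
      by (auto simp: Qstar_def GL2Af_def mat_mult_mat simp flip: adele_of_rat_mult intro!: exI[of _ "p * q"])
  qed
  then show ?thesis
  proof (rule normalI)
    show "\<forall>x\<in>carrier GL2Af. Qstar #>\<^bsub>GL2Af\<^esub> x = x <#\<^bsub>GL2Af\<^esub> Qstar"
      by (auto simp: r_coset_def l_coset_def GL2Af_def Qstar_def mat_commute)
  qed
qed

lemma group_S: "group S_group"
  unfolding S_group_def by (rule normal.factorgroup_is_group[OF Qstar_normal])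

section \<open>The space \<open>Z\<close> and the convolution algebra\<close>

definition GL2Qp :: "(rat^2^2) set" where
  "GL2Qp = {g. det g > 0}"

definition SL2Z :: "(rat^2^2) set" where
  "SL2Z = {map_matrix of_int \<gamma> | \<gamma> :: int^2^2. det \<gamma> = 1}"

definition M2R :: "(adele^2^2) set" where
  "M2R = range (map_matrix adele_of_zhat)"

definition Y_space :: "((adele^2^2) \<times> complex) set" where
  "Y_space = M2R \<times> {\<tau>. Im \<tau> > 0}"

definition moebius :: "rat^2^2 \<Rightarrow> complex \<Rightarrow> complex" where
  "moebius g \<tau> = (of_rat (g$1$1) * \<tau> + of_rat (g$1$2)) / (of_rat (g$2$1) * \<tau> + of_rat (g$2$2))"

definition act :: "rat^2^2 \<Rightarrow> (adele^2^2) \<times> complex \<Rightarrow> (adele^2^2) \<times> complex" where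
  "act g y = (map_matrix adele_of_rat g ** fst y, moebius g (snd y))"

definition G_at :: "(adele^2^2) \<times> complex \<Rightarrow> (rat^2^2) set" where
  "G_at y = {g \<in> GL2Qp. act g y \<in> Y_space}"

definition U_space :: "((rat^2^2) \<times> ((adele^2^2) \<times> complex)) set" where
  "U_space = {(g, y). y \<in> Y_space \<and> g \<in> G_at y}"

text \<open>\<open>GL\<^sub>2\<^sup>+(\<rat>)\<close> is discrete; \<open>Y_space\<close> is topologized as a subspace of \<open>M\<^sub>2(A\<^sub>f) \<times> \<complex>\<close>, which induces
  on \<open>M\<^sub>2(R)\<close> its profinite topology.\<close>

definition U_top :: "((rat^2^2) \<times> ((adele^2^2) \<times> complex)) topology" where
  "U_top = subtopology (prod_topology (discrete_topology GL2Qp) euclidean) U_space"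

definition Z_proj :: "(rat^2^2) \<times> ((adele^2^2) \<times> complex) \<Rightarrow> ((rat^2^2) \<times> ((adele^2^2) \<times> complex)) set" where
  "Z_proj u = {(\<gamma>\<^sub>1 ** fst u ** matrix_inv \<gamma>\<^sub>2, act \<gamma>\<^sub>2 (snd u)) | \<gamma>\<^sub>1 \<gamma>\<^sub>2. \<gamma>\<^sub>1 \<in> SL2Z \<and> \<gamma>\<^sub>2 \<in> SL2Z}"

definition Z_top :: "((rat^2^2) \<times> ((adele^2^2) \<times> complex)) set topology" where
  "Z_top = topology (\<lambda>W. W \<subseteq> Z_proj ` U_space \<and> openin U_top {u \<in> U_space. Z_proj u \<in> W})"

lemma topspace_U_top: "topspace U_top = U_space"
  by (auto simp: U_top_def U_space_def G_at_def)

lemma openin_Z_top: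
  "openin Z_top W \<longleftrightarrow> W \<subseteq> Z_proj ` U_space \<and> openin U_top {u \<in> U_space. Z_proj u \<in> W}"
proof -
  have "istopology (\<lambda>W. W \<subseteq> Z_proj ` U_space \<and> openin U_top {u \<in> U_space. Z_proj u \<in> W})"
    unfolding istopology_def
  proof (intro conjI allI impI)
    fix S T
    assume a: "S \<subseteq> Z_proj ` U_space \<and> openin U_top {u \<in> U_space. Z_proj u \<in> S}"
      "T \<subseteq> Z_proj ` U_space \<and> openin U_top {u \<in> U_space. Z_proj u \<in> T}"
    show "S \<inter> T \<subseteq> Z_proj ` U_space" using a by blast
    have "{u \<in> U_space. Z_proj u \<in> S \<inter> T} = {u \<in> U_space. Z_proj u \<in> S} \<inter> {u \<in> U_space. Z_proj u \<in> T}" by blast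
    then show "openin U_top {u \<in> U_space. Z_proj u \<in> S \<inter> T}" using a by (simp add: openin_Int)
  next
    fix K assume a: "\<forall>S\<in>K. S \<subseteq> Z_proj ` U_space \<and> openin U_top {u \<in> U_space. Z_proj u \<in> S}"
    show "\<Union>K \<subseteq> Z_proj ` U_space" using a by blast
    have "{u \<in> U_space. Z_proj u \<in> \<Union>K} = (\<Union>S\<in>K. {u \<in> U_space. Z_proj u \<in> S})" by blast
    then show "openin U_top {u \<in> U_space. Z_proj u \<in> \<Union>K}" using a by auto
  qed
  then show ?thesis unfolding Z_top_def by (subst topology_inverse') (rule refl | assumption)+
qed

lemma topspace_Z_top: "topspace Z_top = Z_proj ` U_space"
proof (rule subset_antisym)
  show "topspace Z_top \<subseteq> Z_proj ` U_space" using openin_Z_top[of "topspace Z_top"] by simp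
  have "{u \<in> U_space. Z_proj u \<in> Z_proj ` U_space} = topspace U_top" by (auto simp: topspace_U_top)
  then have "openin Z_top (Z_proj ` U_space)" 
    by (simp only: openin_Z_top openin_topspace) blast
  then show "Z_proj ` U_space \<subseteq> topspace Z_top" by (rule openin_subset)
qed

lemma quotient_map_Z_proj: "quotient_map U_top Z_top Z_proj"
  by (auto simp: quotient_map_def topspace_U_top topspace_Z_top openin_Z_top)

text \<open>Functions on \<open>Z\<close> are viewed as functions of \<open>(g, y)\<close>, extended by zero off \<open>U_space\<close>.\<close>

type_synonym hfun = "rat^2^2 \<Rightarrow> (adele^2^2) \<times> complex \<Rightarrow> complex"

definition extend0 :: "hfun \<Rightarrow> hfun" where
  "extend0 f = (\<lambda>g y. if (g, y) \<in> U_space then f g y else 0)"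

definition Cc_Z :: "hfun set" where
  "Cc_Z = {extend0 (\<lambda>g y. F (Z_proj (g, y))) | F.
     continuous_map Z_top euclidean F \<and>
     compactin Z_top (Z_top closure_of {z \<in> topspace Z_top. F z \<noteq> 0})}"

definition left_cosets :: "(rat^2^2) set \<Rightarrow> (rat^2^2) set set" where
  "left_cosets D = (\<lambda>h. {\<gamma> ** h | \<gamma>. \<gamma> \<in> SL2Z}) ` D"

definition coset_rep :: "(rat^2^2) set \<Rightarrow> rat^2^2" where
  "coset_rep C = (SOME h. h \<in> C)"

definition conv :: "hfun \<Rightarrow> hfun \<Rightarrow> hfun" where
  "conv f\<^sub>1 f\<^sub>2 = extend0 (\<lambda>g y.
     \<Sum>\<^sub>\<infinity>C\<in>left_cosets (G_at y). f\<^sub>1 (g ** matrix_inv (coset_rep C)) (act (coset_rep C) y) * f\<^sub>2 (coset_rep C) y)"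

definition hadj :: "hfun \<Rightarrow> hfun" where
  "hadj f = extend0 (\<lambda>g y. cnj (f (matrix_inv g) (act g y)))"

text \<open>Vectors of \<open>\<ell>\<^sup>2(\<Gamma>\<backslash>G\<^sub>y)\<close> are \<open>\<Gamma>\<close>-invariant functions on \<open>G\<^sub>y\<close>, extended by zero.\<close>

definition l2norm :: "(adele^2^2) \<times> complex \<Rightarrow> (rat^2^2 \<Rightarrow> complex) \<Rightarrow> ennreal" where
  "l2norm y \<xi> = (SUP F\<in>{F. finite F \<and> F \<subseteq> left_cosets (G_at y)}.
     ennreal (L2_set (\<lambda>C. cmod (\<xi> (coset_rep C))) F))"

definition l2space :: "(adele^2^2) \<times> complex \<Rightarrow> (rat^2^2 \<Rightarrow> complex) set" where
  "l2space y = {\<xi>. (\<forall>g. g \<notin> G_at y \<longrightarrow> \<xi> g = 0) \<and>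
     (\<forall>\<gamma>\<in>SL2Z. \<forall>g\<in>G_at y. \<xi> (\<gamma> ** g) = \<xi> g) \<and> l2norm y \<xi> < \<infinity>}"

definition pi_rep :: "(adele^2^2) \<times> complex \<Rightarrow> hfun \<Rightarrow> (rat^2^2 \<Rightarrow> complex) \<Rightarrow> rat^2^2 \<Rightarrow> complex" where
  "pi_rep y f \<xi> g = (if g \<in> G_at y
     then \<Sum>\<^sub>\<infinity>C\<in>left_cosets (G_at y). f (g ** matrix_inv (coset_rep C)) (act (coset_rep C) y) * \<xi> (coset_rep C)
     else 0)"

definition hnorm :: "hfun \<Rightarrow> ennreal" where
  "hnorm f = (SUP y\<in>Y_space. SUP \<xi>\<in>{\<xi> \<in> l2space y. l2norm y \<xi> \<le> 1}. l2norm y (pi_rep y f \<xi>))"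

section \<open>C*-algebras, multipliers and endomorphisms modulo inner\<close>

class cstar_algebra = banach + real_normed_algebra +
  fixes scaleC :: "complex \<Rightarrow> 'a \<Rightarrow> 'a" (infixr \<open>*\<^sub>C\<close> 75)
    and star :: "'a \<Rightarrow> 'a"
  assumes scaleC_add_right: "c *\<^sub>C (x + y) = c *\<^sub>C x + c *\<^sub>C y"
    and scaleC_add_left: "(c + d) *\<^sub>C x = c *\<^sub>C x + d *\<^sub>C x"
    and scaleC_scaleC: "c *\<^sub>C (d *\<^sub>C x) = (c * d) *\<^sub>C x"
    and scaleC_of_real: "complex_of_real r *\<^sub>C x = r *\<^sub>R x"
    and norm_scaleC: "norm (c *\<^sub>C x) = cmod c * norm x"
    and scaleC_mult_left: "(c *\<^sub>C x) * y = c *\<^sub>C (x * y)"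
    and scaleC_mult_right: "x * (c *\<^sub>C y) = c *\<^sub>C (x * y)"
    and star_star: "star (star x) = x"
    and star_add: "star (x + y) = star x + star y"
    and star_scaleC: "star (c *\<^sub>C x) = cnj c *\<^sub>C star x"
    and star_mult: "star (x * y) = star y * star x"
    and cstar_identity: "norm (star x * x) = norm x ^ 2"

text \<open>The multiplier algebra as the algebra of double centralizers \<open>(L, R)\<close>; linearity, boundedness
  and the module properties of \<open>L\<close> and \<open>R\<close> are automatic.\<close>

type_synonym 'a dc = "('a \<Rightarrow> 'a) \<times> ('a \<Rightarrow> 'a)"

definition multipliers :: "'a::cstar_algebra dc set" where
  "multipliers = {(L, R). \<forall>a b. a * L b = R a * b}"

definition m_of :: "'a::cstar_algebra \<Rightarrow> 'a dc" where
  "m_of a = ((\<lambda>b. a * b), (\<lambda>b. b * a))"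

definition m_one :: "'a::cstar_algebra dc" where
  "m_one = (id, id)"

definition m_mult :: "'a::cstar_algebra dc \<Rightarrow> 'a dc \<Rightarrow> 'a dc" where
  "m_mult u v = (fst u \<circ> fst v, snd v \<circ> snd u)"

definition m_star :: "'a::cstar_algebra dc \<Rightarrow> 'a dc" where
  "m_star u = ((\<lambda>a. star (snd u (star a))), (\<lambda>a. star (fst u (star a))))"

definition m_scale :: "complex \<Rightarrow> 'a::cstar_algebra dc \<Rightarrow> 'a dc" where
  "m_scale c u = ((\<lambda>a. c *\<^sub>C fst u a), (\<lambda>a. c *\<^sub>C snd u a))"

definition m_evol :: "(real \<Rightarrow> 'a::cstar_algebra \<Rightarrow> 'a) \<Rightarrow> real \<Rightarrow> 'a dc \<Rightarrow> 'a dc" where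
  "m_evol \<sigma> t u = (\<sigma> t \<circ> fst u \<circ> \<sigma> (- t), \<sigma> t \<circ> snd u \<circ> \<sigma> (- t))"

definition star_hom :: "('a::cstar_algebra \<Rightarrow> 'a) \<Rightarrow> bool" where
  "star_hom \<phi> \<longleftrightarrow> (\<forall>x y. \<phi> (x + y) = \<phi> x + \<phi> y) \<and> (\<forall>c x. \<phi> (c *\<^sub>C x) = c *\<^sub>C \<phi> x) \<and>
     (\<forall>x y. \<phi> (x * y) = \<phi> x * \<phi> y) \<and> (\<forall>x. \<phi> (star x) = star (\<phi> x))"

definition Endo :: "(real \<Rightarrow> 'a::cstar_algebra \<Rightarrow> 'a) \<Rightarrow> ('a \<Rightarrow> 'a) set" where
  "Endo \<sigma> = {\<phi>. star_hom \<phi> \<and> (\<forall>t. \<phi> \<circ> \<sigma> t = \<sigma> t \<circ> \<phi>)}"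

definition Inner :: "(real \<Rightarrow> 'a::cstar_algebra \<Rightarrow> 'a) \<Rightarrow> ('a \<Rightarrow> 'a) set" where
  "Inner \<sigma> = {\<phi> \<in> Endo \<sigma>. \<exists>u\<in>multipliers.
     m_mult (m_star u) u = m_one \<and>
     (\<exists>l>0. \<forall>t. m_evol \<sigma> t u = m_scale (complex_of_real l powr (\<i> * complex_of_real t)) u) \<and>
     (\<forall>x. m_of (\<phi> x) = m_mult (m_mult u (m_of x)) (m_star u))}"

text \<open>Inner endomorphisms need not be invertible, so equality modulo inner is
  \<open>I \<circ> \<phi> = J \<circ> \<psi>\<close> with \<open>I, J\<close> inner; for automorphisms this says that \<open>\<psi> \<circ> \<phi>\<^sup>-\<^sup>1\<close> is inner.\<close>

definition eq_mod_inner :: "(real \<Rightarrow> 'a::cstar_algebra \<Rightarrow> 'a) \<Rightarrow> ('a \<Rightarrow> 'a) \<Rightarrow> ('a \<Rightarrow> 'a) \<Rightarrow> bool" where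
  "eq_mod_inner \<sigma> \<phi> \<psi> \<longleftrightarrow> \<phi> \<in> Endo \<sigma> \<and> \<psi> \<in> Endo \<sigma> \<and> (\<exists>I\<in>Inner \<sigma>. \<exists>J\<in>Inner \<sigma>. I \<circ> \<phi> = J \<circ> \<psi>)"

definition symmetry_action ::
    "(real \<Rightarrow> 'a::cstar_algebra \<Rightarrow> 'a) \<Rightarrow> 's monoid \<Rightarrow> ('s \<Rightarrow> 'a \<Rightarrow> 'a) \<Rightarrow> bool" where
  "symmetry_action \<sigma> G \<alpha> \<longleftrightarrow> group G \<and> (\<forall>s\<in>carrier G. \<alpha> s \<in> Endo \<sigma>) \<and>
     eq_mod_inner \<sigma> (\<alpha> \<one>\<^bsub>G\<^esub>) id \<and>
     (\<forall>s\<in>carrier G. \<forall>t\<in>carrier G. eq_mod_inner \<sigma> (\<alpha> (s \<otimes>\<^bsub>G\<^esub> t)) (\<alpha> s \<circ> \<alpha> t))"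

section \<open>The system \<open>(A, \<sigma>\<^sub>t)\<close> and the two actions\<close>

text \<open>\<open>\<iota>\<close> exhibits the C*-algebra \<open>'a\<close> as the completion of \<open>C\<^sub>c(Z)\<close>; this determines \<open>'a\<close> up to
  a unique isomorphism compatible with \<open>\<iota>\<close>.\<close>

definition is_completion :: "(hfun \<Rightarrow> 'a::cstar_algebra) \<Rightarrow> bool" where
  "is_completion \<iota> \<longleftrightarrow>
     (\<forall>f\<^sub>1\<in>Cc_Z. \<forall>f\<^sub>2\<in>Cc_Z. \<iota> (\<lambda>g y. f\<^sub>1 g y + f\<^sub>2 g y) = \<iota> f\<^sub>1 + \<iota> f\<^sub>2) \<and>
     (\<forall>c. \<forall>f\<in>Cc_Z. \<iota> (\<lambda>g y. c * f g y) = c *\<^sub>C \<iota> f) \<and>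
     (\<forall>f\<^sub>1\<in>Cc_Z. \<forall>f\<^sub>2\<in>Cc_Z. \<iota> (conv f\<^sub>1 f\<^sub>2) = \<iota> f\<^sub>1 * \<iota> f\<^sub>2) \<and>
     (\<forall>f\<in>Cc_Z. \<iota> (hadj f) = star (\<iota> f)) \<and>
     (\<forall>f\<in>Cc_Z. ennreal (norm (\<iota> f)) = hnorm f) \<and>
     closure (\<iota> ` Cc_Z) = UNIV"

definition extension :: "(hfun \<Rightarrow> 'a::cstar_algebra) \<Rightarrow> (hfun \<Rightarrow> hfun) \<Rightarrow> 'a \<Rightarrow> 'a" where
  "extension \<iota> T = (THE \<Phi>. continuous_on UNIV \<Phi> \<and> (\<forall>f\<in>Cc_Z. \<Phi> (\<iota> f) = \<iota> (T f)))"

definition evol :: "(hfun \<Rightarrow> 'a::cstar_algebra) \<Rightarrow> real \<Rightarrow> 'a \<Rightarrow> 'a" where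
  "evol \<iota> t = extension \<iota> (\<lambda>f g y.
     complex_of_real (real_of_rat (det g)) powr (\<i> * complex_of_real t) * f g y)"

definition theta_GL2R :: "(hfun \<Rightarrow> 'a::cstar_algebra) \<Rightarrow> zhat^2^2 \<Rightarrow> 'a \<Rightarrow> 'a" where
  "theta_GL2R \<iota> \<gamma> = extension \<iota> (\<lambda>f g (\<rho>, \<tau>). f g (\<rho> ** map_matrix adele_of_zhat \<gamma>, \<tau>))"

definition mtilde :: "int^2^2 \<Rightarrow> adele^2^2" where
  "mtilde m = mat (of_int (det m)) ** matrix_inv (map_matrix of_int m)"

definition R_ideal :: "int^2^2 \<Rightarrow> (adele^2^2) set" where
  "R_ideal m = (\<lambda>\<rho>. \<rho> ** mtilde m) ` M2R"

text \<open>\<open>(g, (\<rho> mtilde\<^sup>-\<^sup>1, \<tau>))\<close> need not lie in \<open>U_space\<close> even if \<open>(g, (\<rho>, \<tau>)) \<in> U_space\<close> and \<open>\<rho> \<in> R\<^sub>m\<close>; there \<open>f\<close>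
  takes the value zero.\<close>

definition theta_M2Z :: "(hfun \<Rightarrow> 'a::cstar_algebra) \<Rightarrow> int^2^2 \<Rightarrow> 'a \<Rightarrow> 'a" where
  "theta_M2Z \<iota> m = extension \<iota> (\<lambda>f g (\<rho>, \<tau>).
     if \<rho> \<in> R_ideal m then extend0 f g (\<rho> ** matrix_inv (mtilde m), \<tau>) else 0)"

end

theory Submission
  imports Defs
begin

text \<open>For \<open>x \<in> GL\<^sub>2(A\<^sub>f)\<close> with \<open>x\<^sup>-\<^sup>1 \<in> M\<^sub>2(R)\<close> put \<open>(\<theta>\<^sub>x f)(g, (\<rho>, \<tau>)) = f(g, (\<rho> x, \<tau>))\<close>, where \<open>f\<close> is zero
  off its domain. Integrality of \<open>x\<^sup>-\<^sup>1\<close> ensures that \<open>\<theta>\<^sub>x f\<close> vanishes unless \<open>\<rho>\<close> and \<open>g \<rho>\<close> are integral, so these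
  are endomorphisms with \<open>\<theta>\<^sub>x \<theta>\<^sub>z = \<theta>\<^sub>x\<^sub>z\<close> on the nose; they contain both given actions, with \<open>m\<close> acting as
  \<open>\<theta>\<^sub>x\<close> for \<open>x = Det(m)\<^sup>-\<^sup>1 m\<close>. Every class in \<open>S\<close> has such a representative, and two of them differ by a rational
  scalar. Since \<open>\<theta>\<^sub>-\<^sub>1 = id\<close> and \<open>\<theta>\<close> of the scalar \<open>1/n\<close> is conjugation by the isometry given by the
  characteristic function of \<open>\<Gamma> n\<close>, the choice of representative is immaterial modulo inner endomorphisms.\<close>

section \<open>Topology of the profinite integers and the finite adeles\<close>

text \<open>Two obstacles shape the proof. First, every operator must be shown to preserve C_c(Z),
  whose definition goes through a quotient topology. \<open>hecke_funs\<close> replaces it by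
  conditions on functions of (g, y): equivariance, continuity on each slice, and support over
  finitely many double cosets of Gamma and a compact set of \<tau> modulo Gamma. This rests on
  M_2(R) being compact and open among the adelic matrices, so that only g and \<tau> can escape to
  infinity and extension by zero stays continuous, and on the proper discontinuity of Gamma on the
  upper half plane. Second, the passage to the completion needs norm bounds. For right translation
  by x the point y x may leave Y, which is repaired by multiplying with a common denominator of x.
  The characteristic function u of Gamma n does not have compact support on Z, since the quotient of
  the upper half plane by Gamma is not compact; u exists only as a double centralizer, and
  multiplication by u is bounded through the C*-identity and star(u) u = 1.\<close>

lemma zhat_eqI:
  assumes "\<And>p n. prime p \<Longrightarrow> zcomp x p n = zcomp y p n"
  shows "x = y"
proof -
  have "zcomp x = zcomp y"
    using zcomp[of x] zcomp[of y] assms by (auto simp: fun_eq_iff PiE_iff extensional_def) metis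
  then show ?thesis by (simp add: zcomp_inject)
qed

lemma zcomp_padic_ints: "prime p \<Longrightarrow> zcomp x p \<in> padic_ints p"
  using zcomp[of x] by auto

lemma zcomp_mod_power: "prime p \<Longrightarrow> zcomp x p (n + k) mod int p ^ n = zcomp x p n"
proof (induction k)
  case 0
  then show ?case using padic_ints_mod[OF zcomp_padic_ints[of p x]] by simp
next
  case (Suc k)
  have "zcomp x p (n + Suc k) mod int p ^ n = zcomp x p (n + Suc k) mod int p ^ (n + k) mod int p ^ n"
    by (simp add: mod_mod_cancel le_imp_power_dvd)
  then show ?case using Suc zcomp_padic_ints[of p x] by (auto simp: padic_ints_def)
qed

lemma continuous_zcomp: "continuous_on UNIV zcomp"
  unfolding continuous_on_open_vimage[OF open_UNIV] by (auto simp: open_zhat_def)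

lemma continuous_on_zcomp [continuous_intros]:
  "continuous_on S f \<Longrightarrow> continuous_on S (\<lambda>x. zcomp (f x) p n)"
  by (rule continuous_on_product_then_coordinatewise, rule continuous_on_product_then_coordinatewise,
      rule continuous_on_compose2[OF continuous_zcomp]) auto

text \<open>The topology is pulled back along \<open>zcomp\<close>, hence initial for the residue
  maps. At a non-prime index the component is the constant \<open>undefined\<close>, so only primes
  have to be tested.\<close>

lemma continuous_on_zhatI:
  assumes "\<And>p n. prime p \<Longrightarrow> continuous_on S (\<lambda>x. zcomp (f x) p n)"
  shows "continuous_on S f"
proof -
  have "continuous_on S (\<lambda>x. zcomp (f x) p n)" for p n
  proof (cases "prime p")
    case False
    then have "zcomp z p = undefined" for z
      using zcomp[of z] by (auto simp: PiE_iff extensional_def)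
    then show ?thesis by simp
  qed (rule assms)
  then have *: "continuous_on S (\<lambda>x. zcomp (f x))"
    by (intro continuous_on_coordinatewise_then_product)
  show ?thesis
    unfolding continuous_on_open_invariant
  proof (intro allI impI)
    fix B :: "zhat set" assume "open B"
    then obtain V where V: "open V" "B = zcomp -` V" by (auto simp: open_zhat_def)
    then obtain A where "open A" "A \<inter> S = (\<lambda>x. zcomp (f x)) -` V \<inter> S"
      using * unfolding continuous_on_open_invariant by blast
    then show "\<exists>A. open A \<and> A \<inter> S = f -` B \<inter> S"
      using V(2) by (intro exI[of _ A]) auto
  qed
qed

text \<open>Two maps into discrete spaces are locally constant, so any h may be applied to them.
  This covers addition and multiplication modulo p^n at once.\<close>

lemma continuous_on_discrete2:
  fixes f :: "'a::topological_space \<Rightarrow> 'b::discrete_topology"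
    and g :: "'a \<Rightarrow> 'c::discrete_topology" and h :: "'b \<Rightarrow> 'c \<Rightarrow> 'd::topological_space"
  assumes "continuous_on S f" "continuous_on S g"
  shows "continuous_on S (\<lambda>x. h (f x) (g x))"
  unfolding continuous_on_def
proof
  fix x assume "x \<in> S"
  then have "eventually (\<lambda>y. f y = f x) (at x within S)" "eventually (\<lambda>y. g y = g x) (at x within S)"
    using assms by (auto simp: continuous_on_def tendsto_discrete)
  then have "eventually (\<lambda>y. h (f x) (g x) = h (f y) (g y)) (at x within S)"
    by eventually_elim simp
  then show "((\<lambda>x. h (f x) (g x)) \<longlongrightarrow> h (f x) (g x)) (at x within S)"
    by (rule Lim_transform_eventually[OF tendsto_const])
qed

lemma continuous_on_zhat_mult:
  fixes f g :: "'a::topological_space \<Rightarrow> zhat"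
  assumes "continuous_on S f" "continuous_on S g"
  shows "continuous_on S (\<lambda>x. f x * g x)"
proof (rule continuous_on_zhatI)
  fix p n assume "prime (p::nat)"
  then have eq: "(\<lambda>x. zcomp (f x * g x) p n) = (\<lambda>x. (zcomp (f x) p n * zcomp (g x) p n) mod int p ^ n)"
    by (simp add: times_zhat.rep_eq padic_reduce_def)
  show "continuous_on S (\<lambda>x. zcomp (f x * g x) p n)"
    unfolding eq by (rule continuous_on_discrete2[where h = "\<lambda>a b. (a * b) mod int p ^ n"])
      (intro continuous_on_zcomp assms)+
qed

lemma continuous_on_zhat_add:
  fixes f g :: "'a::topological_space \<Rightarrow> zhat"
  assumes "continuous_on S f" "continuous_on S g"
  shows "continuous_on S (\<lambda>x. f x + g x)"
proof (rule continuous_on_zhatI)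
  fix p n assume "prime (p::nat)"
  then have eq: "(\<lambda>x. zcomp (f x + g x) p n) = (\<lambda>x. (zcomp (f x) p n + zcomp (g x) p n) mod int p ^ n)"
    by (simp add: plus_zhat.rep_eq padic_reduce_def)
  show "continuous_on S (\<lambda>x. zcomp (f x + g x) p n)"
    unfolding eq by (rule continuous_on_discrete2[where h = "\<lambda>a b. (a + b) mod int p ^ n"])
      (intro continuous_on_zcomp assms)+
qed

instance zhat :: t2_space
proof
  fix x y :: zhat assume "x \<noteq> y"
  then obtain p n where pn: "zcomp x p n \<noteq> zcomp y p n" using zhat_eqI by blast
  have "open ((\<lambda>z. zcomp z p n) -` {c})" for c
    by (rule open_vimage[OF open_discrete continuous_on_zcomp[OF continuous_on_id]])
  then show "\<exists>U V. open U \<and> open V \<and> x \<in> U \<and> y \<in> V \<and> U \<inter> V = {}"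
    using pn by (intro exI[of _ "(\<lambda>z. zcomp z p n) -` {zcomp x p n}"]
        exI[of _ "(\<lambda>z. zcomp z p n) -` {zcomp y p n}"]) auto
qed

text \<open>Joint continuity as a limit along a product of neighbourhood filters is the form that
  carries over to the adeles through \<open>nhds_adele_frac\<close>.\<close>

instance zhat :: topological_monoid_add
proof
  fix a b :: zhat
  have "continuous_on UNIV (\<lambda>x :: zhat \<times> zhat. fst x + snd x)"
    by (intro continuous_on_zhat_add continuous_on_fst continuous_on_snd continuous_on_id)
  then have "((\<lambda>x. fst x + snd x) \<longlongrightarrow> fst (a, b) + snd (a, b)) (at (a, b))"
    unfolding continuous_on_def by blast
  then have "((\<lambda>x. fst x + snd x) \<longlongrightarrow> fst (a, b) + snd (a, b)) (nhds (a, b))"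
    by (rule iffD1[OF tendsto_at_iff_tendsto_nhds[where g = "\<lambda>x. fst x + snd x"]])
  then show "LIM x (nhds a \<times>\<^sub>F nhds b). fst x + snd x :> nhds (a + b)"
    by (simp add: nhds_prod)
qed

text \<open>Tychonoff: \<open>zcomp\<close> identifies R with the part of a product K of finite sets
  that is cut out by the compatibilities C, a closed condition. Since the topology of R is induced
  by \<open>zcomp\<close>, the inverse map is continuous and transports compactness back.\<close>

lemma compact_zhat: "compact (UNIV :: zhat set)"
proof -
  define K where "K = (\<Pi>\<^sub>E p\<in>UNIV. if prime p then (\<Pi>\<^sub>E n\<in>UNIV. {0..<int p ^ n}) else {undefined::nat \<Rightarrow> int})"
  have prod: "compact (\<Pi>\<^sub>E i\<in>UNIV. X i)" if "\<And>i. compact (X i)" for X :: "nat \<Rightarrow> 'b::topological_space set"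
    using that compactin_PiE[of "\<lambda>_. euclidean" UNIV X] by (simp add: euclidean_product_topology)
  have K: "compact K"
    unfolding K_def
  proof (rule prod)
    show "compact (if prime p then (\<Pi>\<^sub>E n\<in>UNIV. {0..<int p ^ n}) else {undefined})" for p
      using prod[of "\<lambda>n. {0..<int p ^ n}"] by (simp add: finite_imp_compact)
  qed
  define C where "C = (\<Inter>p\<in>{p::nat. prime p}. \<Inter>n::nat. {x :: nat \<Rightarrow> nat \<Rightarrow> int. x p (Suc n) mod int p ^ n = x p n})"
  have coord: "continuous_on UNIV (\<lambda>x :: nat \<Rightarrow> nat \<Rightarrow> int. x p m)" for p m
    by (rule continuous_on_product_then_coordinatewise, rule continuous_on_product_then_coordinatewise,
        rule continuous_on_id)
  then have "continuous_on UNIV (\<lambda>x :: nat \<Rightarrow> nat \<Rightarrow> int. x p (Suc n) mod int p ^ n)" for p n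
    using continuous_on_discrete2[of UNIV "\<lambda>x :: nat \<Rightarrow> nat \<Rightarrow> int. x p (Suc n)" "\<lambda>_. 0::int" "\<lambda>a _. a mod int p ^ n"]
    by simp
  then have "closed C"
    unfolding C_def by (intro closed_INT ballI closed_Collect_eq coord)
  have "range zcomp = K \<inter> C"
  proof -
    have "range zcomp = (\<Pi>\<^sub>E p\<in>{p::nat. prime p}. padic_ints p)"
      using type_definition.Rep_range[OF type_definition_zhat] .
    also have "\<dots> = K \<inter> C"
    proof (rule equalityI; rule subsetI)
      fix x assume x: "x \<in> (\<Pi>\<^sub>E p\<in>{p::nat. prime p}. padic_ints p)"
      have "x p \<in> (if prime p then (\<Pi>\<^sub>E n\<in>UNIV. {0..<int p ^ n}) else {undefined})" for p
      proof (cases "prime p")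
        case True
        then have "x p \<in> padic_ints p" using x by (simp add: PiE_iff)
        then show ?thesis using True by (simp add: padic_ints_def PiE_iff)
      next
        case False
        then show ?thesis using x by (simp add: PiE_iff extensional_def)
      qed
      moreover have "x \<in> C" using x by (simp add: C_def PiE_iff padic_ints_def)
      ultimately show "x \<in> K \<inter> C" by (simp add: K_def PiE_iff)
    next
      fix x assume x: "x \<in> K \<inter> C"
      then have K: "x p \<in> (if prime p then (\<Pi>\<^sub>E n\<in>UNIV. {0..<int p ^ n}) else {undefined})" for p
        by (simp add: K_def PiE_iff)
      have "x p \<in> padic_ints p" if "prime p" for p
        using K[of p] x that by (simp add: C_def PiE_iff padic_ints_def)
      moreover have "x p = undefined" if "\<not> prime p" for p using K[of p] that by simp
      ultimately show "x \<in> (\<Pi>\<^sub>E p\<in>{p::nat. prime p}. padic_ints p)"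
        by (simp add: PiE_iff extensional_def)
    qed
    finally show ?thesis .
  qed
  then have c: "compact (range zcomp)"
    using K \<open>closed C\<close> by (simp add: compact_Int_closed)
  have "continuous_on (range zcomp) Abs_zhat"
  proof (subst continuous_on_open_invariant, intro allI impI)
    fix B :: "zhat set" assume "open B"
    then obtain V where "open V" "B = zcomp -` V" by (auto simp: open_zhat_def)
    then show "\<exists>A. open A \<and> A \<inter> range zcomp = Abs_zhat -` B \<inter> range zcomp"
      by (intro exI[of _ V]) (auto simp: zcomp_inverse)
  qed
  then have "compact (Abs_zhat ` range zcomp)" using c by (rule compact_continuous_image)
  then show ?thesis by (simp add: image_image zcomp_inverse)
qed

text \<open>Solving m x = y splits over the primes. With m = p^v e and e a unit at p, the only
  obstruction at p is that p^v divides y, that is, that the residue of y at level v vanishes. Only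
  the finitely many p dividing m impose a condition, which is what makes the range open.\<close>

lemma range_zhat_mult_int:
  assumes "m \<noteq> 0"
  shows "range ((*) (of_int m :: zhat)) =
    {y. \<forall>p. prime p \<longrightarrow> int p dvd m \<longrightarrow> zcomp y p (multiplicity (int p) m) = 0}"
proof (rule equalityI; rule subsetI)
  fix y :: zhat assume "y \<in> range ((*) (of_int m))"
  then obtain x where y: "y = of_int m * x" by auto
  have "zcomp y p (multiplicity (int p) m) = 0" if "prime p" for p
  proof -
    have "int p ^ multiplicity (int p) m dvd m" by (rule multiplicity_dvd)
    then show ?thesis
      using that by (simp add: y times_zhat.rep_eq padic_reduce_def zcomp_of_int mod_simps)
  qed
  then show "y \<in> {y. \<forall>p. prime p \<longrightarrow> int p dvd m \<longrightarrow> zcomp y p (multiplicity (int p) m) = 0}" by simp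
next
  fix y :: zhat assume y: "y \<in> {y. \<forall>p. prime p \<longrightarrow> int p dvd m \<longrightarrow> zcomp y p (multiplicity (int p) m) = 0}"
  have "\<exists>z\<in>padic_ints p. \<forall>n. (m * z n) mod int p ^ n = zcomp y p n" if p: "prime p" for p
  proof -
    have pi: "prime (int p)" and p0: "int p ^ k > 0" for k using p by (auto simp: prime_gt_0_nat)
    define v where "v = multiplicity (int p) m"
    obtain e where e: "m = int p ^ v * e" "\<not> int p dvd e"
      unfolding v_def using multiplicity_decompose'[of m "int p"] assms pi by (metis not_prime_unit)
    have cop: "coprime e (int p ^ n)" for n
      using prime_imp_coprime[OF pi e(2)] by (simp add: coprime_commute)
    then have "\<exists>w. [e * w = 1] (mod int p ^ n)" for n
      by (intro cong_solve_coprime_int)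
    then obtain w where w: "\<And>n. [e * w n = 1] (mod int p ^ n)" by metis
    have yv: "int p ^ v dvd zcomp y p (n + v)" for n
    proof -
      have "zcomp y p v = 0"
      proof (cases "int p dvd m")
        case False
        then have "v = 0" by (simp add: v_def not_dvd_imp_multiplicity_0)
        then show ?thesis using zcomp_mod_power[OF p, of y 0 0] by simp
      qed (use y p v_def in auto)
      then show ?thesis using zcomp_mod_power[OF p, of y v n] by (simp add: add.commute mod_eq_0_iff_dvd)
    qed
    \<comment> \<open>Dividing by p^v costs v digits of precision, so level n of the quotient is
      read off from level n + v of y.\<close>
    define q where "q n = zcomp y p (n + v) div int p ^ v" for n
    have q: "zcomp y p (n + v) = int p ^ v * q n" for n using yv by (simp add: q_def)
    have qc: "[q (Suc n) = q n] (mod int p ^ n)" for n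
    proof -
      have "[zcomp y p (Suc n + v) = zcomp y p (n + v)] (mod int p ^ (n + v))"
        using padic_ints_cong[OF zcomp_padic_ints[OF p]] by simp
      then have "[int p ^ v * q (Suc n) = int p ^ v * q n] (mod int p ^ (n + v))"
        by (simp only: q)
      then have "int p ^ v * int p ^ n dvd int p ^ v * (q (Suc n) - q n)"
        by (simp add: cong_iff_dvd_diff power_add right_diff_distrib mult.commute)
      then show ?thesis using p0[of v] by (auto simp add: cong_iff_dvd_diff)
    qed
    define z where "z = padic_reduce p (\<lambda>n. q n * w n)"
    have ez: "[e * (q n * w n) = q n] (mod int p ^ n)" for n
      using cong_scalar_left[OF w[of n], of "q n"] by (simp add: ac_simps)
    \<comment> \<open>The inverses \<open>w n\<close> of e were chosen independently for each n;
      compatibility is therefore checked after multiplication by e, which cancels because e is prime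
      to p.\<close>
    have "[q (Suc n) * w (Suc n) = q n * w n] (mod int p ^ n)" for n
    proof -
      have "[e * (q (Suc n) * w (Suc n)) = q (Suc n)] (mod int p ^ n)"
        using ez[of "Suc n"] by (rule cong_dvd_modulus) (simp add: le_imp_power_dvd)
      then have "[e * (q (Suc n) * w (Suc n)) = e * (q n * w n)] (mod int p ^ n)"
        using qc[of n] ez[of n] by (meson cong_sym cong_trans)
      then show ?thesis using cop by (simp add: cong_mult_lcancel)
    qed
    then have "z \<in> padic_ints p" unfolding z_def using p by (intro padic_reduce_in)
    moreover have "(m * z n) mod int p ^ n = zcomp y p n" for n
    proof -
      have "[m * z n = int p ^ v * (e * (q n * w n))] (mod int p ^ n)"
        unfolding e(1) z_def padic_reduce_def mult.assoc
        by (intro cong_scalar_left) (simp add: cong_def)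
      also have "[int p ^ v * (e * (q n * w n)) = zcomp y p (n + v)] (mod int p ^ n)"
        unfolding q using cong_scalar_left[OF ez] .
      also have "[zcomp y p (n + v) = zcomp y p n] (mod int p ^ n)"
        using zcomp_mod_power[OF p, of y n v] zcomp_mod_power[OF p, of y n 0] by (simp add: cong_def)
      finally show ?thesis using zcomp_mod_power[OF p, of y n 0] by (simp add: cong_def)
    qed
    ultimately show ?thesis by blast
  qed
  then obtain Z where Z: "\<And>p. prime p \<Longrightarrow> Z p \<in> padic_ints p"
    "\<And>p n. prime p \<Longrightarrow> (m * Z p n) mod int p ^ n = zcomp y p n" by metis
  define x where "x = Abs_zhat (\<lambda>p\<in>{p. prime p}. Z p)"
  have x: "zcomp x = (\<lambda>p\<in>{p. prime p}. Z p)"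
    unfolding x_def by (rule Abs_zhat_inverse) (use Z in auto)
  have "of_int m * x = y"
    by (rule zhat_eqI) (simp add: times_zhat.rep_eq padic_reduce_def x zcomp_of_int mod_simps Z)
  then show "y \<in> range ((*) (of_int m))" by auto
qed

lemma open_range_zhat_mult_int:
  assumes "m \<noteq> 0"
  shows "open (range ((*) (of_int m :: zhat)))"
proof -
  have "finite {p. int p dvd m}"
  proof (rule finite_subset)
    show "{p. int p dvd m} \<subseteq> {..nat \<bar>m\<bar>}" using assms dvd_imp_le_int by force
  qed auto
  then have fin: "finite {p. prime p \<and> int p dvd m}" by (rule rev_finite_subset) auto
  have eq: "{y. \<forall>p. prime p \<longrightarrow> int p dvd m \<longrightarrow> zcomp y p (multiplicity (int p) m) = 0} =
    (\<Inter>p\<in>{p. prime p \<and> int p dvd m}. (\<lambda>z. zcomp z p (multiplicity (int p) m)) -` {0})" by auto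
  show ?thesis
    unfolding range_zhat_mult_int[OF assms] eq
    using fin by (intro open_INT ballI open_vimage continuous_on_zcomp continuous_on_id) (auto simp: open_discrete)
qed

text \<open>By compactness multiplication by m is a closed map. Being injective with open range, it
  is also open: the image of V is the range minus the closed image of the complement of V.\<close>

lemma open_zhat_mult_int_image:
  assumes "m \<noteq> 0" "open V"
  shows "open ((*) (of_int m :: zhat) ` V)"
proof -
  have inj: "inj ((*) (of_int m :: zhat))"
  proof (rule injI)
    fix x y :: zhat assume "of_int m * x = of_int m * y"
    then have "of_int m * (x - y) = 0" by (simp add: right_diff_distrib)
    then show "x = y" using zhat_torsion_free assms(1) by fastforce
  qed
  have "compact (- V)" using compact_zhat assms(2) by (metis Compl_UNIV_eq closed_Compl compact_Int_closed Int_UNIV_left)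
  then have "compact ((*) (of_int m) ` (- V))"
    by (intro compact_continuous_image continuous_on_zhat_mult continuous_intros)
  then have "closed ((*) (of_int m) ` (- V))" by (rule compact_imp_closed)
  moreover have "(*) (of_int m) ` V = range ((*) (of_int m)) - (*) (of_int m) ` (- V)"
    using inj by (auto simp: inj_def)
  ultimately show ?thesis using open_range_zhat_mult_int[OF assms(1)] by (simp add: open_Diff)
qed

section \<open>The finite adeles as a directed union of open copies of R\<close>

lemma adele_fracE:
  obtains y n where "n > 0" "(x :: adele) = adele_frac y n"
proof -
  have "\<exists>y n. n \<noteq> 0 \<and> x = adele_frac y n"
    by transfer (auto simp: adelerel_def)
  then obtain y n where yn: "n \<noteq> 0" "x = adele_frac y n" by blast
  show ?thesis
  proof (cases "n > 0")
    case False
    then have "x = adele_frac (- y) (- n)" using yn by (simp add: adele_frac_eq_iff)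
    then show ?thesis using that[of "- n" "- y"] False yn by simp
  qed (use that yn in blast)
qed

lemma adele_frac_mult_cancel: "n \<noteq> 0 \<Longrightarrow> k \<noteq> 0 \<Longrightarrow> adele_frac (x * of_int k) (n * k) = adele_frac x n"
  by (simp add: adele_frac_eq_iff ac_simps)

lemma adele_frac_add: "n \<noteq> 0 \<Longrightarrow> adele_frac x n + adele_frac y n = adele_frac (x + y) n"
  by transfer (simp add: adelerel_def algebra_simps)

lemma continuous_adele_frac: "n > 0 \<Longrightarrow> continuous_on UNIV (\<lambda>x. adele_frac x n)"
  by (auto simp: continuous_on_open_vimage open_adele_def)

text \<open>Openness of adeles is tested at each denominator m. There x/m lies in (1/n) V exactly if
  n x lies in m V, so the claim reduces to openness of multiplication by m on R.\<close>

lemma open_adele_frac_image: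
  assumes "n > 0" "open V"
  shows "open ((\<lambda>x. adele_frac x n) ` V)"
  unfolding open_adele_def
proof (intro allI impI)
  fix m :: int assume m: "m > 0"
  have eq: "(\<lambda>x. adele_frac x m) -` ((\<lambda>x. adele_frac x n) ` V) = (\<lambda>y. y * of_int n) -` ((*) (of_int m) ` V)"
    using assms(1) m by (auto simp: adele_frac_eq_iff mult.commute)
  show "open ((\<lambda>x. adele_frac x m) -` ((\<lambda>x. adele_frac x n) ` V))"
    unfolding eq using m assms(2)
    by (intro open_vimage open_zhat_mult_int_image continuous_on_zhat_mult continuous_intros) auto
qed

lemma nhds_adele_frac:
  assumes "n > 0"
  shows "nhds (adele_frac x n) = filtermap (\<lambda>x. adele_frac x n) (nhds x)"
  by (rule filtermap_nhds_open_map[symmetric])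
     (use assms continuous_adele_frac open_adele_frac_image in \<open>auto simp: continuous_on_eq_continuous_at\<close>)

text \<open>Over a common denominator N, addition of adeles is addition in R, and x -> x/N
  transports neighbourhood filters exactly because it is continuous and open.\<close>

instance adele :: topological_comm_monoid_add
proof
  fix a b :: adele
  obtain x n where a: "n > 0" "a = adele_frac x n" by (rule adele_fracE)
  obtain y m where b: "m > 0" "b = adele_frac y m" by (rule adele_fracE)
  define N where "N = n * m"
  define x' where "x' = x * of_int m"
  define y' where "y' = y * of_int n"
  have N: "N > 0" "a = adele_frac x' N" "b = adele_frac y' N"
    using a b adele_frac_mult_cancel[of n m x] adele_frac_mult_cancel[of m n y]
    by (auto simp: N_def x'_def y'_def mult.commute)
  have "((\<lambda>p. adele_frac (fst p + snd p) N) \<longlongrightarrow> adele_frac (x' + y') N) (nhds x' \<times>\<^sub>F nhds y')"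
    using tendsto_add_Pair[of x' y'] continuous_adele_frac[OF N(1)]
    by (intro isCont_tendsto_compose[where g = "\<lambda>z. adele_frac z N"]) (auto simp: continuous_on_eq_continuous_at)
  then show "LIM x (nhds a \<times>\<^sub>F nhds b). fst x + snd x :> nhds (a + b)"
    using N by (simp add: nhds_adele_frac prod_filtermap1 prod_filtermap2 filterlim_filtermap adele_frac_add)
qed

text \<open>For c = z/k, multiplication by c maps (1/n) R into (1/(k n)) R and is multiplication by
  z on numerators. A fixed factor suffices, as only products with a fixed matrix on one side occur
  later.\<close>

lemma continuous_on_adele_cmult [continuous_intros]:
  fixes f :: "'a::topological_space \<Rightarrow> adele"
  assumes "continuous_on S f"
  shows "continuous_on S (\<lambda>x. c * f x)"
proof -
  obtain z k where c: "k > 0" "c = adele_frac z k" by (rule adele_fracE)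
  have "continuous_on UNIV ((*) c)"
    unfolding continuous_on_open_vimage[OF open_UNIV]
  proof (intro allI impI)
    fix B :: "adele set" assume B: "open B"
    show "open ((*) c -` B \<inter> UNIV)"
      unfolding open_adele_def
    proof (intro allI impI)
      fix n :: int assume n: "n > 0"
      have eq: "(\<lambda>x. adele_frac x n) -` ((*) c -` B \<inter> UNIV) = (\<lambda>x. z * x) -` ((\<lambda>x. adele_frac x (k * n)) -` B)"
        using c n by (auto simp: adele_frac_mult)
      have "open ((\<lambda>x. adele_frac x (k * n)) -` B)" using B c n by (auto simp: open_adele_def)
      then show "open ((\<lambda>x. adele_frac x n) -` ((*) c -` B \<inter> UNIV))"
        unfolding eq by (rule open_vimage) (intro continuous_on_zhat_mult continuous_intros)
    qed
  qed
  from continuous_on_compose2[OF this assms] show ?thesis by simp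
qed

lemma open_range_adele_of_zhat: "open (range adele_of_zhat)"
  using open_adele_frac_image[of 1 UNIV] by (simp add: adele_of_zhat_def[abs_def])

text \<open>At denominator n the integral adeles become the multiples of n in R, a compact and hence
  closed set.\<close>

lemma closed_range_adele_of_zhat: "closed (range adele_of_zhat)"
  unfolding closed_def open_adele_def
proof (intro allI impI)
  fix n :: int assume n: "n > 0"
  have eq: "(\<lambda>x. adele_frac x n) -` (- range adele_of_zhat) = - range ((*) (of_int n))"
    using n by (auto simp: adele_of_zhat_def adele_frac_eq_iff mult.commute)
  have "compact (range ((*) (of_int n :: zhat)))"
    by (intro compact_continuous_image continuous_on_zhat_mult continuous_intros compact_zhat)
  then show "open ((\<lambda>x. adele_frac x n) -` (- range adele_of_zhat))"
    unfolding eq by (simp add: compact_imp_closed open_Compl)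
qed

lemma continuous_adele_of_zhat: "continuous_on UNIV adele_of_zhat"
  using continuous_adele_frac[of 1] by (simp add: adele_of_zhat_def[abs_def])

section \<open>M_2(R) as a compact open set of adelic matrices\<close>

lemma M2R_iff: "\<rho> \<in> M2R \<longleftrightarrow> (\<forall>i j. \<rho> $ i $ j \<in> range adele_of_zhat)"
proof
  assume "\<forall>i j. \<rho> $ i $ j \<in> range adele_of_zhat"
  then obtain r where "\<And>i j. \<rho> $ i $ j = adele_of_zhat (r i j)" by (simp add: image_iff) metis
  then have "\<rho> = map_matrix adele_of_zhat (\<chi> i j. r i j)" by (simp add: vec_eq_iff map_matrix_def)
  then show "\<rho> \<in> M2R" unfolding M2R_def by blast
qed (auto simp: M2R_def map_matrix_def)

lemma M2R_Int: "M2R = (\<Inter>i. \<Inter>j. (\<lambda>\<rho>. \<rho> $ i $ j) -` range adele_of_zhat)"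
  by (auto simp: M2R_iff)

lemma open_M2R: "open M2R"
  unfolding M2R_Int
  by (intro open_INT ballI open_vimage open_range_adele_of_zhat continuous_intros) auto

lemma closed_M2R: "closed M2R"
  unfolding M2R_Int
  by (intro closed_INT ballI closed_vimage closed_range_adele_of_zhat continuous_intros)

lemma compact_M2R: "compact M2R"
proof -
  \<comment> \<open>Compactness is imported from R^4, written as nested pairs, through the
    continuous map that arranges four entries in a matrix.\<close>
  define F where "F = (\<lambda>(a, b, c, d). vector [vector [adele_of_zhat a, adele_of_zhat b], vector [adele_of_zhat c, adele_of_zhat d]] :: adele^2^2)"
  have F: "F = (\<lambda>z. \<chi> i j. adele_of_zhat (if i = 1 then if j = 1 then fst z else fst (snd z)
      else if j = 1 then fst (snd (snd z)) else snd (snd (snd z))))"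
    by (auto simp: F_def vec_eq_iff forall_2)
  have "continuous_on UNIV F"
    unfolding F
  proof (intro continuous_on_vec_lambda continuous_on_compose2[OF continuous_adele_of_zhat])
    fix i j :: 2
    show "continuous_on UNIV (\<lambda>z :: zhat \<times> zhat \<times> zhat \<times> zhat. if i = 1 then if j = 1 then fst z else fst (snd z)
      else if j = 1 then fst (snd (snd z)) else snd (snd (snd z)))"
      by (cases "i = 1"; cases "j = 1") (auto intro!: continuous_intros)
  qed auto
  moreover have "compact (UNIV :: (zhat \<times> zhat \<times> zhat \<times> zhat) set)"
    using compact_Times[OF compact_zhat compact_Times[OF compact_zhat compact_Times[OF compact_zhat compact_zhat]]]
    by simp
  ultimately have "compact (range F)" by (rule compact_continuous_image)
  moreover have "range F = M2R"
  proof (rule equalityI; rule subsetI)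
    fix \<rho> assume "\<rho> \<in> M2R"
    then obtain r where "\<rho> = map_matrix adele_of_zhat r" by (auto simp: M2R_def)
    then have "\<rho> = F (r$1$1, r$1$2, r$2$1, r$2$2)"
      by (auto simp: F_def vec_eq_iff forall_2 map_matrix_def)
    then show "\<rho> \<in> range F" by blast
  qed (auto simp: M2R_iff F forall_2)
  ultimately show ?thesis by simp
qed

lemma M2R_mult: "a \<in> M2R \<Longrightarrow> b \<in> M2R \<Longrightarrow> a ** b \<in> M2R"
proof -
  have 1: "adele_of_zhat x + adele_of_zhat y = adele_of_zhat (x + y)"
    "adele_of_zhat x * adele_of_zhat y = adele_of_zhat (x * y)" for x y
    by (simp_all add: adele_of_zhat_def adele_frac_add adele_frac_mult)
  assume "a \<in> M2R" "b \<in> M2R"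
  then show ?thesis
    by (auto simp: M2R_iff matrix_matrix_mult_def sum_2 image_iff) (metis 1)
qed

lemma continuous_on_adele_matrix_mult:
  fixes f :: "'a::topological_space \<Rightarrow> adele^2^2"
  assumes "continuous_on S f"
  shows "continuous_on S (\<lambda>x. a ** f x)" "continuous_on S (\<lambda>x. f x ** a)"
  using assms unfolding matrix_matrix_mult_def sum_2 mult.commute[of _ "a $ _ $ _"]
  by (auto intro!: continuous_intros)

section \<open>Matrices acting on adelic matrices and on the upper half plane\<close>

lemma invertible_matrix_inv:
  assumes "invertible A"
  shows "A ** matrix_inv A = mat 1" "matrix_inv A ** A = mat 1"
  using someI_ex[OF assms[unfolded invertible_def]] unfolding matrix_inv_def by auto

lemma matrix_inv_unique:
  assumes "A ** B = mat 1" "B ** A = mat 1"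
  shows "matrix_inv A = B"
proof -
  have "invertible A" using assms invertible_def by blast
  then have "matrix_inv A ** A = mat 1" by (rule invertible_matrix_inv)
  then have "matrix_inv A ** (A ** B) = B" by (simp add: matrix_mul_assoc)
  then show ?thesis using assms by simp
qed

lemma GL2Qp_invertible: "g \<in> GL2Qp \<Longrightarrow> invertible g"
  by (simp add: GL2Qp_def invertible_det_nz)

lemma GL2Qp_inv:
  assumes "g \<in> GL2Qp"
  shows "g ** matrix_inv g = mat 1" "matrix_inv g ** g = mat 1"
  using assms by (auto simp: invertible_matrix_inv GL2Qp_invertible)

lemma GL2Qp_mult [simp]: "g \<in> GL2Qp \<Longrightarrow> h \<in> GL2Qp \<Longrightarrow> g ** h \<in> GL2Qp"
  by (simp add: GL2Qp_def det_mul)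

lemma GL2Qp_one [simp]: "mat 1 \<in> GL2Qp"
  by (simp add: GL2Qp_def)

lemma GL2Qp_matrix_inv [simp]:
  assumes "g \<in> GL2Qp"
  shows "matrix_inv g \<in> GL2Qp"
proof -
  have "det g * det (matrix_inv g) = 1" using GL2Qp_inv(1)[OF assms] det_mul[of g "matrix_inv g"] by simp
  then show ?thesis using assms by (auto simp: GL2Qp_def) (metis zero_less_mult_pos zero_less_one)
qed

lemma GL2Qp_mult_cancel:
  assumes "g \<in> GL2Qp"
  shows "a ** g ** matrix_inv g = a" "a ** matrix_inv g ** g = a"
    "g ** (matrix_inv g ** a) = a" "matrix_inv g ** (g ** a) = a"
  using GL2Qp_inv[OF assms] by (simp_all add: matrix_mul_assoc) (simp_all flip: matrix_mul_assoc)

lemma GL2Qp_matrix_inv_mult: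
  assumes "g \<in> GL2Qp" "h \<in> GL2Qp"
  shows "matrix_inv (g ** h) = matrix_inv h ** matrix_inv g"
proof (rule matrix_inv_unique)
  show "g ** h ** (matrix_inv h ** matrix_inv g) = mat 1"
    using assms by (simp add: matrix_mul_assoc GL2Qp_mult_cancel GL2Qp_inv)
  show "matrix_inv h ** matrix_inv g ** (g ** h) = mat 1"
    using assms by (simp add: matrix_mul_assoc GL2Qp_mult_cancel GL2Qp_inv)
qed

lemma GL2Qp_matrix_inv_inv: "g \<in> GL2Qp \<Longrightarrow> matrix_inv (matrix_inv g) = g"
  by (intro matrix_inv_unique GL2Qp_inv)

lemma GL2Qp_mult_iff: "h \<in> GL2Qp \<Longrightarrow> h ** g \<in> GL2Qp \<longleftrightarrow> g \<in> GL2Qp"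
  by (auto simp: GL2Qp_def det_mul zero_less_mult_iff)

lemma GL2Qp_mult_iff_right: "h \<in> GL2Qp \<Longrightarrow> g ** h \<in> GL2Qp \<longleftrightarrow> g \<in> GL2Qp"
  by (auto simp: GL2Qp_def det_mul zero_less_mult_iff)

lemma mat_mult_rat: "mat a ** mat b = (mat (a * b) :: rat^2^2)"
  by (auto simp: matrix_matrix_mult_def mat_def vec_eq_iff sum_2 forall_2)

lemma mat_commute_rat: "mat a ** x = x ** mat a" for x :: "rat^2^2"
  by (auto simp: matrix_matrix_mult_def mat_def vec_eq_iff sum_2 forall_2 mult.commute)

lemma det_mat_rat: "det (mat a :: rat^2^2) = a * a"
  by (simp add: det_2 mat_def)

lemma mat_GL2Qp [simp]: "a \<noteq> 0 \<Longrightarrow> mat a \<in> GL2Qp"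
  by (auto simp: GL2Qp_def det_mat_rat zero_less_mult_iff)

lemma matrix_inv_mat_rat: "a \<noteq> 0 \<Longrightarrow> matrix_inv (mat a) = (mat (1 / a) :: rat^2^2)"
  by (intro matrix_inv_unique) (simp_all add: mat_mult_rat)

lemma map_matrix_nth [simp]: "map_matrix f A $ i $ j = f (A $ i $ j)"
  by (simp add: map_matrix_def)

lemma of_int_matrix_mult:
  "map_matrix of_int (a ** b) = (map_matrix of_int a ** map_matrix of_int b :: 'a::comm_ring_1^2^2)" for a b :: "int^2^2"
  by (simp add: matrix_matrix_mult_def vec_eq_iff sum_2)

lemma of_int_det: "det (map_matrix of_int k :: 'a::comm_ring_1^2^2) = of_int (det k)" for k :: "int^2^2"
  by (simp add: det_2)

lemma SL2Z_det: "\<gamma> \<in> SL2Z \<Longrightarrow> det \<gamma> = 1"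
  by (auto simp: SL2Z_def of_int_det)

lemma SL2Z_GL2Qp [simp]: "\<gamma> \<in> SL2Z \<Longrightarrow> \<gamma> \<in> GL2Qp"
  by (auto simp: SL2Z_det GL2Qp_def)

lemma SL2Z_one [simp]: "mat 1 \<in> SL2Z"
  unfolding SL2Z_def by (auto simp: vec_eq_iff mat_def det_2 intro!: exI[of _ "mat 1"])

lemma SL2Z_mult [simp]: "a \<in> SL2Z \<Longrightarrow> b \<in> SL2Z \<Longrightarrow> a ** b \<in> SL2Z"
  by (auto simp: SL2Z_def simp flip: of_int_matrix_mult) (metis det_mul mult_1)

lemma SL2Z_matrix_inv [simp]:
  assumes "\<gamma> \<in> SL2Z"
  shows "matrix_inv \<gamma> \<in> SL2Z"
proof -
  obtain k :: "int^2^2" where k: "\<gamma> = map_matrix of_int k" "det k = 1" using assms by (auto simp: SL2Z_def)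
  define l :: "int^2^2" where "l = vector [vector [k$2$2, - k$1$2], vector [- k$2$1, k$1$1]]"
  have l: "l $ 1 $ 1 = k$2$2" "l $ 1 $ 2 = - k$1$2" "l $ 2 $ 1 = - k$2$1" "l $ 2 $ 2 = k$1$1"
    by (simp_all add: l_def)
  have "k ** l = mat 1" "l ** k = mat 1" "det l = 1"
    using k(2) by (auto simp: vec_eq_iff matrix_matrix_mult_def sum_2 forall_2 mat_def det_2 l algebra_simps)
  moreover have "map_matrix of_int (mat 1 :: int^2^2) = (mat 1 :: rat^2^2)" by (simp add: vec_eq_iff mat_def)
  ultimately have "matrix_inv \<gamma> = map_matrix of_int l"
    unfolding k(1) by (intro matrix_inv_unique) (simp_all flip: of_int_matrix_mult)
  then show ?thesis using \<open>det l = 1\<close> by (auto simp: SL2Z_def)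
qed

subsection \<open>Adelic matrices\<close>

lemma adele_frac_add_gen:
  "a \<noteq> 0 \<Longrightarrow> b \<noteq> 0 \<Longrightarrow> adele_frac x a + adele_frac y b = adele_frac (x * of_int b + y * of_int a) (a * b)"
  by transfer (simp add: adelerel_def)

lemma adele_of_rat_add: "adele_of_rat (p + q) = adele_of_rat p + adele_of_rat q"
  by (cases p, cases q) (simp add: adele_of_rat_Fract adele_frac_add_gen)

lemma adele_of_rat_0: "adele_of_rat 0 = 0"
  using adele_of_rat_add[of 0 0] by simp

lemma adele_of_rat_minus: "adele_of_rat (- p) = - adele_of_rat p"
  using adele_of_rat_add[of p "- p"] by (simp add: adele_of_rat_0 eq_neg_iff_add_eq_0 add.commute)

lemma adele_of_rat_of_nat: "adele_of_rat (of_nat k) = of_nat k"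
  by (induction k) (auto simp: adele_of_rat_0 adele_of_rat_1 adele_of_rat_add)

lemma adele_of_rat_of_int: "adele_of_rat (of_int k) = of_int k"
  by (cases k rule: int_cases2) (simp_all add: adele_of_rat_of_nat adele_of_rat_minus)

lemma of_int_eq_adele_frac: "of_int k = adele_frac (of_int k) 1"
  using adele_of_rat_Fract[of 1 k] adele_of_rat_of_int[of k] by (simp add: of_int_rat)

lemma of_int_range_zhat: "of_int k \<in> range adele_of_zhat"
  unfolding adele_of_zhat_def of_int_eq_adele_frac by blast

abbreviation amat :: "rat^2^2 \<Rightarrow> adele^2^2" where
  "amat \<equiv> map_matrix adele_of_rat"

lemma amat_mult: "amat (g ** h) = amat g ** amat h"
  by (simp add: vec_eq_iff matrix_matrix_mult_def sum_2 adele_of_rat_add adele_of_rat_mult)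

lemma amat_mat: "amat (mat q) = mat (adele_of_rat q)"
  by (simp add: vec_eq_iff mat_def adele_of_rat_0)

lemma amat_one [simp]: "amat (mat 1) = mat 1"
  by (simp add: amat_mat adele_of_rat_1)

lemma amat_SL2Z: "\<gamma> \<in> SL2Z \<Longrightarrow> amat \<gamma> \<in> M2R"
  by (auto simp: SL2Z_def M2R_iff of_int_range_zhat adele_of_rat_of_int)

lemma mat_of_int_M2R: "mat (of_int n) \<in> M2R"
  using of_int_range_zhat[of 0] of_int_range_zhat[of n] by (auto simp: M2R_iff mat_def)

lemma M2R_SL2Z_mult: "\<gamma> \<in> SL2Z \<Longrightarrow> amat \<gamma> ** \<rho> \<in> M2R \<longleftrightarrow> \<rho> \<in> M2R"
proof
  assume \<gamma>: "\<gamma> \<in> SL2Z" and "amat \<gamma> ** \<rho> \<in> M2R"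
  then have "amat (matrix_inv \<gamma>) ** (amat \<gamma> ** \<rho>) \<in> M2R" by (auto intro!: M2R_mult[of "amat (matrix_inv \<gamma>)"] amat_SL2Z)
  moreover have "amat (matrix_inv \<gamma>) ** (amat \<gamma> ** \<rho>) = \<rho>"
    using \<gamma> amat_mult[of "matrix_inv \<gamma>" \<gamma>, symmetric] by (simp add: matrix_mul_assoc GL2Qp_inv)
  ultimately show "\<rho> \<in> M2R" by simp
qed (simp add: M2R_mult amat_SL2Z)

text \<open>The product of denominators of the four entries works. It serves both to bring a
  translated point y x back into Y and to find representatives with integral inverse in the classes
  of S.\<close>

lemma denominator_adele_matrix:
  fixes x :: "adele^2^2"
  obtains n :: int where "n > 0" "mat (of_int n) ** x \<in> M2R"
proof -
  have "\<exists>n>0. of_int n * a \<in> range adele_of_zhat" for a :: adele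
  proof -
    obtain y n where yn: "n > 0" "a = adele_frac y n" by (rule adele_fracE)
    then have "of_int n * a = adele_of_zhat y"
      by (simp add: of_int_eq_adele_frac adele_frac_mult adele_of_zhat_def adele_frac_eq_iff mult.commute)
    then show ?thesis using yn by blast
  qed
  then obtain N where N: "\<And>a. N a > 0" "\<And>a :: adele. of_int (N a) * a \<in> range adele_of_zhat" by metis
  have mul: "of_int k * a \<in> range adele_of_zhat" if "a \<in> range adele_of_zhat" for k and a :: adele
    using that by (auto simp: adele_of_zhat_def of_int_eq_adele_frac adele_frac_mult)
  define n where "n = N (x$1$1) * N (x$1$2) * N (x$2$1) * N (x$2$2)"
  have "of_int n * x $ i $ j \<in> range adele_of_zhat" for i j
  proof -
    have "N (x $ i $ j) dvd n" using exhaust_2[of i] exhaust_2[of j] by (auto simp: n_def)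
    then obtain k where "n = k * N (x $ i $ j)" by (metis dvd_def mult.commute)
    then have "of_int n * x $ i $ j = of_int k * (of_int (N (x $ i $ j)) * x $ i $ j)" by (simp add: mult.assoc)
    then show ?thesis using mul N by simp
  qed
  then have "mat (of_int n) ** x \<in> M2R"
    by (simp add: M2R_iff matrix_matrix_mult_def mat_def sum_2 forall_2)
  then show ?thesis using that[of n] N by (simp add: n_def)
qed

subsection \<open>Moebius transformations\<close>

lemma of_rat_complex: "(of_rat q :: complex) = of_real (of_rat q)"
  by (cases q) (simp add: of_rat_rat)

lemma Im_moebius:
  "Im (moebius g \<tau>) = of_rat (det g) * Im \<tau> / (cmod (of_rat (g$2$1) * \<tau> + of_rat (g$2$2)))\<^sup>2"
proof -
  have "Im (moebius g \<tau>) = Im ((of_rat (g$1$1) * \<tau> + of_rat (g$1$2)) * cnj (of_rat (g$2$1) * \<tau> + of_rat (g$2$2)))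
      / (cmod (of_rat (g$2$1) * \<tau> + of_rat (g$2$2)))\<^sup>2"
    unfolding moebius_def by (subst complex_div_cnj) (simp flip: of_real_power)
  also have "Im ((of_rat (g$1$1) * \<tau> + of_rat (g$1$2)) * cnj (of_rat (g$2$1) * \<tau> + of_rat (g$2$2)))
      = of_rat (det g) * Im \<tau>"
    by (simp add: of_rat_complex det_2 of_rat_diff of_rat_mult algebra_simps)
  finally show ?thesis .
qed

lemma moebius_denom_nonzero:
  assumes "g \<in> GL2Qp" "Im \<tau> > 0"
  shows "of_rat (g$2$1) * \<tau> + of_rat (g$2$2) \<noteq> 0"
proof
  assume *: "of_rat (g$2$1) * \<tau> + of_rat (g$2$2) = 0"
  then have "Im (of_rat (g$2$1) * \<tau> + of_rat (g$2$2)) = 0" by simp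
  then have "g$2$1 = 0" using assms(2) by (simp add: of_rat_complex)
  moreover from this * have "g$2$2 = 0" by simp
  ultimately show False using assms(1) by (simp add: GL2Qp_def det_2)
qed

lemma Im_moebius_pos: "g \<in> GL2Qp \<Longrightarrow> Im (moebius g \<tau>) > 0 \<longleftrightarrow> Im \<tau> > 0"
proof
  assume "g \<in> GL2Qp" "Im (moebius g \<tau>) > 0"
  then show "Im \<tau> > 0" by (auto simp: Im_moebius GL2Qp_def zero_less_mult_iff zero_less_divide_iff not_less[symmetric])
next
  assume *: "g \<in> GL2Qp" "Im \<tau> > 0"
  then show "Im (moebius g \<tau>) > 0"
    using moebius_denom_nonzero[OF *] by (simp add: Im_moebius GL2Qp_def)
qed

lemma moebius_mult:
  assumes "g \<in> GL2Qp" "h \<in> GL2Qp" "Im \<tau> > 0"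
  shows "moebius (g ** h) \<tau> = moebius g (moebius h \<tau>)"
proof -
  define w where "w = of_rat (h$2$1) * \<tau> + of_rat (h$2$2)"
  define v where "v = of_rat (h$1$1) * \<tau> + of_rat (h$1$2)"
  have w: "w \<noteq> 0" unfolding w_def using assms by (intro moebius_denom_nonzero)
  have num: "of_rat ((g ** h)$i$1) * \<tau> + of_rat ((g ** h)$i$2) = of_rat (g$i$1) * v + of_rat (g$i$2) * w" for i
    by (simp add: matrix_matrix_mult_def sum_2 of_rat_add of_rat_mult v_def w_def algebra_simps)
  have "of_rat (g$i$1) * v + of_rat (g$i$2) * w = (of_rat (g$i$1) * (v / w) + of_rat (g$i$2)) * w" for i
    using w by (simp add: field_simps)
  then have "moebius (g ** h) \<tau> = ((of_rat (g$1$1) * (v / w) + of_rat (g$1$2)) * w) / ((of_rat (g$2$1) * (v / w) + of_rat (g$2$2)) * w)"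
    unfolding moebius_def num by simp
  also have "\<dots> = moebius g (moebius h \<tau>)"
    using w by (simp add: moebius_def[of g] moebius_def[of h] flip: v_def w_def)
  finally show ?thesis .
qed

lemma moebius_mat [simp]: "a \<noteq> 0 \<Longrightarrow> moebius (mat a) \<tau> = \<tau>"
  by (simp add: moebius_def mat_def)

lemma continuous_on_moebius [continuous_intros]:
  assumes "g \<in> GL2Qp" "continuous_on S f" "\<And>x. x \<in> S \<Longrightarrow> Im (f x) > 0"
  shows "continuous_on S (\<lambda>x. moebius g (f x))"
  unfolding moebius_def using assms moebius_denom_nonzero by (intro continuous_intros) auto

subsection \<open>The action on the pairs of an adelic matrix and a point of the upper half plane\<close>

text \<open>Unlike \<open>Y_space\<close>, this set does not ask for integrality, so it is stable
  under GL_2^+(Q) and under right multiplication by adelic matrices. Functions extended by zero can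
  be evaluated and composed on it without side conditions.\<close>

definition AH :: "((adele^2^2) \<times> complex) set" where
  "AH = {y. Im (snd y) > 0}"

lemma Y_space_iff: "y \<in> Y_space \<longleftrightarrow> fst y \<in> M2R \<and> y \<in> AH"
  by (cases y) (auto simp: Y_space_def AH_def)

lemma act_AH: "g \<in> GL2Qp \<Longrightarrow> act g y \<in> AH \<longleftrightarrow> y \<in> AH"
  by (simp add: act_def AH_def Im_moebius_pos)

lemma act_mult: "g \<in> GL2Qp \<Longrightarrow> h \<in> GL2Qp \<Longrightarrow> y \<in> AH \<Longrightarrow> act (g ** h) y = act g (act h y)"
  by (simp add: act_def AH_def moebius_mult amat_mult matrix_mul_assoc)

lemma act_mat: "a \<noteq> 0 \<Longrightarrow> act (mat a) y = (mat (adele_of_rat a) ** fst y, snd y)"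
  by (simp add: act_def amat_mat)

lemma act_one [simp]: "act (mat 1) y = y"
  by (simp add: act_mat adele_of_rat_1)

lemma act_inv:
  assumes "g \<in> GL2Qp" "y \<in> AH"
  shows "act (matrix_inv g) (act g y) = y" "act g (act (matrix_inv g) y) = y"
  using assms by (simp_all add: GL2Qp_inv flip: act_mult)

lemma continuous_on_act:
  assumes "g \<in> GL2Qp" "continuous_on S f" "\<And>x. x \<in> S \<Longrightarrow> f x \<in> AH"
  shows "continuous_on S (\<lambda>x. act g (f x))"
  unfolding act_def using assms by (auto intro!: continuous_intros continuous_on_adele_matrix_mult simp: AH_def)

lemma U_space_iff: "(g, y) \<in> U_space \<longleftrightarrow> g \<in> GL2Qp \<and> y \<in> AH \<and> fst y \<in> M2R \<and> amat g ** fst y \<in> M2R"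
  by (auto simp: U_space_def G_at_def Y_space_iff act_AH) (auto simp: act_def)

lemma U_space_SL2Z_left: "\<gamma> \<in> SL2Z \<Longrightarrow> (\<gamma> ** g, y) \<in> U_space \<longleftrightarrow> (g, y) \<in> U_space"
  by (auto simp: U_space_iff GL2Qp_mult_iff amat_mult M2R_SL2Z_mult simp flip: matrix_mul_assoc)

lemma U_space_SL2Z_right: "\<gamma> \<in> SL2Z \<Longrightarrow> (g ** \<gamma>, y) \<in> U_space \<longleftrightarrow> (g, act \<gamma> y) \<in> U_space"
  by (auto simp: U_space_iff GL2Qp_mult_iff_right amat_mult act_AH)
     (auto simp: act_def M2R_SL2Z_mult matrix_mul_assoc)

subsection \<open>Boxes in the upper half plane\<close>

text \<open>A compact exhaustion of the upper half plane by rectangles with one parameter; every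
  compact subset lies in some \<open>Box M\<close>, and the open versions \<open>OBox\<close> serve
  as a cover.\<close>

definition Box :: "real \<Rightarrow> complex set" where
  "Box M = {\<tau>. \<bar>Re \<tau>\<bar> \<le> M \<and> 1 / M \<le> Im \<tau> \<and> Im \<tau> \<le> M}"

definition OBox :: "real \<Rightarrow> complex set" where
  "OBox M = {\<tau>. \<bar>Re \<tau>\<bar> < M \<and> 1 / M < Im \<tau> \<and> Im \<tau> < M}"

lemma OBox_Box: "OBox M \<subseteq> Box M"
  by (auto simp: OBox_def Box_def)

lemma Box_Im: "1 \<le> M \<Longrightarrow> \<tau> \<in> Box M \<Longrightarrow> Im \<tau> > 0"
  by (auto simp: Box_def intro: less_le_trans[of 0 "1 / M"])

lemma Box_mono:
  assumes "1 \<le> M" "M \<le> N"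
  shows "Box M \<subseteq> Box N"
proof -
  have "1 / N \<le> 1 / M" using assms by (intro divide_left_mono) auto
  then show ?thesis using assms by (auto simp: Box_def)
qed

lemma OBox_mono:
  assumes "1 \<le> M" "M \<le> N"
  shows "OBox M \<subseteq> OBox N"
proof -
  have "1 / N \<le> 1 / M" using assms by (intro divide_left_mono) auto
  then show ?thesis using assms by (auto simp: OBox_def)
qed

lemma open_OBox: "open (OBox M)"
  unfolding OBox_def by (intro open_Collect_conj open_Collect_less continuous_intros)

lemma compact_Box: "compact (Box M)"
proof -
  have "Box M = cbox (Complex (- M) (1 / M)) (Complex M M)"
    by (auto simp: Box_def in_cbox_complex_iff)
  then show ?thesis by simp
qed

lemma closed_Box: "closed (Box M)"
  by (rule compact_imp_closed[OF compact_Box])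

lemma compact_subset_Box:
  assumes "compact K" "\<And>\<tau>. \<tau> \<in> K \<Longrightarrow> Im \<tau> > 0"
  obtains M where "1 \<le> M" "K \<subseteq> Box M"
proof (cases "K = {}")
  case True
  then show ?thesis using that[of 1] by simp
next
  case False
  obtain B where B: "\<And>\<tau>. \<tau> \<in> K \<Longrightarrow> cmod \<tau> \<le> B"
    using compact_imp_bounded[OF assms(1)] by (auto simp: bounded_iff)
  obtain \<tau>0 where t0: "\<tau>0 \<in> K" "\<And>\<tau>. \<tau> \<in> K \<Longrightarrow> Im \<tau>0 \<le> Im \<tau>"
    using continuous_attains_inf[OF assms(1) False, of Im] continuous_on_Im[OF continuous_on_id] by blast
  define M where "M = max 1 (max B (1 / Im \<tau>0))"
  have "\<tau> \<in> Box M" if "\<tau> \<in> K" for \<tau>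
  proof -
    have "1 / M \<le> Im \<tau>0"
    proof -
      have "1 / Im \<tau>0 \<le> M" "0 < M" by (simp_all add: M_def)
      then show ?thesis using assms(2)[OF t0(1)] by (simp add: field_simps)
    qed
    then show ?thesis
      using t0(2)[OF that] B[OF that] abs_Re_le_cmod[of \<tau>] abs_Im_le_cmod[of \<tau>] by (auto simp: Box_def M_def)
  qed
  then show ?thesis using that[of M] by (auto simp: M_def)
qed

lemma OBox_cover:
  assumes "Im \<tau> > 0"
  obtains n :: nat where "1 \<le> n" "\<tau> \<in> OBox n"
proof -
  define M where "M = 1 + cmod \<tau> + 1 / Im \<tau>"
  have "1 / M < Im \<tau>"
  proof -
    have "1 / Im \<tau> < M" by (simp add: M_def add_pos_nonneg)
    moreover have "0 < M" using assms by (simp add: M_def add_pos_nonneg)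
    ultimately show ?thesis using assms by (simp add: field_simps)
  qed
  moreover have "1 \<le> M" "cmod \<tau> < M" using assms by (auto simp: M_def add_strict_increasing)
  ultimately have "\<tau> \<in> OBox M"
    using abs_Re_le_cmod[of \<tau>] abs_Im_le_cmod[of \<tau>] by (auto simp: OBox_def)
  obtain n :: nat where "M \<le> n" using real_arch_simple by blast
  then have "1 \<le> n" "\<tau> \<in> OBox n" using OBox_mono[OF \<open>1 \<le> M\<close> \<open>M \<le> n\<close>] \<open>\<tau> \<in> OBox M\<close> \<open>1 \<le> M\<close> by auto
  then show ?thesis using that by blast
qed

lemma moebius_Box:
  assumes "g \<in> GL2Qp" "1 \<le> M"
  obtains N where "1 \<le> N" "moebius g ` Box M \<subseteq> Box N"
proof (rule compact_subset_Box[of "moebius g ` Box M"])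
  show "compact (moebius g ` Box M)"
    using assms Box_Im by (intro compact_continuous_image compact_Box continuous_intros) auto
qed (use assms Box_Im in \<open>auto simp: Im_moebius_pos\<close>)

text \<open>Follows the \<tau>-support through finitely many double coset representatives, as
  required for convolutions and adjoints.\<close>

lemma finite_moebius_Box:
  assumes "finite D" "D \<subseteq> GL2Qp" "1 \<le> M"
  obtains N where "1 \<le> N" "\<And>d \<tau>. d \<in> D \<Longrightarrow> \<tau> \<in> Box M \<Longrightarrow> moebius d \<tau> \<in> Box N"
proof -
  have "\<exists>N\<ge>1. moebius d ` Box M \<subseteq> Box N" if "d \<in> GL2Qp" for d
    using moebius_Box[OF that assms(3)] by blast
  then obtain N where N: "\<And>d. d \<in> GL2Qp \<Longrightarrow> N d \<ge> 1 \<and> moebius d ` Box M \<subseteq> Box (N d)" by metis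
  \<comment> \<open>All \<open>N d\<close> are at least 1, so the sum dominates each of them; the
    extra 1 keeps L at least 1 when D is empty.\<close>
  define L where "L = 1 + (\<Sum>d\<in>D. N d)"
  have "N d \<le> L" if "d \<in> D" for d
    using member_le_sum[OF that, of N] N assms by (force simp: L_def)
  moreover have "0 \<le> (\<Sum>d\<in>D. N d)" by (intro sum_nonneg order_trans[OF zero_le_one]) (use N assms(2) in blast)
  ultimately have L: "1 \<le> L" "\<And>d. d \<in> D \<Longrightarrow> N d \<le> L" by (simp_all add: L_def)
  have "moebius d \<tau> \<in> Box L" if d: "d \<in> D" and \<tau>: "\<tau> \<in> Box M" for d \<tau>
  proof -
    have "d \<in> GL2Qp" using d assms(2) by blast
    then have "1 \<le> N d" "moebius d \<tau> \<in> Box (N d)" using N \<tau> by blast+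
    then show ?thesis using Box_mono[of "N d" L] L(2)[OF d] by blast
  qed
  then show ?thesis using that L(1) by blast
qed

text \<open>Proper discontinuity: \<open>Im (\<gamma> \<tau>) = Im \<tau> / |c \<tau> + d|\<^sup>2\<close> bounds the bottom row of \<open>\<gamma>\<close>, and
  \<open>a \<tau> + b = \<gamma> \<tau> (c \<tau> + d)\<close> then bounds the top row.\<close>

lemma finite_SL2Z_Box:
  assumes M: "1 \<le> M"
  shows "finite {\<gamma> \<in> SL2Z. \<exists>\<tau>\<in>Box M. moebius \<gamma> \<tau> \<in> Box M}"
proof -
  \<comment> \<open>A row (a, b) with |a \<tau> + b| at most 2 M^2 has |a| at most 2 M^3, since Im
    \<tau> is at least 1/M, and then |b| is at most 2 M^2 + 2 M^3 * 2 M, which is at most 6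
    M^4.\<close>
  define N where "N = 6 * M ^ 4"
  have row: "a \<in> {- \<lceil>N\<rceil>..\<lceil>N\<rceil>} \<and> b \<in> {- \<lceil>N\<rceil>..\<lceil>N\<rceil>}"
    if \<tau>: "\<tau> \<in> Box M" and le: "cmod (of_int a * \<tau> + of_int b) \<le> 2 * M ^ 2" for a b \<tau>
  proof -
    have im: "1 / M \<le> Im \<tau>" "cmod \<tau> \<le> 2 * M"
      using \<tau> cmod_le[of \<tau>] Box_Im[OF M \<tau>] by (auto simp: Box_def)
    have "\<bar>real_of_int a\<bar> * (1 / M) \<le> \<bar>real_of_int a\<bar> * Im \<tau>"
      using im(1) by (intro mult_left_mono) auto
    also have "\<dots> = \<bar>Im (of_int a * \<tau> + of_int b)\<bar>"
      using Box_Im[OF M \<tau>] by (simp add: abs_mult)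
    also have "\<dots> \<le> 2 * M ^ 2" using abs_Im_le_cmod le order_trans by blast
    finally have a: "\<bar>real_of_int a\<bar> \<le> 2 * M ^ 3"
      using M by (simp add: divide_simps power_numeral_reduce)
    have "cmod (of_int b :: complex) \<le> cmod (of_int a * \<tau> + of_int b) + cmod (of_int a * \<tau>)"
      using norm_triangle_ineq4[of "of_int a * \<tau> + of_int b" "of_int a * \<tau>"] by simp
    also have "\<dots> \<le> 2 * M ^ 2 + 2 * M ^ 3 * (2 * M)"
      using le mult_mono[OF a im(2)] M by (simp add: norm_mult)
    finally have b: "\<bar>real_of_int b\<bar> \<le> 2 * M ^ 2 + 4 * M ^ 4" by (simp add: power_numeral_reduce)
    have "M ^ 2 \<le> M ^ 4" "M ^ 3 \<le> M ^ 4" "0 \<le> M ^ 4" using M by (auto intro: power_increasing)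
    with a b have "\<bar>real_of_int a\<bar> \<le> N" "\<bar>real_of_int b\<bar> \<le> N" unfolding N_def by linarith+
    then show ?thesis by (simp add: abs_le_iff) linarith
  qed
  define F where "F = (\<lambda>(a, b, c, d). vector [vector [of_int a, of_int b], vector [of_int c, of_int d]] :: rat^2^2)"
  have "{\<gamma> \<in> SL2Z. \<exists>\<tau>\<in>Box M. moebius \<gamma> \<tau> \<in> Box M} \<subseteq>
    F ` ({- \<lceil>N\<rceil>..\<lceil>N\<rceil>} \<times> {- \<lceil>N\<rceil>..\<lceil>N\<rceil>} \<times> {- \<lceil>N\<rceil>..\<lceil>N\<rceil>} \<times> {- \<lceil>N\<rceil>..\<lceil>N\<rceil>})"
  proof clarify
    fix \<gamma> \<tau> assume g: "\<gamma> \<in> SL2Z" and \<tau>: "\<tau> \<in> Box M" and g\<tau>: "moebius \<gamma> \<tau> \<in> Box M"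
    then obtain k :: "int^2^2" where k: "\<gamma> = map_matrix of_int k" by (auto simp: SL2Z_def)
    define w where "w = of_int (k$2$1) * \<tau> + of_int (k$2$2)"
    define v where "v = of_int (k$1$1) * \<tau> + of_int (k$1$2)"
    have w0: "w \<noteq> 0" using moebius_denom_nonzero[of \<gamma> \<tau>] Box_Im[OF M \<tau>] g by (simp add: w_def k)
    have "1 / M \<le> Im \<tau> / (cmod w)\<^sup>2"
      using g\<tau> SL2Z_det[OF g] Im_moebius[of \<gamma> \<tau>] by (simp add: Box_def k w_def)
    also have "\<dots> \<le> M / (cmod w)\<^sup>2" using \<tau> by (intro divide_right_mono) (auto simp: Box_def)
    finally have "(cmod w)\<^sup>2 \<le> M\<^sup>2" using M w0 by (simp add: field_simps power2_eq_square)
    then have w: "cmod w \<le> M" by (rule power2_le_imp_le) (use M in simp)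
    have "v = moebius \<gamma> \<tau> * w" using w0 by (simp add: moebius_def k v_def w_def)
    moreover have "cmod (moebius \<gamma> \<tau>) \<le> 2 * M" using g\<tau> cmod_le[of "moebius \<gamma> \<tau>"] Box_Im[OF M g\<tau>] by (auto simp: Box_def)
    ultimately have v: "cmod v \<le> 2 * M ^ 2"
      using w M mult_mono[of "cmod (moebius \<gamma> \<tau>)" "2 * M" "cmod w" M]
      by (simp add: norm_mult power2_eq_square)
    have "M * 1 \<le> M * (2 * M)" using M by (intro mult_left_mono) auto
    then have w': "cmod w \<le> 2 * M ^ 2" using w by (simp add: power2_eq_square)
    have "\<gamma> = F (k$1$1, k$1$2, k$2$1, k$2$2)" by (simp add: F_def k vec_eq_iff forall_2)
    then show "\<gamma> \<in> F ` ({- \<lceil>N\<rceil>..\<lceil>N\<rceil>} \<times> {- \<lceil>N\<rceil>..\<lceil>N\<rceil>} \<times> {- \<lceil>N\<rceil>..\<lceil>N\<rceil>} \<times> {- \<lceil>N\<rceil>..\<lceil>N\<rceil>})"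
      using row[OF \<tau> v[unfolded v_def]] row[OF \<tau> w'[unfolded w_def]] by blast
  qed
  then show ?thesis by (rule finite_subset) auto
qed

section \<open>Compactly supported functions on \<open>Z\<close>\<close>

text \<open>GL_2^+(Q) is discrete, so openness is tested slice by slice; and the slices of
  \<open>U_space\<close> are themselves open in the space of all pairs because M_2(R) is open, so no
  relative topology remains.\<close>

lemma openin_U_top:
  "openin U_top W \<longleftrightarrow> W \<subseteq> U_space \<and> (\<forall>g\<in>GL2Qp. open {y. (g, y) \<in> W})"
proof
  have open_slice: "open {y. (g, y) \<in> U_space}" for g
  proof (cases "g \<in> GL2Qp")
    case True
    have eq: "{y. (g, y) \<in> U_space} = {y. Im (snd y) > 0} \<inter> ((fst -` M2R) \<inter> ((\<lambda>y. amat g ** fst y) -` M2R))"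
      using True by (auto simp: U_space_iff AH_def)
    show ?thesis
      unfolding eq by (intro open_Int open_vimage open_M2R continuous_on_adele_matrix_mult open_Collect_less continuous_intros)
  qed (simp add: U_space_iff)
  assume "openin U_top W"
  then obtain T where T: "openin (prod_topology (discrete_topology GL2Qp) euclidean) T" "W = T \<inter> U_space"
    by (auto simp: U_top_def openin_subtopology)
  have "open {y. (g, y) \<in> T}" for g
  proof (subst open_subopen, clarify)
    fix a b assume ab: "(g, a, b) \<in> T"
    from T(1)[unfolded openin_prod_topology_alt, rule_format, OF ab]
    obtain A B where "g \<in> A" "(a, b) \<in> B" "openin euclidean B" "A \<times> B \<subseteq> T" by blast
    then show "\<exists>S. open S \<and> (a, b) \<in> S \<and> S \<subseteq> {y. (g, y) \<in> T}" by (intro exI[of _ B]) auto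
  qed
  then have "open ({y. (g, y) \<in> T} \<inter> {y. (g, y) \<in> U_space})" for g by (intro open_Int open_slice)
  moreover have "{y. (g, y) \<in> T} \<inter> {y. (g, y) \<in> U_space} = {y. (g, y) \<in> W}" for g using T(2) by auto
  ultimately show "W \<subseteq> U_space \<and> (\<forall>g\<in>GL2Qp. open {y. (g, y) \<in> W})" using T(2) by simp
next
  assume W: "W \<subseteq> U_space \<and> (\<forall>g\<in>GL2Qp. open {y. (g, y) \<in> W})"
  have "openin (prod_topology (discrete_topology GL2Qp) euclidean) (\<Union>g\<in>GL2Qp. {g} \<times> {y. (g, y) \<in> W})"
    using W by (intro openin_clauses(3) ballI) (auto simp: openin_prod_Times_iff)
  moreover have "(\<Union>g\<in>GL2Qp. {g} \<times> {y. (g, y) \<in> W}) = W" using W by (auto simp: U_space_iff)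
  ultimately show "openin U_top W"
    using W unfolding U_top_def openin_subtopology by (intro exI[of _ W]) auto
qed

section \<open>Saturated subsets of U lying over sets of \<tau>\<close>

lemma open_AH: "open AH"
  unfolding AH_def by (intro open_Collect_less continuous_intros)

lemma open_moebius_vimage:
  assumes "g \<in> GL2Qp" "open B"
  shows "open {\<tau>. Im \<tau> > 0 \<and> moebius g \<tau> \<in> B}"
proof -
  have "continuous_on {\<tau>. Im \<tau> > 0} (moebius g)"
    using assms(1) by (intro continuous_intros) auto
  moreover have "open {\<tau>. Im \<tau> > 0}" by (intro open_Collect_less continuous_intros)
  ultimately have "open (moebius g -` B \<inter> {\<tau>. Im \<tau> > 0})"
    using assms(2) continuous_on_open_vimage by blast
  moreover have "moebius g -` B \<inter> {\<tau>. Im \<tau> > 0} = {\<tau>. Im \<tau> > 0 \<and> moebius g \<tau> \<in> B}" by auto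
  ultimately show ?thesis by simp
qed

text \<open>An infinite intersection of open conditions, yet locally a finite one: by proper
  discontinuity only finitely many \<gamma> carry a point near a given \<tau> into
  \<open>Box M\<close>.\<close>

lemma open_moebius_avoid_Box:
  assumes "A \<subseteq> SL2Z" "1 \<le> M"
  shows "open {\<tau>. Im \<tau> > 0 \<and> (\<forall>\<gamma>\<in>A. moebius \<gamma> \<tau> \<notin> Box M)}" (is "open ?X")
proof (subst open_subopen, intro ballI)
  fix \<tau>0 assume \<tau>0: "\<tau>0 \<in> ?X"
  then obtain n :: nat where n: "1 \<le> n" "\<tau>0 \<in> OBox n" using OBox_cover by blast
  define N where "N = max M (real n)"
  \<comment> \<open>N is chosen so that \<open>Box N\<close> contains both the neighbourhood
    \<open>OBox n\<close> and the target \<open>Box M\<close>; every \<gamma> in A that could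
    violate the condition on \<open>OBox n\<close> then lies in F.\<close>
  define F where "F = A \<inter> {\<gamma> \<in> SL2Z. \<exists>\<tau>\<in>Box N. moebius \<gamma> \<tau> \<in> Box N}"
  have "finite F" using finite_SL2Z_Box[of N] assms(2) by (auto simp: F_def N_def)
  define S where "S = OBox n \<inter> (\<Inter>\<gamma>\<in>F. {\<tau>. Im \<tau> > 0 \<and> moebius \<gamma> \<tau> \<in> - Box M})"
  have "open S"
    unfolding S_def using \<open>finite F\<close>
    by (intro open_Int open_OBox open_INT ballI open_moebius_vimage open_Compl closed_Box) (auto simp: F_def)
  moreover have "\<tau>0 \<in> S" using \<tau>0 n by (auto simp: S_def F_def)
  moreover have "S \<subseteq> ?X"
  proof (clarify, intro conjI ballI notI)
    fix \<tau> assume \<tau>: "\<tau> \<in> S"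
    then have box: "\<tau> \<in> Box n" using OBox_Box by (auto simp: S_def)
    then show "Im \<tau> > 0" using Box_Im[of "real n"] n by auto
    fix \<gamma> assume \<gamma>: "\<gamma> \<in> A" "moebius \<gamma> \<tau> \<in> Box M"
    have "Box M \<subseteq> Box N" "Box n \<subseteq> Box N"
      using Box_mono[of M N] Box_mono[of n N] assms(2) n by (auto simp: N_def)
    then have "\<gamma> \<in> F" using \<gamma> box assms(1) by (auto simp: F_def)
    then show False using \<tau> \<gamma> by (auto simp: S_def)
  qed
  ultimately show "\<exists>T. open T \<and> \<tau>0 \<in> T \<and> T \<subseteq> ?X" by blast
qed

text \<open>Under Gamma x Gamma the pair (\<gamma>' d \<gamma>, y) is equivalent to (d, \<gamma> y).
  This is therefore the saturation of the points with g in D and \<tau> in S, which is why the same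
  \<gamma> occurs in both conditions.\<close>

definition tube :: "(rat^2^2) set \<Rightarrow> complex set \<Rightarrow> ((rat^2^2) \<times> ((adele^2^2) \<times> complex)) set" where
  "tube D S = {(g, y) \<in> U_space. \<exists>\<gamma>\<in>SL2Z. \<exists>\<gamma>'\<in>SL2Z. \<exists>d\<in>D. g = \<gamma>' ** d ** \<gamma> \<and> moebius \<gamma> (snd y) \<in> S}"

lemma tube_subset: "tube D S \<subseteq> U_space"
  by (auto simp: tube_def)

lemma tube_mono: "D \<subseteq> D' \<Longrightarrow> S \<subseteq> S' \<Longrightarrow> tube D S \<subseteq> tube D' S'"
  unfolding tube_def by blast

lemma openin_tube: "open S \<Longrightarrow> openin U_top (tube D S)"
proof (unfold openin_U_top, intro conjI ballI)
  fix g assume S: "open S" and g: "g \<in> GL2Qp"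
  define A where "A = {\<gamma> \<in> SL2Z. \<exists>\<gamma>'\<in>SL2Z. \<exists>d\<in>D. g = \<gamma>' ** d ** \<gamma>}"
  have eq: "{y. (g, y) \<in> tube D S} = {y. (g, y) \<in> U_space} \<inter> snd -` (\<Union>\<gamma>\<in>A. {\<tau>. Im \<tau> > 0 \<and> moebius \<gamma> \<tau> \<in> S})"
    by (auto simp: tube_def A_def U_space_iff AH_def)
  have "openin U_top U_space" using openin_topspace[of U_top] by (simp add: topspace_U_top)
  then have "open {y. (g, y) \<in> U_space}" using g by (simp add: openin_U_top)
  then show "open {y. (g, y) \<in> tube D S}"
    unfolding eq using S by (intro open_Int open_vimage open_UN ballI open_moebius_vimage continuous_intros) (auto simp: A_def)
qed (rule tube_subset)

lemma openin_compl_tube_Box: "1 \<le> M \<Longrightarrow> openin U_top (U_space - tube D (Box M))"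
proof (unfold openin_U_top, intro conjI ballI)
  fix g assume M: "1 \<le> M" and g: "g \<in> GL2Qp"
  define A where "A = {\<gamma> \<in> SL2Z. \<exists>\<gamma>'\<in>SL2Z. \<exists>d\<in>D. g = \<gamma>' ** d ** \<gamma>}"
  have eq: "{y. (g, y) \<in> U_space - tube D (Box M)} =
    {y. (g, y) \<in> U_space} \<inter> snd -` {\<tau>. Im \<tau> > 0 \<and> (\<forall>\<gamma>\<in>A. moebius \<gamma> \<tau> \<notin> Box M)}"
    by (auto simp: tube_def A_def U_space_iff AH_def)
  have "openin U_top U_space" using openin_topspace[of U_top] by (simp add: topspace_U_top)
  then have "open {y. (g, y) \<in> U_space}" using g by (simp add: openin_U_top)
  then show "open {y. (g, y) \<in> U_space - tube D (Box M)}"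
    unfolding eq using M by (intro open_Int open_vimage open_moebius_avoid_Box continuous_intros) (auto simp: A_def)
qed auto

section \<open>Orbits of Gamma x Gamma\<close>

lemma mem_Z_proj: "u \<in> Z_proj u"
proof -
  have "matrix_inv (mat 1 :: rat^2^2) = mat 1" by (intro matrix_inv_unique) simp_all
  then have "u = (mat 1 ** fst u ** matrix_inv (mat 1), act (mat 1) (snd u))" by simp
  then show ?thesis unfolding Z_proj_def using SL2Z_one by blast
qed

lemma Z_proj_eqD:
  assumes "Z_proj (g, y) = Z_proj v"
  obtains \<gamma>1 \<gamma>2 where "\<gamma>1 \<in> SL2Z" "\<gamma>2 \<in> SL2Z" "g = \<gamma>1 ** fst v ** matrix_inv \<gamma>2" "y = act \<gamma>2 (snd v)"
proof -
  have "(g, y) \<in> Z_proj v" using mem_Z_proj[of "(g, y)"] assms by simp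
  then show ?thesis using that by (auto simp: Z_proj_def)
qed

lemma Z_proj_left: "\<gamma> \<in> SL2Z \<Longrightarrow> Z_proj (\<gamma> ** g, y) = Z_proj (g, y)"
proof (rule equalityI)
  assume \<gamma>: "\<gamma> \<in> SL2Z"
  show "Z_proj (\<gamma> ** g, y) \<subseteq> Z_proj (g, y)"
  proof
    fix z assume "z \<in> Z_proj (\<gamma> ** g, y)"
    then obtain a b where ab: "a \<in> SL2Z" "b \<in> SL2Z" "z = (a ** (\<gamma> ** g) ** matrix_inv b, act b y)"
      by (auto simp: Z_proj_def)
    then have "z = ((a ** \<gamma>) ** g ** matrix_inv b, act b y)" by (simp add: matrix_mul_assoc)
    then show "z \<in> Z_proj (g, y)" unfolding Z_proj_def fst_conv snd_conv using \<gamma> ab SL2Z_mult by blast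
  qed
  show "Z_proj (g, y) \<subseteq> Z_proj (\<gamma> ** g, y)"
  proof
    fix z assume "z \<in> Z_proj (g, y)"
    then obtain a b where ab: "a \<in> SL2Z" "b \<in> SL2Z" "z = (a ** g ** matrix_inv b, act b y)"
      by (auto simp: Z_proj_def)
    then have "z = ((a ** matrix_inv \<gamma>) ** (\<gamma> ** g) ** matrix_inv b, act b y)"
      using \<gamma> by (simp add: matrix_mul_assoc GL2Qp_mult_cancel)
    then show "z \<in> Z_proj (\<gamma> ** g, y)"
      unfolding Z_proj_def fst_conv snd_conv using \<gamma> ab SL2Z_mult SL2Z_matrix_inv by blast
  qed
qed

lemma Z_proj_right:
  assumes "\<gamma> \<in> SL2Z" "y \<in> AH"
  shows "Z_proj (g ** \<gamma>, y) = Z_proj (g, act \<gamma> y)"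
proof (rule equalityI)
  show "Z_proj (g ** \<gamma>, y) \<subseteq> Z_proj (g, act \<gamma> y)"
  proof
    fix z assume "z \<in> Z_proj (g ** \<gamma>, y)"
    then obtain a b where ab: "a \<in> SL2Z" "b \<in> SL2Z" "z = (a ** (g ** \<gamma>) ** matrix_inv b, act b y)"
      by (auto simp: Z_proj_def)
    then have "z = (a ** g ** matrix_inv (b ** matrix_inv \<gamma>), act (b ** matrix_inv \<gamma>) (act \<gamma> y))"
      using assms by (simp add: matrix_mul_assoc GL2Qp_mult_cancel GL2Qp_matrix_inv_mult GL2Qp_matrix_inv_inv flip: act_mult)
    then show "z \<in> Z_proj (g, act \<gamma> y)"
      unfolding Z_proj_def fst_conv snd_conv using assms ab SL2Z_mult SL2Z_matrix_inv by blast
  qed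
  show "Z_proj (g, act \<gamma> y) \<subseteq> Z_proj (g ** \<gamma>, y)"
  proof
    fix z assume "z \<in> Z_proj (g, act \<gamma> y)"
    then obtain a b where ab: "a \<in> SL2Z" "b \<in> SL2Z" "z = (a ** g ** matrix_inv b, act b (act \<gamma> y))"
      by (auto simp: Z_proj_def)
    then have "z = (a ** (g ** \<gamma>) ** matrix_inv (b ** \<gamma>), act (b ** \<gamma>) y)"
      using assms by (simp add: matrix_mul_assoc GL2Qp_mult_cancel GL2Qp_matrix_inv_mult act_mult)
    then show "z \<in> Z_proj (g ** \<gamma>, y)"
      unfolding Z_proj_def fst_conv snd_conv using assms ab SL2Z_mult by blast
  qed
qed

text \<open>Openness in Z is tested on preimages under \<open>Z_proj\<close>; for the image of a
  tube this preimage is the tube itself, so openness and closedness can be computed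
  upstairs.\<close>

lemma tube_saturated: "{u \<in> U_space. Z_proj u \<in> Z_proj ` tube D S} = tube D S"
proof (rule equalityI; rule subsetI)
  fix u assume "u \<in> {u \<in> U_space. Z_proj u \<in> Z_proj ` tube D S}"
  then obtain g y v where u: "u = (g, y)" "u \<in> U_space" "v \<in> tube D S" "Z_proj (g, y) = Z_proj v"
    by (cases u) auto
  obtain a b where ab: "a \<in> SL2Z" "b \<in> SL2Z" "g = a ** fst v ** matrix_inv b" "y = act b (snd v)"
    using Z_proj_eqD[OF u(4)] by blast
  obtain \<gamma> \<gamma>' d where v: "\<gamma> \<in> SL2Z" "\<gamma>' \<in> SL2Z" "d \<in> D" "fst v = \<gamma>' ** d ** \<gamma>" "moebius \<gamma> (snd (snd v)) \<in> S"
    "snd v \<in> AH"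
    using u(3) by (auto simp: tube_def U_space_iff)
  have "g = (a ** \<gamma>') ** d ** (\<gamma> ** matrix_inv b)" using ab(3) v(4) by (simp add: matrix_mul_assoc)
  moreover have "moebius (\<gamma> ** matrix_inv b) (snd y) = moebius \<gamma> (snd (snd v))"
  proof -
    have "act (\<gamma> ** matrix_inv b) y = act \<gamma> (snd v)"
      using ab v by (simp add: act_mult act_AH act_inv)
    then show ?thesis by (simp add: act_def)
  qed
  ultimately show "u \<in> tube D S"
    using u ab v SL2Z_mult SL2Z_matrix_inv unfolding tube_def by (metis (mono_tags, lifting) case_prodI mem_Collect_eq)
qed (auto simp: tube_def)

text \<open>A description of C_c(Z) that avoids the quotient topology. Continuity on all of
  \<open>AH\<close> is no stronger than continuity on the slice of U, as that slice is open and
  closed in \<open>AH\<close>. The last clause encodes compact support: finitely many double cosets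
  and \<tau> in a compact set modulo Gamma, while the component in the compact M_2(R) stays
  unrestricted.\<close>

definition hecke_funs :: "hfun set" where
  "hecke_funs = {f. (\<forall>g y. f g y \<noteq> 0 \<longrightarrow> (g, y) \<in> U_space) \<and>
     (\<forall>\<gamma>\<in>SL2Z. \<forall>g y. f (\<gamma> ** g) y = f g y) \<and>
     (\<forall>\<gamma>\<in>SL2Z. \<forall>g y. f (g ** \<gamma>) y = f g (act \<gamma> y)) \<and>
     (\<forall>g. continuous_on AH (f g)) \<and>
     (\<exists>D M. finite D \<and> D \<subseteq> GL2Qp \<and> 1 \<le> M \<and> (\<forall>g y. f g y \<noteq> 0 \<longrightarrow> (g, y) \<in> tube D (Box M)))}"

lemma hecke_funs_props:
  assumes "f \<in> hecke_funs"
  shows hecke_funs_supp: "\<And>g y. f g y \<noteq> 0 \<Longrightarrow> (g, y) \<in> U_space"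
    and hecke_funs_left: "\<And>\<gamma> g y. \<gamma> \<in> SL2Z \<Longrightarrow> f (\<gamma> ** g) y = f g y"
    and hecke_funs_right: "\<And>\<gamma> g y. \<gamma> \<in> SL2Z \<Longrightarrow> f (g ** \<gamma>) y = f g (act \<gamma> y)"
    and hecke_funs_continuous: "\<And>g. continuous_on AH (f g)"
    and hecke_funs_tube: "\<exists>D M. finite D \<and> D \<subseteq> GL2Qp \<and> 1 \<le> M \<and> (\<forall>g y. f g y \<noteq> 0 \<longrightarrow> (g, y) \<in> tube D (Box M))"
  using assms unfolding hecke_funs_def mem_Collect_eq by metis+

text \<open>M_2(R) is open and closed, so the slice of U at g splits \<open>AH\<close> into two open
  pieces, on one of which f is zero.\<close>

lemma continuous_on_AH_extend:
  assumes g: "g \<in> GL2Qp" and "continuous_on {y. (g, y) \<in> U_space} f" "\<And>y. (g, y) \<notin> U_space \<Longrightarrow> f y = 0"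
  shows "continuous_on AH f"
proof -
  define V where "V = AH - {y. (g, y) \<in> U_space}"
  have eq: "V = AH \<inter> - ((fst -` M2R) \<inter> ((\<lambda>y. amat g ** fst y) -` M2R))"
    using g by (auto simp: V_def U_space_iff)
  have "open V"
    unfolding eq
    by (intro open_Int open_Compl closed_Int open_AH closed_vimage closed_M2R continuous_on_adele_matrix_mult continuous_intros)
  have "openin U_top U_space" using openin_topspace[of U_top] by (simp add: topspace_U_top)
  then have "open {y. (g, y) \<in> U_space}" using g by (simp add: openin_U_top)
  moreover have "continuous_on V f"
    using assms(3) continuous_on_cong[of V V f "\<lambda>_. 0"] by (auto simp: V_def)
  ultimately have "continuous_on ({y. (g, y) \<in> U_space} \<union> V) f"
    using \<open>open V\<close> assms(2) by (intro continuous_on_open_Un)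
  moreover have "{y. (g, y) \<in> U_space} \<union> V = AH" by (auto simp: V_def U_space_iff)
  ultimately show ?thesis by simp
qed

lemma Cc_Z_subset_hecke_funs: "Cc_Z \<subseteq> hecke_funs"
proof
  fix f assume "f \<in> Cc_Z"
  then obtain F where f: "f = extend0 (\<lambda>g y. F (Z_proj (g, y)))" and cont: "continuous_map Z_top euclidean F"
    and comp: "compactin Z_top (Z_top closure_of {z \<in> topspace Z_top. F z \<noteq> 0})"
    unfolding Cc_Z_def by blast
  have supp: "\<forall>g y. f g y \<noteq> 0 \<longrightarrow> (g, y) \<in> U_space" by (simp add: f extend0_def)
  moreover have "\<forall>\<gamma>\<in>SL2Z. \<forall>g y. f (\<gamma> ** g) y = f g y"
    by (simp add: f extend0_def U_space_SL2Z_left Z_proj_left)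
  moreover have "\<forall>\<gamma>\<in>SL2Z. \<forall>g y. f (g ** \<gamma>) y = f g (act \<gamma> y)"
  proof (intro ballI allI)
    fix \<gamma> g y assume \<gamma>: "\<gamma> \<in> SL2Z"
    show "f (g ** \<gamma>) y = f g (act \<gamma> y)"
    proof (cases "(g ** \<gamma>, y) \<in> U_space")
      case True
      then have "y \<in> AH" by (simp add: U_space_iff)
      then show ?thesis using True \<gamma> U_space_SL2Z_right[OF \<gamma>, of g y] by (simp add: f extend0_def Z_proj_right)
    qed (use \<gamma> U_space_SL2Z_right[OF \<gamma>, of g y] in \<open>simp add: f extend0_def\<close>)
  qed
  moreover have "continuous_on AH (f g)" for g
  proof (cases "g \<in> GL2Qp")
    case True
    have "continuous_map U_top euclidean (F \<circ> Z_proj)"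
      using quotient_map_Z_proj cont by (simp add: continuous_compose_quotient_map_eq)
    then have *: "openin U_top {u \<in> U_space. F (Z_proj u) \<in> B}" if "open B" for B
      using that by (auto simp: continuous_map topspace_U_top)
    have "open (f g -` B \<inter> {y. (g, y) \<in> U_space})" if "open B" for B
    proof -
      have "f g -` B \<inter> {y. (g, y) \<in> U_space} = {y. (g, y) \<in> {u \<in> U_space. F (Z_proj u) \<in> B}}"
        by (auto simp: f extend0_def)
      then show ?thesis using *[OF that] True by (simp add: openin_U_top)
    qed
    moreover have "open {y. (g, y) \<in> U_space}" using *[of UNIV] True by (simp add: openin_U_top)
    ultimately have "continuous_on {y. (g, y) \<in> U_space} (f g)" by (simp add: continuous_on_open_vimage)
    then show ?thesis using True by (intro continuous_on_AH_extend) (auto simp: f extend0_def)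
  next
    case False
    then have "f g = (\<lambda>_. 0)" by (auto simp: f extend0_def U_space_iff)
    then show ?thesis by simp
  qed
  moreover have "\<exists>D M. finite D \<and> D \<subseteq> GL2Qp \<and> 1 \<le> M \<and> (\<forall>g y. f g y \<noteq> 0 \<longrightarrow> (g, y) \<in> tube D (Box M))"
  proof -
    define C where "C = Z_top closure_of {z \<in> topspace Z_top. F z \<noteq> 0}"
    \<comment> \<open>Images of open tubes over a single g form an open cover of Z; a finite
      subcover of the compact support yields the finite set D and the box.\<close>
    define Ob where "Ob = (\<lambda>(g, n). Z_proj ` tube {g} (OBox (real n)))"
    have op: "openin Z_top (Ob (g, n))" for g n
      unfolding Ob_def openin_Z_top using tube_subset openin_tube[OF open_OBox, of "{g}" "real n"]
      by (auto simp: tube_saturated)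
    have "C \<subseteq> \<Union>(Ob ` (GL2Qp \<times> {1..}))"
    proof
      fix z assume "z \<in> C"
      then have "z \<in> topspace Z_top" unfolding C_def by (rule subsetD[OF closure_of_subset_topspace])
      then obtain g y where gy: "(g, y) \<in> U_space" "z = Z_proj (g, y)" by (auto simp: topspace_Z_top)
      then obtain n :: nat where n: "1 \<le> n" "snd y \<in> OBox n" using OBox_cover[of "snd y"] by (auto simp: U_space_iff AH_def)
      have "g = mat 1 ** g ** mat 1" "moebius (mat 1) (snd y) \<in> OBox n" using n by simp_all
      then have "(g, y) \<in> tube {g} (OBox n)"
        unfolding tube_def using gy SL2Z_one by blast
      then have "z \<in> Ob (g, n)" using gy by (auto simp: Ob_def)
      moreover have "g \<in> GL2Qp" using gy by (simp add: U_space_iff)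
      ultimately show "z \<in> \<Union>(Ob ` (GL2Qp \<times> {1..}))" using n by force
    qed
    then obtain \<F> where \<F>: "finite \<F>" "\<F> \<subseteq> Ob ` (GL2Qp \<times> {1..})" "C \<subseteq> \<Union>\<F>"
      using compactinD[OF comp[folded C_def], of "Ob ` (GL2Qp \<times> {1..})"] op by auto
    then obtain I where I: "finite I" "I \<subseteq> GL2Qp \<times> {1..}" "C \<subseteq> \<Union>(Ob ` I)"
      using finite_subset_image[OF \<F>(1,2)] by blast
    \<comment> \<open>The sum bounds every index n in the finite subcover, and the successor makes M
      at least 1.\<close>
    define M where "M = real (Suc (\<Sum>i\<in>I. snd i))"
    have "(g, y) \<in> tube (fst ` I) (Box M)" if "f g y \<noteq> 0" for g y
    proof -
      have u: "(g, y) \<in> U_space" and "F (Z_proj (g, y)) \<noteq> 0"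
        using that by (auto simp: f extend0_def split: if_splits)
      then have "Z_proj (g, y) \<in> {z \<in> topspace Z_top. F z \<noteq> 0}" by (simp add: topspace_Z_top)
      moreover have "{z \<in> topspace Z_top. F z \<noteq> 0} \<subseteq> C"
        unfolding C_def by (intro closure_of_subset) auto
      ultimately obtain d n where dn: "(d, n) \<in> I" "Z_proj (g, y) \<in> Ob (d, n)" using I(3) by auto
      then have "(g, y) \<in> tube {d} (OBox n)" using u tube_saturated[of "{d}" "OBox n"] by (auto simp: Ob_def)
      moreover have "n \<le> Suc (\<Sum>i\<in>I. snd i)" using member_le_sum[OF dn(1), of snd] I by auto
      then have "real n \<le> M" "1 \<le> real n"
        using I(2) dn unfolding M_def by (simp only: of_nat_le_iff, auto)
      then have "OBox n \<subseteq> Box M" using OBox_Box Box_mono by blast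
      then have "tube {d} (OBox n) \<subseteq> tube (fst ` I) (Box M)" using dn by (intro tube_mono) force+
      ultimately show ?thesis by blast
    qed
    then show ?thesis using I by (intro exI[of _ "fst ` I"] exI[of _ M]) (auto simp: M_def sum_nonneg)
  qed
  ultimately show "f \<in> hecke_funs" unfolding hecke_funs_def by simp
qed

lemma compactin_tube_core:
  assumes "finite D" "D \<subseteq> GL2Qp" "1 \<le> M"
  shows "compactin U_top {(g, y). (g, y) \<in> U_space \<and> g \<in> D \<and> snd y \<in> Box M}"
proof -
  define K where "K d = (M2R \<inter> (\<lambda>\<rho>. amat d ** \<rho>) -` M2R) \<times> Box M" for d
  have "compact (K d)" for d
    unfolding K_def
    by (intro compact_Times compact_Int_closed compact_M2R compact_Box closed_vimage closed_M2R
        continuous_on_adele_matrix_mult continuous_on_id)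
  then have "compactin (prod_topology (discrete_topology GL2Qp) euclidean) (\<Union>d\<in>D. {d} \<times> K d)"
    using assms by (intro compactin_Union) (auto simp: compactin_Times)
  moreover have "(\<Union>d\<in>D. {d} \<times> K d) = {(g, y). (g, y) \<in> U_space \<and> g \<in> D \<and> snd y \<in> Box M}"
    using assms Box_Im[OF assms(3)] by (auto simp: K_def U_space_iff AH_def)
  ultimately show ?thesis
    unfolding U_top_def compactin_subtopology by auto
qed

lemma hecke_funs_subset_Cc_Z: "hecke_funs \<subseteq> Cc_Z"
proof
  fix f assume "f \<in> hecke_funs"
  note supp = hecke_funs_supp[OF this] and left = hecke_funs_left[OF this]
    and right = hecke_funs_right[OF this] and cont = hecke_funs_continuous[OF this]
  obtain D M where DM: "finite D" "D \<subseteq> GL2Qp" "1 \<le> M" "\<And>g y. f g y \<noteq> 0 \<Longrightarrow> (g, y) \<in> tube D (Box M)"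
    using hecke_funs_tube[OF \<open>f \<in> hecke_funs\<close>] by blast
  define F where "F z = (let u = SOME u. u \<in> U_space \<and> Z_proj u = z in f (fst u) (snd u))" for z
  have F: "F (Z_proj (g, y)) = f g y" if gy: "(g, y) \<in> U_space" for g y
  proof -
    define u where "u = (SOME u. u \<in> U_space \<and> Z_proj u = Z_proj (g, y))"
    have u: "u \<in> U_space \<and> Z_proj u = Z_proj (g, y)" unfolding u_def by (rule someI) (use gy in blast)
    obtain a b where ab: "a \<in> SL2Z" "b \<in> SL2Z" "fst u = a ** g ** matrix_inv b" "snd u = act b y"
      using u Z_proj_eqD[of "fst u" "snd u" "(g, y)"] by auto
    have "F (Z_proj (g, y)) = f (a ** (g ** matrix_inv b)) (act b y)"
      using ab by (simp add: F_def matrix_mul_assoc flip: u_def)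
    also have "\<dots> = f g y"
      using ab gy by (simp add: left right act_inv U_space_iff)
    finally show ?thesis .
  qed
  have ext: "f = extend0 (\<lambda>g y. F (Z_proj (g, y)))"
    using supp by (auto simp: extend0_def F fun_eq_iff)
  have "continuous_map U_top euclidean (F \<circ> Z_proj)"
    unfolding continuous_map topspace_U_top openin_U_top
  proof (intro conjI allI impI ballI)
    fix B :: "complex set" and g assume B: "openin euclidean B" and g: "g \<in> GL2Qp"
    have "openin U_top U_space" using openin_topspace[of U_top] by (simp add: topspace_U_top)
    then have "open {y. (g, y) \<in> U_space}" using g by (simp add: openin_U_top)
    moreover have "open (f g -` B \<inter> AH)" using B cont[of g] open_AH by (simp add: continuous_on_open_vimage)
    ultimately have "open ({y. (g, y) \<in> U_space} \<inter> (f g -` B \<inter> AH))" by (rule open_Int)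
    moreover have "{y. (g, y) \<in> {u \<in> U_space. (F \<circ> Z_proj) u \<in> B}} = {y. (g, y) \<in> U_space} \<inter> (f g -` B \<inter> AH)"
      by (auto simp: F) (auto simp: U_space_iff)
    ultimately show "open {y. (g, y) \<in> {u \<in> U_space. (F \<circ> Z_proj) u \<in> B}}" by simp
  qed auto
  then have cF: "continuous_map Z_top euclidean F"
    using quotient_map_Z_proj by (simp add: continuous_compose_quotient_map_eq)
  define Q where "Q = Z_proj ` tube D (Box M)"
  have "Q = Z_proj ` {(g, y). (g, y) \<in> U_space \<and> g \<in> D \<and> snd y \<in> Box M}"
  proof (rule equalityI; rule subsetI)
    fix z assume "z \<in> Q"
    then obtain g y where gy: "(g, y) \<in> tube D (Box M)" "z = Z_proj (g, y)" by (auto simp: Q_def)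
    then obtain a b d where ab: "(g, y) \<in> U_space" "b \<in> SL2Z" "a \<in> SL2Z" "d \<in> D" "g = a ** d ** b" "moebius b (snd y) \<in> Box M"
      by (auto simp: tube_def)
    have y: "y \<in> AH" using ab by (simp add: U_space_iff)
    have "(d, act b y) \<in> U_space"
      using ab U_space_SL2Z_left[OF ab(3)] U_space_SL2Z_right[OF ab(2)] by (metis matrix_mul_assoc)
    moreover have "Z_proj (d, act b y) = z"
      using gy ab y by (simp add: Z_proj_left flip: Z_proj_right matrix_mul_assoc)
    ultimately show "z \<in> Z_proj ` {(g, y). (g, y) \<in> U_space \<and> g \<in> D \<and> snd y \<in> Box M}"
      using ab by (intro image_eqI[of _ _ "(d, act b y)"]) (auto simp: act_def)
  next
    fix z assume "z \<in> Z_proj ` {(g, y). (g, y) \<in> U_space \<and> g \<in> D \<and> snd y \<in> Box M}"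
    then obtain g y where gy: "(g, y) \<in> U_space" "g \<in> D" "snd y \<in> Box M" "z = Z_proj (g, y)" by auto
    have "g = mat 1 ** g ** mat 1" "moebius (mat 1) (snd y) \<in> Box M" using gy by simp_all
    then have "(g, y) \<in> tube D (Box M)"
      unfolding tube_def using gy SL2Z_one by blast
    then show "z \<in> Q" using gy by (auto simp: Q_def)
  qed
  then have compQ: "compactin Z_top Q"
    using image_compactin[OF compactin_tube_core[OF DM(1-3)] quotient_imp_continuous_map[OF quotient_map_Z_proj]]
    by simp
  have "closedin Z_top Q"
    unfolding closedin_def openin_Z_top topspace_Z_top
  proof (intro conjI)
    show "Q \<subseteq> Z_proj ` U_space" using tube_subset by (auto simp: Q_def)
    have "{u \<in> U_space. Z_proj u \<in> Z_proj ` U_space - Q} = U_space - tube D (Box M)"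
      using tube_saturated[of D "Box M"] by (auto simp: Q_def)
    then show "openin U_top {u \<in> U_space. Z_proj u \<in> Z_proj ` U_space - Q}"
      using openin_compl_tube_Box[OF DM(3)] by simp
  qed auto
  moreover have "{z \<in> topspace Z_top. F z \<noteq> 0} \<subseteq> Q"
    using DM(4) by (auto simp: topspace_Z_top Q_def F)
  ultimately have "Z_top closure_of {z \<in> topspace Z_top. F z \<noteq> 0} \<subseteq> Q"
    by (simp add: closure_of_minimal)
  then have "compactin Z_top (Z_top closure_of {z \<in> topspace Z_top. F z \<noteq> 0})"
    using compQ closed_compactin closedin_closure_of by blast
  then show "f \<in> Cc_Z" unfolding Cc_Z_def using ext cF by blast
qed

lemma Cc_Z_eq: "Cc_Z = hecke_funs"
  using Cc_Z_subset_hecke_funs hecke_funs_subset_Cc_Z by blast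

section \<open>Sums over left cosets\<close>

definition gcoset :: "rat^2^2 \<Rightarrow> (rat^2^2) set" where
  "gcoset h = {\<gamma> ** h | \<gamma>. \<gamma> \<in> SL2Z}"

lemma left_cosets_eq: "left_cosets D = gcoset ` D"
  by (simp add: left_cosets_def gcoset_def[abs_def])

lemma gcoset_mult:
  assumes "\<gamma> \<in> SL2Z"
  shows "gcoset (\<gamma> ** h) = gcoset h"
proof (rule equalityI; rule subsetI)
  fix z assume "z \<in> gcoset (\<gamma> ** h)"
  then obtain a where "a \<in> SL2Z" "z = a ** (\<gamma> ** h)" by (auto simp: gcoset_def)
  then have "a ** \<gamma> \<in> SL2Z" "z = (a ** \<gamma>) ** h" using assms by (simp_all add: matrix_mul_assoc)
  then show "z \<in> gcoset h" unfolding gcoset_def by blast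
next
  fix z assume "z \<in> gcoset h"
  then obtain a where "a \<in> SL2Z" "z = a ** h" by (auto simp: gcoset_def)
  then have "a ** matrix_inv \<gamma> \<in> SL2Z" "z = (a ** matrix_inv \<gamma>) ** (\<gamma> ** h)"
    using assms by (simp_all add: matrix_mul_assoc GL2Qp_mult_cancel)
  then show "z \<in> gcoset (\<gamma> ** h)" unfolding gcoset_def by blast
qed

lemma mem_gcoset: "h \<in> gcoset h"
  unfolding gcoset_def using SL2Z_one by (force intro: exI[of _ "mat 1"])

lemma gcoset_eqD: "gcoset h = gcoset h' \<Longrightarrow> \<exists>\<gamma>\<in>SL2Z. h = \<gamma> ** h'"
  using mem_gcoset[of h] by (auto simp: gcoset_def)

lemma coset_rep_gcoset: obtains \<gamma> where "\<gamma> \<in> SL2Z" "coset_rep (gcoset h) = \<gamma> ** h"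
proof -
  have "coset_rep (gcoset h) \<in> gcoset h"
    unfolding coset_rep_def by (rule someI) (rule mem_gcoset)
  then show ?thesis using that by (auto simp: gcoset_def)
qed

definition SL2Z_invariant :: "(rat^2^2 \<Rightarrow> complex) \<Rightarrow> bool" where
  "SL2Z_invariant F \<longleftrightarrow> (\<forall>\<gamma>\<in>SL2Z. \<forall>h. F (\<gamma> ** h) = F h)"

lemma SL2Z_invariantD: "SL2Z_invariant F \<Longrightarrow> \<gamma> \<in> SL2Z \<Longrightarrow> F (\<gamma> ** h) = F h"
  by (simp add: SL2Z_invariant_def)

lemma SL2Z_invariant_coset_rep: "SL2Z_invariant F \<Longrightarrow> F (coset_rep (gcoset h)) = F h"
  by (metis coset_rep_gcoset SL2Z_invariantD)

lemma SL2Z_invariant_shift: "SL2Z_invariant F \<Longrightarrow> SL2Z_invariant (\<lambda>h. F (h ** k))"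
  by (simp add: SL2Z_invariant_def flip: matrix_mul_assoc)

text \<open>The index set is all of Gamma-cosets in GL_2^+(Q) rather than those in G_y. The
  additional terms vanish for functions extended by zero, and since the index set does not depend on
  y, a substitution h -> h k simply permutes it.\<close>

definition coset_sum :: "(rat^2^2 \<Rightarrow> complex) \<Rightarrow> complex" where
  "coset_sum F = (\<Sum>\<^sub>\<infinity>C\<in>left_cosets GL2Qp. F (coset_rep C))"

lemma coset_sum_cong:
  assumes "\<And>h. h \<in> GL2Qp \<Longrightarrow> F h = G h"
  shows "coset_sum F = coset_sum G"
  unfolding coset_sum_def
proof (rule infsum_cong)
  fix C assume "C \<in> left_cosets GL2Qp"
  then obtain h where "h \<in> GL2Qp" "C = gcoset h" by (auto simp: left_cosets_eq)
  then have "coset_rep C \<in> GL2Qp" by (metis coset_rep_gcoset GL2Qp_mult SL2Z_GL2Qp)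
  then show "F (coset_rep C) = G (coset_rep C)" by (rule assms)
qed

lemma coset_sum_0: "(\<And>h. h \<in> GL2Qp \<Longrightarrow> F h = 0) \<Longrightarrow> coset_sum F = 0"
  using coset_sum_cong[of F "\<lambda>_. 0"] by (simp add: coset_sum_def)

lemma coset_sum_restrict:
  assumes "SL2Z_invariant F" "D \<subseteq> GL2Qp" "\<And>h. h \<in> GL2Qp \<Longrightarrow> F h \<noteq> 0 \<Longrightarrow> gcoset h \<in> gcoset ` D"
  shows "(\<Sum>\<^sub>\<infinity>C\<in>left_cosets D. F (coset_rep C)) = coset_sum F"
  unfolding coset_sum_def left_cosets_eq
proof (rule infsum_cong_neutral)
  fix C assume "C \<in> gcoset ` GL2Qp - gcoset ` D"
  then obtain h where "h \<in> GL2Qp" "C = gcoset h" "gcoset h \<notin> gcoset ` D" by auto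
  then show "F (coset_rep C) = 0" using assms(1,3) SL2Z_invariant_coset_rep by metis
qed (use assms(2) in auto)

lemma gcoset_image_mult: "(\<lambda>x. x ** k) ` gcoset h = gcoset (h ** k)"
  unfolding gcoset_def by (auto simp: matrix_mul_assoc image_iff)

lemma bij_betw_left_cosets_mult:
  assumes "k \<in> GL2Qp"
  shows "bij_betw ((`) (\<lambda>x. x ** k)) (left_cosets GL2Qp) (left_cosets GL2Qp)"
proof (rule bij_betw_byWitness[where f' = "(`) (\<lambda>x. x ** matrix_inv k)"])
  show "\<forall>C\<in>left_cosets GL2Qp. (\<lambda>x. x ** matrix_inv k) ` (\<lambda>x. x ** k) ` C = C"
    using assms by (simp add: image_image GL2Qp_mult_cancel)
  show "\<forall>C\<in>left_cosets GL2Qp. (\<lambda>x. x ** k) ` (\<lambda>x. x ** matrix_inv k) ` C = C"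
    using assms by (simp add: image_image GL2Qp_mult_cancel)
  show "(`) (\<lambda>x. x ** k) ` left_cosets GL2Qp \<subseteq> left_cosets GL2Qp"
    "(`) (\<lambda>x. x ** matrix_inv k) ` left_cosets GL2Qp \<subseteq> left_cosets GL2Qp"
    using assms by (auto simp: left_cosets_eq gcoset_image_mult)
qed

lemma SL2Z_invariant_image_mult:
  assumes "SL2Z_invariant F" "C \<in> left_cosets GL2Qp"
  shows "F (coset_rep ((\<lambda>x. x ** k) ` C)) = F (coset_rep C ** k)"
proof -
  obtain h where h: "C = gcoset h" using assms(2) by (auto simp: left_cosets_eq)
  then show ?thesis
    using SL2Z_invariant_coset_rep[OF assms(1), of "h ** k"]
      SL2Z_invariant_coset_rep[OF SL2Z_invariant_shift[OF assms(1), of k], of h]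
    by (simp add: gcoset_image_mult)
qed

lemma coset_sum_shift:
  assumes "SL2Z_invariant F" "k \<in> GL2Qp"
  shows "coset_sum (\<lambda>h. F (h ** k)) = coset_sum F"
proof -
  have "coset_sum F = (\<Sum>\<^sub>\<infinity>C\<in>left_cosets GL2Qp. F (coset_rep ((\<lambda>x. x ** k) ` C)))"
    unfolding coset_sum_def
    by (rule infsum_reindex_bij_betw[OF bij_betw_left_cosets_mult[OF assms(2)], symmetric])
  also have "\<dots> = coset_sum (\<lambda>h. F (h ** k))"
    unfolding coset_sum_def by (rule infsum_cong) (rule SL2Z_invariant_image_mult[OF assms(1)])
  finally show ?thesis by simp
qed

section \<open>The convolution algebra\<close>

text \<open>Replacing h by \<gamma> h turns (g h^-1, h y) into (g h^-1 \<gamma>^-1, \<gamma> h y),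
  an equivalent point, so each term depends only on the coset. The support condition on \<xi>
  discards those h for which \<open>matrix_inv\<close> is uncontrolled.\<close>

lemma SL2Z_invariant_kernel:
  assumes f: "f \<in> hecke_funs" and \<xi>: "SL2Z_invariant \<xi>" "\<And>h. \<xi> h \<noteq> 0 \<Longrightarrow> h \<in> GL2Qp" and y: "y \<in> AH"
  shows "SL2Z_invariant (\<lambda>h. f (g ** matrix_inv h) (act h y) * \<xi> h)"
  unfolding SL2Z_invariant_def
proof (intro ballI allI)
  fix \<gamma> h assume \<gamma>: "\<gamma> \<in> SL2Z"
  show "f (g ** matrix_inv (\<gamma> ** h)) (act (\<gamma> ** h) y) * \<xi> (\<gamma> ** h) = f (g ** matrix_inv h) (act h y) * \<xi> h"
  proof (cases "h \<in> GL2Qp")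
    case True
    have "f (g ** matrix_inv (\<gamma> ** h)) (act (\<gamma> ** h) y) = f ((g ** matrix_inv h) ** matrix_inv \<gamma>) (act \<gamma> (act h y))"
      using True \<gamma> y by (simp add: GL2Qp_matrix_inv_mult act_mult matrix_mul_assoc)
    also have "\<dots> = f (g ** matrix_inv h) (act h y)"
      using True \<gamma> y hecke_funs_right[OF f, of "matrix_inv \<gamma>" "g ** matrix_inv h" "act \<gamma> (act h y)"]
      by (simp add: act_inv act_AH)
    finally show ?thesis using \<gamma> \<xi>(1) by (simp add: SL2Z_invariantD)
  next
    case False
    then have "\<xi> h = 0" using \<xi>(2) by blast
    then show ?thesis using \<gamma> \<xi>(1) by (simp add: SL2Z_invariantD)
  qed
qed

lemma hecke_funs_GL2Qp: "f \<in> hecke_funs \<Longrightarrow> f h y \<noteq> 0 \<Longrightarrow> h \<in> GL2Qp"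
  using hecke_funs_supp[of f h y] by (simp add: U_space_iff)

lemma hecke_funs_AH: "f \<in> hecke_funs \<Longrightarrow> f h y \<noteq> 0 \<Longrightarrow> y \<in> AH"
  using hecke_funs_supp[of f h y] by (simp add: U_space_iff)

lemma SL2Z_invariant_hecke: "f \<in> hecke_funs \<Longrightarrow> SL2Z_invariant (\<lambda>h. f h y)"
  by (simp add: SL2Z_invariant_def hecke_funs_left)

text \<open>Composition in the groupoid of pairs (g, y) with y and g y in Y: g y = (g h^-1)(h y). It
  shows that convolution sums vanish off \<open>U_space\<close>.\<close>

lemma U_space_mult:
  assumes "h \<in> GL2Qp" "(g ** matrix_inv h, act h y) \<in> U_space" "fst y \<in> M2R"
  shows "(g, y) \<in> U_space"
proof -
  have "g = (g ** matrix_inv h) ** h" using assms(1) by (simp add: GL2Qp_mult_cancel)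
  then have "amat g ** fst y = amat (g ** matrix_inv h) ** fst (act h y)"
    by (metis act_def amat_mult fst_conv matrix_mul_assoc)
  then show ?thesis
    using assms GL2Qp_mult_iff_right[of "matrix_inv h" g] by (simp add: U_space_iff act_AH)
qed

lemma conv_eq:
  assumes f: "f\<^sub>1 \<in> hecke_funs" "f\<^sub>2 \<in> hecke_funs"
  shows "conv f\<^sub>1 f\<^sub>2 g y = coset_sum (\<lambda>h. f\<^sub>1 (g ** matrix_inv h) (act h y) * f\<^sub>2 h y)"
proof (cases "(g, y) \<in> U_space")
  case True
  then have y: "y \<in> AH" by (simp add: U_space_iff)
  have "(\<Sum>\<^sub>\<infinity>C\<in>left_cosets (G_at y). f\<^sub>1 (g ** matrix_inv (coset_rep C)) (act (coset_rep C) y) * f\<^sub>2 (coset_rep C) y)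
     = coset_sum (\<lambda>h. f\<^sub>1 (g ** matrix_inv h) (act h y) * f\<^sub>2 h y)"
  proof (rule coset_sum_restrict)
    show "SL2Z_invariant (\<lambda>h. f\<^sub>1 (g ** matrix_inv h) (act h y) * f\<^sub>2 h y)"
      using f y hecke_funs_GL2Qp[OF f(2)] by (intro SL2Z_invariant_kernel SL2Z_invariant_hecke) auto
    fix h assume "f\<^sub>1 (g ** matrix_inv h) (act h y) * f\<^sub>2 h y \<noteq> 0"
    then have "(h, y) \<in> U_space" using hecke_funs_supp[OF f(2)] by auto
    then show "gcoset h \<in> gcoset ` G_at y" by (auto simp: U_space_def)
  qed (auto simp: G_at_def)
  then show ?thesis using True by (simp add: conv_def extend0_def)
next
  case False
  have "coset_sum (\<lambda>h. f\<^sub>1 (g ** matrix_inv h) (act h y) * f\<^sub>2 h y) = 0"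
  proof (rule coset_sum_0, rule ccontr)
    fix h assume h: "h \<in> GL2Qp" "f\<^sub>1 (g ** matrix_inv h) (act h y) * f\<^sub>2 h y \<noteq> 0"
    then have u: "(h, y) \<in> U_space" "(g ** matrix_inv h, act h y) \<in> U_space"
      using hecke_funs_supp[OF f(2)] hecke_funs_supp[OF f(1)] by auto
    then have "fst y \<in> M2R" by (simp add: U_space_iff)
    then show False using False U_space_mult[OF h(1) u(2)] by blast
  qed
  then show ?thesis using False by (simp add: conv_def extend0_def)
qed

text \<open>If f is nonzero at h = \<gamma>' d \<gamma>, then \<gamma> moves \<tau> into the support
  box. For \<tau> in a compact box, proper discontinuity leaves finitely many such \<gamma>, hence
  finitely many cosets of the form Gamma d \<gamma>.\<close>

lemma locally_finite_support:
  assumes f: "f \<in> hecke_funs" and M: "1 \<le> M"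
  obtains E where "finite E" "E \<subseteq> GL2Qp" "\<And>h y. snd y \<in> Box M \<Longrightarrow> f h y \<noteq> 0 \<Longrightarrow> gcoset h \<in> gcoset ` E"
proof -
  obtain D N where D: "finite D" "D \<subseteq> GL2Qp" "1 \<le> N" "\<And>g y. f g y \<noteq> 0 \<Longrightarrow> (g, y) \<in> tube D (Box N)"
    using hecke_funs_tube[OF f] by blast
  define L where "L = max M N"
  define P where "P = {\<gamma> \<in> SL2Z. \<exists>\<tau>\<in>Box L. moebius \<gamma> \<tau> \<in> Box L}"
  have "finite P" unfolding P_def using M by (intro finite_SL2Z_Box) (simp add: L_def)
  have box: "Box M \<subseteq> Box L" "Box N \<subseteq> Box L" using Box_mono[of M L] Box_mono[of N L] M D(3) by (simp_all add: L_def)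
  define E where "E = (\<lambda>(d, \<gamma>). d ** \<gamma>) ` (D \<times> P)"
  have "gcoset h \<in> gcoset ` E" if y: "snd y \<in> Box M" "f h y \<noteq> 0" for h y
  proof -
    obtain \<gamma> \<gamma>' d where h: "\<gamma> \<in> SL2Z" "\<gamma>' \<in> SL2Z" "d \<in> D" "h = \<gamma>' ** d ** \<gamma>" "moebius \<gamma> (snd y) \<in> Box N"
      using D(4)[OF y(2)] by (auto simp: tube_def)
    then have "\<gamma> \<in> P" using y box unfolding P_def by blast
    then have "d ** \<gamma> \<in> E" using h by (force simp: E_def)
    moreover have "gcoset h = gcoset (d ** \<gamma>)" using h gcoset_mult[of \<gamma>' "d ** \<gamma>"] by (simp add: matrix_mul_assoc)
    ultimately show ?thesis by blast
  qed
  moreover have "E \<subseteq> GL2Qp" using D(2) by (auto simp: E_def P_def)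
  moreover have "finite E" using D(1) \<open>finite P\<close> by (simp add: E_def)
  ultimately show ?thesis using that by blast
qed

lemma continuous_on_compose_act:
  assumes "continuous_on AH F" "k \<in> GL2Qp"
  shows "continuous_on AH (\<lambda>y. F (act k y))"
  by (rule continuous_on_compose2[OF assms(1)])
     (use assms(2) in \<open>auto intro!: continuous_on_act continuous_on_id simp: act_AH\<close>)

lemma continuous_on_conv:
  assumes f: "f\<^sub>1 \<in> hecke_funs" "f\<^sub>2 \<in> hecke_funs"
  shows "continuous_on AH (conv f\<^sub>1 f\<^sub>2 g)"
proof -
  \<comment> \<open>On each member of this open cover the convolution is one fixed finite sum of
    continuous functions.\<close>
  define V where "V n = AH \<inter> snd -` OBox (real n)" for n
  have "continuous_on (V n) (conv f\<^sub>1 f\<^sub>2 g)" if n: "1 \<le> n" for n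
  proof -
    obtain E where E: "finite E" "E \<subseteq> GL2Qp" "\<And>h y. snd y \<in> Box n \<Longrightarrow> f\<^sub>2 h y \<noteq> 0 \<Longrightarrow> gcoset h \<in> gcoset ` E"
      using locally_finite_support[OF f(2), of "real n"] n by auto
    have eq: "conv f\<^sub>1 f\<^sub>2 g y = (\<Sum>C\<in>gcoset ` E. f\<^sub>1 (g ** matrix_inv (coset_rep C)) (act (coset_rep C) y) * f\<^sub>2 (coset_rep C) y)"
      if y: "y \<in> V n" for y
    proof -
      have "coset_sum (\<lambda>h. f\<^sub>1 (g ** matrix_inv h) (act h y) * f\<^sub>2 h y) =
        (\<Sum>\<^sub>\<infinity>C\<in>left_cosets E. f\<^sub>1 (g ** matrix_inv (coset_rep C)) (act (coset_rep C) y) * f\<^sub>2 (coset_rep C) y)"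
      proof (rule coset_sum_restrict[symmetric])
        show "SL2Z_invariant (\<lambda>h. f\<^sub>1 (g ** matrix_inv h) (act h y) * f\<^sub>2 h y)"
          using f y hecke_funs_GL2Qp[OF f(2)] by (intro SL2Z_invariant_kernel SL2Z_invariant_hecke) (auto simp: V_def)
        fix h assume "f\<^sub>1 (g ** matrix_inv h) (act h y) * f\<^sub>2 h y \<noteq> 0"
        moreover have "snd y \<in> Box n" using y OBox_Box[of "real n"] by (auto simp: V_def)
        ultimately show "gcoset h \<in> gcoset ` E" using E(3)[of y h] by simp
      qed (rule E)
      then show ?thesis using E(1) by (simp add: conv_eq[OF f] left_cosets_eq)
    qed
    have "continuous_on AH (\<lambda>y. \<Sum>C\<in>gcoset ` E. f\<^sub>1 (g ** matrix_inv (coset_rep C)) (act (coset_rep C) y) * f\<^sub>2 (coset_rep C) y)"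
    proof (intro continuous_on_sum continuous_on_mult)
      fix C assume "C \<in> gcoset ` E"
      then have "coset_rep C \<in> GL2Qp" using E(2) by (metis (no_types, lifting) coset_rep_gcoset GL2Qp_mult SL2Z_GL2Qp imageE subsetD)
      then show "continuous_on AH (\<lambda>y. f\<^sub>1 (g ** matrix_inv (coset_rep C)) (act (coset_rep C) y))"
        by (rule continuous_on_compose_act[OF hecke_funs_continuous[OF f(1)]])
    qed (rule hecke_funs_continuous[OF f(2)])
    then have "continuous_on (V n) (\<lambda>y. \<Sum>C\<in>gcoset ` E. f\<^sub>1 (g ** matrix_inv (coset_rep C)) (act (coset_rep C) y) * f\<^sub>2 (coset_rep C) y)"
      by (rule continuous_on_subset) (auto simp: V_def)
    then show ?thesis by (rule continuous_on_eq) (simp add: eq)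
  qed
  moreover have "open (V n)" for n unfolding V_def by (intro open_Int open_AH open_vimage open_OBox continuous_intros)
  ultimately have "continuous_on (\<Union>n\<in>{1..}. V n) (conv f\<^sub>1 f\<^sub>2 g)"
    by (intro continuous_on_open_UN) auto
  moreover have "(\<Union>n\<in>{1..}. V n) = AH"
  proof
    show "AH \<subseteq> (\<Union>n\<in>{1..}. V n)"
    proof
      fix y assume y: "y \<in> AH"
      then obtain n where "1 \<le> n" "snd y \<in> OBox (real n)" using OBox_cover[of "snd y"] by (auto simp: AH_def)
      then show "y \<in> (\<Union>n\<in>{1..}. V n)" using y by (auto simp: V_def)
    qed
  qed (auto simp: V_def)
  ultimately show ?thesis by simp
qed

section \<open>Stability of \<open>hecke_funs\<close> under the algebra operations\<close>

lemma tubeI: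
  assumes "(g, y) \<in> U_space" "\<gamma> \<in> SL2Z" "\<gamma>' \<in> SL2Z" "d \<in> D" "g = \<gamma>' ** d ** \<gamma>" "moebius \<gamma> (snd y) \<in> S"
  shows "(g, y) \<in> tube D S"
  using assms unfolding tube_def by blast

lemma tubeE:
  assumes "(g, y) \<in> tube D S"
  obtains \<gamma> \<gamma>' d where "(g, y) \<in> U_space" "\<gamma> \<in> SL2Z" "\<gamma>' \<in> SL2Z" "d \<in> D" "g = \<gamma>' ** d ** \<gamma>" "moebius \<gamma> (snd y) \<in> S"
  using assms unfolding tube_def by blast

lemma hecke_funsI:
  assumes "\<And>g y. f g y \<noteq> 0 \<Longrightarrow> (g, y) \<in> U_space"
    and "\<And>\<gamma> g y. \<gamma> \<in> SL2Z \<Longrightarrow> f (\<gamma> ** g) y = f g y"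
    and "\<And>\<gamma> g y. \<gamma> \<in> SL2Z \<Longrightarrow> f (g ** \<gamma>) y = f g (act \<gamma> y)"
    and "\<And>g. continuous_on AH (f g)"
    and "finite D" "D \<subseteq> GL2Qp" "1 \<le> M" "\<And>g y. f g y \<noteq> 0 \<Longrightarrow> (g, y) \<in> tube D (Box M)"
  shows "f \<in> hecke_funs"
  unfolding hecke_funs_def mem_Collect_eq
  by (intro conjI allI ballI impI exI[of _ D] exI[of _ M]) (simp_all add: assms)

lemma conv_hecke_funs:
  assumes f: "f\<^sub>1 \<in> hecke_funs" "f\<^sub>2 \<in> hecke_funs"
  shows "conv f\<^sub>1 f\<^sub>2 \<in> hecke_funs"
proof -
  obtain D M where D: "finite D" "D \<subseteq> GL2Qp" "1 \<le> M" "\<And>g y. f\<^sub>2 g y \<noteq> 0 \<Longrightarrow> (g, y) \<in> tube D (Box M)"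
    using hecke_funs_tube[OF f(2)] by blast
  obtain N where N: "1 \<le> N" "\<And>d \<tau>. d \<in> D \<Longrightarrow> \<tau> \<in> Box M \<Longrightarrow> moebius d \<tau> \<in> Box N"
    using finite_moebius_Box[OF D(1-3)] by blast
  obtain E where E: "finite E" "E \<subseteq> GL2Qp" "\<And>h y. snd y \<in> Box N \<Longrightarrow> f\<^sub>1 h y \<noteq> 0 \<Longrightarrow> gcoset h \<in> gcoset ` E"
    using locally_finite_support[OF f(1) N(1)] by blast
  \<comment> \<open>Let a term be nonzero with h = \<gamma>' d \<gamma> and \<gamma> \<tau> in
    \<open>Box M\<close>. Then d \<gamma> \<tau> lies in \<open>Box N\<close>, where
    \<open>f\<^sub>1\<close> sees only the cosets of E; so g is in Gamma e d \<gamma> for some e in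
    E, with the same \<gamma> and M.\<close>
  define D' where "D' = (\<lambda>(e, d). e ** d) ` (E \<times> D)"
  have supp: "(g, y) \<in> U_space" if "conv f\<^sub>1 f\<^sub>2 g y \<noteq> 0" for g y
    using that by (auto simp: conv_def extend0_def split: if_splits)
  show ?thesis
  proof (rule hecke_funsI[where D = D' and M = M])
    show "(g, y) \<in> U_space" if "conv f\<^sub>1 f\<^sub>2 g y \<noteq> 0" for g y by (rule supp[OF that])
  next
    fix \<gamma> g y assume \<gamma>: "\<gamma> \<in> SL2Z"
    show "conv f\<^sub>1 f\<^sub>2 (\<gamma> ** g) y = conv f\<^sub>1 f\<^sub>2 g y"
      using \<gamma> by (simp add: conv_eq[OF f] hecke_funs_left[OF f(1)] flip: matrix_mul_assoc)
    show "conv f\<^sub>1 f\<^sub>2 (g ** \<gamma>) y = conv f\<^sub>1 f\<^sub>2 g (act \<gamma> y)"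
    proof (cases "y \<in> AH")
      case True
      \<comment> \<open>The substitution h -> h \<gamma> turns the sum for (g, \<gamma> y) into the
        sum for (g \<gamma>, y).\<close>
      define G where "G h = f\<^sub>1 (g ** \<gamma> ** matrix_inv h) (act h y) * f\<^sub>2 h y" for h
      have G: "SL2Z_invariant G"
        unfolding G_def using f True hecke_funs_GL2Qp[OF f(2)] by (intro SL2Z_invariant_kernel SL2Z_invariant_hecke) auto
      have "conv f\<^sub>1 f\<^sub>2 g (act \<gamma> y) = coset_sum (\<lambda>h. G (h ** \<gamma>))"
        unfolding conv_eq[OF f]
        by (rule coset_sum_cong)
           (use \<gamma> True in \<open>simp add: G_def GL2Qp_matrix_inv_mult matrix_mul_assoc GL2Qp_mult_cancel act_mult hecke_funs_right[OF f(2)]\<close>)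
      also have "\<dots> = coset_sum G" using G \<gamma> by (simp add: coset_sum_shift)
      also have "\<dots> = conv f\<^sub>1 f\<^sub>2 (g ** \<gamma>) y" unfolding conv_eq[OF f] G_def ..
      finally show ?thesis by simp
    next
      case False
      then have "conv f\<^sub>1 f\<^sub>2 (g ** \<gamma>) y = 0" "conv f\<^sub>1 f\<^sub>2 g (act \<gamma> y) = 0"
        using supp[of "g ** \<gamma>" y] supp[of g "act \<gamma> y"] \<gamma> by (auto simp: U_space_iff act_AH)
      then show ?thesis by simp
    qed
  next
    fix g y assume nz: "conv f\<^sub>1 f\<^sub>2 g y \<noteq> 0"
    then obtain h where h: "h \<in> GL2Qp" "f\<^sub>1 (g ** matrix_inv h) (act h y) \<noteq> 0" "f\<^sub>2 h y \<noteq> 0"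
      using coset_sum_0[of "\<lambda>h. f\<^sub>1 (g ** matrix_inv h) (act h y) * f\<^sub>2 h y"] by (auto simp: conv_eq[OF f])
    obtain \<gamma> \<gamma>' d where dec: "\<gamma> \<in> SL2Z" "\<gamma>' \<in> SL2Z" "d \<in> D" "h = \<gamma>' ** d ** \<gamma>" "moebius \<gamma> (snd y) \<in> Box M"
      using D(4)[OF h(3)] by (rule tubeE)
    have d: "d \<in> GL2Qp" using dec D(2) by blast
    have y: "y \<in> AH" using supp[OF nz] by (simp add: U_space_iff)
    have "g ** matrix_inv h = g ** matrix_inv \<gamma> ** matrix_inv d ** matrix_inv \<gamma>'"
      using dec d by (simp add: GL2Qp_matrix_inv_mult matrix_mul_assoc)
    moreover have "act (matrix_inv \<gamma>') (act h y) = act d (act \<gamma> y)"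
      using dec d y by (simp add: act_mult act_AH act_inv)
    ultimately have "f\<^sub>1 (g ** matrix_inv \<gamma> ** matrix_inv d) (act d (act \<gamma> y)) \<noteq> 0"
      using h(2) dec by (simp add: hecke_funs_right[OF f(1)])
    moreover have "snd (act d (act \<gamma> y)) \<in> Box N" using N(2)[OF dec(3,5)] by (simp add: act_def)
    ultimately obtain e where e: "e \<in> E" "gcoset (g ** matrix_inv \<gamma> ** matrix_inv d) = gcoset e" using E(3) by blast
    then obtain \<gamma>'' where \<gamma>'': "\<gamma>'' \<in> SL2Z" "g ** matrix_inv \<gamma> ** matrix_inv d = \<gamma>'' ** e" using gcoset_eqD by blast
    have "g = (g ** matrix_inv \<gamma> ** matrix_inv d) ** d ** \<gamma>" using dec d by (simp add: GL2Qp_mult_cancel)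
    then have "g = \<gamma>'' ** (e ** d) ** \<gamma>" unfolding \<gamma>''(2) by (simp add: matrix_mul_assoc)
    moreover have "e ** d \<in> D'" using e dec by (force simp: D'_def)
    ultimately show "(g, y) \<in> tube D' (Box M)" using dec \<gamma>'' supp[OF nz] by (intro tubeI) auto
  qed (use D E in \<open>auto simp: D'_def intro!: continuous_on_conv GL2Qp_mult f\<close>)
qed

text \<open>The inverse pair (g^-1, g y) lies in U exactly if (g, y) does, so the extension by zero
  is automatic for g in GL_2^+(Q); other g need an explicit case because \<open>matrix_inv\<close>
  is arbitrary there.\<close>

lemma hadj_eq:
  assumes f: "f \<in> hecke_funs"
  shows "hadj f g y = (if g \<in> GL2Qp then cnj (f (matrix_inv g) (act g y)) else 0)"
proof -
  have "(g, y) \<in> U_space" if "g \<in> GL2Qp" "f (matrix_inv g) (act g y) \<noteq> 0"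
  proof -
    have "(matrix_inv g, act g y) \<in> U_space" using hecke_funs_supp[OF f that(2)] .
    moreover from this have "y \<in> AH" using that(1) by (simp add: U_space_iff act_AH)
    moreover have "amat (matrix_inv g) ** fst (act g y) = fst y"
      using that(1) act_inv(1)[of g y] \<open>y \<in> AH\<close> by (simp add: act_def prod_eq_iff)
    ultimately show ?thesis using that(1) by (simp add: U_space_iff) (simp add: act_def)
  qed
  then show ?thesis by (auto simp: hadj_def extend0_def U_space_iff)
qed

lemma hadj_hecke_funs:
  assumes f: "f \<in> hecke_funs"
  shows "hadj f \<in> hecke_funs"
proof -
  obtain D M where D: "finite D" "D \<subseteq> GL2Qp" "1 \<le> M" "\<And>g y. f g y \<noteq> 0 \<Longrightarrow> (g, y) \<in> tube D (Box M)"
    using hecke_funs_tube[OF f] by blast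
  obtain N where N: "1 \<le> N" "\<And>d \<tau>. d \<in> D \<Longrightarrow> \<tau> \<in> Box M \<Longrightarrow> moebius d \<tau> \<in> Box N"
    using finite_moebius_Box[OF D(1-3)] by blast
  have supp: "(g, y) \<in> U_space" if "hadj f g y \<noteq> 0" for g y
    using that by (auto simp: hadj_def extend0_def split: if_splits)
  show ?thesis
  \<comment> \<open>Inversion exchanges the source y and the target g y, so the box is transported
    through the elements of D; this is why N replaces M.\<close>
  proof (rule hecke_funsI[where D = "matrix_inv ` D" and M = N])
    show "(g, y) \<in> U_space" if "hadj f g y \<noteq> 0" for g y by (rule supp[OF that])
  next
    fix \<gamma> g y assume \<gamma>: "\<gamma> \<in> SL2Z"
    show "hadj f (\<gamma> ** g) y = hadj f g y"
    proof (cases "y \<in> AH \<and> g \<in> GL2Qp")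
      case True
      then show ?thesis using \<gamma> by (simp add: hadj_eq[OF f] GL2Qp_matrix_inv_mult act_mult act_AH act_inv hecke_funs_right[OF f])
    next
      case False
      then have "hadj f (\<gamma> ** g) y = 0" "hadj f g y = 0"
        using supp[of "\<gamma> ** g" y] supp[of g y] \<gamma> by (auto simp: U_space_iff GL2Qp_mult_iff)
      then show ?thesis by simp
    qed
    show "hadj f (g ** \<gamma>) y = hadj f g (act \<gamma> y)"
    proof (cases "y \<in> AH \<and> g \<in> GL2Qp")
      case True
      then show ?thesis using \<gamma> by (simp add: hadj_eq[OF f] GL2Qp_matrix_inv_mult act_mult hecke_funs_left[OF f])
    next
      case False
      then have "hadj f (g ** \<gamma>) y = 0" "hadj f g (act \<gamma> y) = 0"
        using supp[of "g ** \<gamma>" y] supp[of g "act \<gamma> y"] \<gamma> by (auto simp: U_space_iff GL2Qp_mult_iff_right act_AH)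
      then show ?thesis by simp
    qed
  next
    fix g show "continuous_on AH (hadj f g)"
    proof (cases "g \<in> GL2Qp")
      case True
      then have "hadj f g = (\<lambda>y. cnj (f (matrix_inv g) (act g y)))" by (simp add: hadj_eq[OF f] fun_eq_iff)
      then show ?thesis using True by (auto intro!: continuous_on_cnj continuous_on_compose_act hecke_funs_continuous[OF f])
    next
      case False
      then have "hadj f g = (\<lambda>y. 0)" by (simp add: hadj_eq[OF f] fun_eq_iff)
      then show ?thesis by simp
    qed
  next
    fix g y assume nz: "hadj f g y \<noteq> 0"
    have g: "g \<in> GL2Qp" and y: "y \<in> AH" and nz': "f (matrix_inv g) (act g y) \<noteq> 0"
      using nz supp[OF nz] by (auto simp: hadj_eq[OF f] U_space_iff)
    obtain \<gamma> \<gamma>' d where dec: "\<gamma> \<in> SL2Z" "\<gamma>' \<in> SL2Z" "d \<in> D" "matrix_inv g = \<gamma>' ** d ** \<gamma>" "moebius \<gamma> (snd (act g y)) \<in> Box M"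
      using D(4)[OF nz'] by (rule tubeE)
    have d: "d \<in> GL2Qp" using dec D(2) by blast
    have "g = matrix_inv (matrix_inv g)" using g by (simp add: GL2Qp_matrix_inv_inv)
    also have "\<dots> = matrix_inv (\<gamma>' ** d ** \<gamma>)" by (simp only: dec(4))
    also have "\<dots> = matrix_inv \<gamma> ** matrix_inv d ** matrix_inv \<gamma>'"
      using d dec(1,2) by (simp add: GL2Qp_matrix_inv_mult matrix_mul_assoc)
    finally have g_eq: "g = matrix_inv \<gamma> ** matrix_inv d ** matrix_inv \<gamma>'" .
    have "act d (act \<gamma> (act g y)) = act (matrix_inv \<gamma>') y"
      using dec d y by (subst g_eq) (simp add: act_mult act_AH act_inv)
    then have "moebius (matrix_inv \<gamma>') (snd y) \<in> Box N" using N(2)[OF dec(3,5)] by (simp add: act_def)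
    then show "(g, y) \<in> tube (matrix_inv ` D) (Box N)"
      using supp[OF nz] dec g_eq by (intro tubeI[of g y "matrix_inv \<gamma>'" "matrix_inv \<gamma>" "matrix_inv d"]) auto
  qed (use D N in auto)
qed

lemma add_hecke_funs:
  assumes f: "f\<^sub>1 \<in> hecke_funs" "f\<^sub>2 \<in> hecke_funs"
  shows "(\<lambda>g y. f\<^sub>1 g y + f\<^sub>2 g y) \<in> hecke_funs"
proof -
  obtain D1 M1 where D1: "finite D1" "D1 \<subseteq> GL2Qp" "1 \<le> M1" "\<And>g y. f\<^sub>1 g y \<noteq> 0 \<Longrightarrow> (g, y) \<in> tube D1 (Box M1)"
    using hecke_funs_tube[OF f(1)] by blast
  obtain D2 M2 where D2: "finite D2" "D2 \<subseteq> GL2Qp" "1 \<le> M2" "\<And>g y. f\<^sub>2 g y \<noteq> 0 \<Longrightarrow> (g, y) \<in> tube D2 (Box M2)"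
    using hecke_funs_tube[OF f(2)] by blast
  have "tube D1 (Box M1) \<subseteq> tube (D1 \<union> D2) (Box (max M1 M2))"
    by (rule tube_mono) (use D1(3) D2(3) Box_mono[of M1 "max M1 M2"] in auto)
  moreover have "tube D2 (Box M2) \<subseteq> tube (D1 \<union> D2) (Box (max M1 M2))"
    by (rule tube_mono) (use D1(3) D2(3) Box_mono[of M2 "max M1 M2"] in auto)
  ultimately have tube: "(g, y) \<in> tube (D1 \<union> D2) (Box (max M1 M2))" if "f\<^sub>1 g y + f\<^sub>2 g y \<noteq> 0" for g y
    using that D1(4)[of g y] D2(4)[of g y] by (cases "f\<^sub>1 g y = 0") auto
  show ?thesis
  proof (rule hecke_funsI[where D = "D1 \<union> D2" and M = "max M1 M2"])
    show "continuous_on AH (\<lambda>y. f\<^sub>1 g y + f\<^sub>2 g y)" for g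
      by (intro continuous_on_add hecke_funs_continuous f)
    show "(g, y) \<in> U_space" if "f\<^sub>1 g y + f\<^sub>2 g y \<noteq> 0" for g y
      by (rule subsetD[OF tube_subset tube[OF that]])
  qed (use D1 D2 tube in \<open>auto simp: hecke_funs_left[OF f(1)] hecke_funs_left[OF f(2)]
          hecke_funs_right[OF f(1)] hecke_funs_right[OF f(2)]\<close>)
qed

text \<open>Applied both to constant c, for scalar multiples, and to \<open>det_powr\<close>, for
  the time evolution.\<close>

lemma mult_hecke_funs:
  assumes f: "f \<in> hecke_funs"
    and c: "\<And>\<gamma> g. \<gamma> \<in> SL2Z \<Longrightarrow> c (\<gamma> ** g) = c g" "\<And>\<gamma> g. \<gamma> \<in> SL2Z \<Longrightarrow> c (g ** \<gamma>) = c g"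
  shows "(\<lambda>g y. c g * f g y) \<in> hecke_funs"
proof -
  obtain D M where D: "finite D" "D \<subseteq> GL2Qp" "1 \<le> M" "\<And>g y. f g y \<noteq> 0 \<Longrightarrow> (g, y) \<in> tube D (Box M)"
    using hecke_funs_tube[OF f] by blast
  show ?thesis
  proof (rule hecke_funsI[where D = D and M = M])
    show "continuous_on AH (\<lambda>y. c g * f g y)" for g
      by (intro continuous_on_mult continuous_on_const hecke_funs_continuous f)
    show "(g, y) \<in> tube D (Box M)" "(g, y) \<in> U_space" if "c g * f g y \<noteq> 0" for g y
      using that D(4) hecke_funs_supp[OF f] by auto
  qed (use D in \<open>simp_all add: c hecke_funs_left[OF f] hecke_funs_right[OF f]\<close>)
qed

section \<open>Right translation by adelic matrices\<close>

definition integral_inverse :: "adele^2^2 \<Rightarrow> bool" where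
  "integral_inverse x \<longleftrightarrow> invertible x \<and> matrix_inv x \<in> M2R"

definition ymult :: "(adele^2^2) \<times> complex \<Rightarrow> adele^2^2 \<Rightarrow> (adele^2^2) \<times> complex" where
  "ymult y x = (fst y ** x, snd y)"

definition rtrans :: "adele^2^2 \<Rightarrow> hfun \<Rightarrow> hfun" where
  "rtrans x f = (\<lambda>g y. f g (ymult y x))"

lemma ymult_AH [simp]: "ymult y x \<in> AH \<longleftrightarrow> y \<in> AH"
  by (simp add: ymult_def AH_def)

lemma snd_ymult [simp]: "snd (ymult y x) = snd y"
  by (simp add: ymult_def)

lemma act_ymult: "act g (ymult y x) = ymult (act g y) x"
  by (simp add: act_def ymult_def matrix_mul_assoc)

lemma ymult_ymult: "ymult (ymult y x) z = ymult y (x ** z)"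
  by (simp add: ymult_def matrix_mul_assoc)

lemma rtrans_rtrans: "rtrans x (rtrans z f) = rtrans (x ** z) f"
  by (simp add: rtrans_def ymult_ymult)

lemma continuous_on_ymult: "continuous_on S (\<lambda>y. ymult y x)"
  unfolding ymult_def by (intro continuous_on_Pair continuous_on_adele_matrix_mult continuous_intros)

lemma integral_inverse_cancel:
  assumes "integral_inverse x" "\<rho> ** x \<in> M2R"
  shows "\<rho> \<in> M2R"
proof -
  have "\<rho> ** x ** matrix_inv x \<in> M2R" using assms by (simp add: integral_inverse_def M2R_mult)
  moreover have "\<rho> ** x ** matrix_inv x = \<rho> ** (x ** matrix_inv x)" by (simp add: matrix_mul_assoc)
  ultimately show ?thesis using assms(1) by (simp add: integral_inverse_def invertible_matrix_inv)
qed

lemma U_space_ymult: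
  assumes "integral_inverse x" "(g, ymult y x) \<in> U_space"
  shows "(g, y) \<in> U_space"
proof -
  have "fst y ** x \<in> M2R" "amat g ** fst y ** x \<in> M2R"
    using assms(2) by (simp_all add: U_space_iff) (simp_all add: ymult_def matrix_mul_assoc)
  then show ?thesis using assms by (auto simp: U_space_iff dest: integral_inverse_cancel)
qed

text \<open>Right translation changes neither g nor \<tau>, so equivariance and the tube survive;
  integrality of y and g y at points of the support comes from cancelling x.\<close>

lemma rtrans_hecke_funs:
  assumes f: "f \<in> hecke_funs" and x: "integral_inverse x"
  shows "rtrans x f \<in> hecke_funs"
proof -
  obtain D M where D: "finite D" "D \<subseteq> GL2Qp" "1 \<le> M" "\<And>g y. f g y \<noteq> 0 \<Longrightarrow> (g, y) \<in> tube D (Box M)"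
    using hecke_funs_tube[OF f] by blast
  show ?thesis
  proof (rule hecke_funsI[where D = D and M = M])
    fix g y assume "rtrans x f g y \<noteq> 0"
    then have "(g, ymult y x) \<in> tube D (Box M)" using D(4) by (simp add: rtrans_def)
    then show "(g, y) \<in> tube D (Box M)" using U_space_ymult[OF x] by (auto simp: tube_def)
  next
    show "continuous_on AH (rtrans x f g)" for g
      unfolding rtrans_def
      by (rule continuous_on_compose2[OF hecke_funs_continuous[OF f] continuous_on_ymult]) auto
  next
    show "(g, y) \<in> U_space" if "rtrans x f g y \<noteq> 0" for g y
      using that U_space_ymult[OF x] hecke_funs_supp[OF f] by (auto simp: rtrans_def)
  qed (use D in \<open>auto simp: rtrans_def hecke_funs_left[OF f] hecke_funs_right[OF f] act_ymult\<close>)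
qed

text \<open>Left and right multiplication commute. The sums over G_y and over its analogue for y x
  have different index sets, but both equal the sum over all cosets.\<close>

lemma rtrans_conv:
  assumes f: "f\<^sub>1 \<in> hecke_funs" "f\<^sub>2 \<in> hecke_funs" and x: "integral_inverse x"
  shows "rtrans x (conv f\<^sub>1 f\<^sub>2) = conv (rtrans x f\<^sub>1) (rtrans x f\<^sub>2)"
  unfolding fun_eq_iff conv_eq[OF rtrans_hecke_funs[OF f(1) x] rtrans_hecke_funs[OF f(2) x]]
  by (simp add: rtrans_def conv_eq[OF f] act_ymult)

lemma rtrans_hadj:
  assumes f: "f \<in> hecke_funs" and x: "integral_inverse x"
  shows "rtrans x (hadj f) = hadj (rtrans x f)"
  unfolding fun_eq_iff hadj_eq[OF rtrans_hecke_funs[OF f x]]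
  by (simp add: rtrans_def hadj_eq[OF f] act_ymult)

section \<open>Multiplication by the scalar coset\<close>

text \<open>Left and right convolution with the characteristic function of \<open>\<Gamma> n\<close>, a multiplier.\<close>

definition lscal :: "nat \<Rightarrow> hfun \<Rightarrow> hfun" where
  "lscal n f = (\<lambda>g y. f (mat (1 / of_nat n) ** g) y)"

definition rscal :: "nat \<Rightarrow> hfun \<Rightarrow> hfun" where
  "rscal n f = (\<lambda>g y. if fst y \<in> M2R then f (g ** mat (1 / of_nat n)) (act (mat (of_nat n)) y) else 0)"

lemma amat_mat_of_nat: "amat (mat (of_nat n)) = mat (of_int (int n))"
  by (simp add: amat_mat adele_of_rat_of_nat)

lemma mat_of_nat_M2R: "amat (mat (of_nat n)) \<in> M2R"
  unfolding amat_mat_of_nat by (rule mat_of_int_M2R)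

lemma mat_scal_cancel:
  assumes "n > 0"
  shows "mat (of_nat n) ** (mat (1 / of_nat n) ** g) = (g :: rat^2^2)"
    "mat (1 / of_nat n) ** (mat (of_nat n) ** g) = g"
    "g ** mat (1 / of_nat n) ** mat (of_nat n) = g"
    "g ** mat (of_nat n) ** mat (1 / of_nat n) = g"
  using assms by (simp_all add: matrix_mul_assoc mat_mult_rat) (simp_all add: mat_mult_rat flip: matrix_mul_assoc)

lemma lscal_hecke_funs:
  assumes f: "f \<in> hecke_funs" and n: "n > 0"
  shows "lscal n f \<in> hecke_funs"
proof -
  obtain D M where D: "finite D" "D \<subseteq> GL2Qp" "1 \<le> M" "\<And>g y. f g y \<noteq> 0 \<Longrightarrow> (g, y) \<in> tube D (Box M)"
    using hecke_funs_tube[OF f] by blast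
  have supp: "(g, y) \<in> U_space" if "lscal n f g y \<noteq> 0" for g y
  proof -
    have u: "(mat (1 / of_nat n) ** g, y) \<in> U_space" using that hecke_funs_supp[OF f] by (simp add: lscal_def)
    have "amat g ** fst y = amat (mat (of_nat n)) ** (amat (mat (1 / of_nat n) ** g) ** fst y)"
      using n by (simp add: matrix_mul_assoc mat_scal_cancel flip: amat_mult) (simp add: mat_scal_cancel flip: matrix_mul_assoc)
    then have "amat g ** fst y \<in> M2R" using u by (auto simp: U_space_iff intro!: M2R_mult mat_of_nat_M2R)
    then show ?thesis using u n by (simp add: U_space_iff GL2Qp_mult_iff)
  qed
  show ?thesis
  proof (rule hecke_funsI[where D = "(\<lambda>d. mat (of_nat n) ** d) ` D" and M = M])
    fix g y assume nz: "lscal n f g y \<noteq> 0"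
    then obtain \<gamma> \<gamma>' d where dec: "\<gamma> \<in> SL2Z" "\<gamma>' \<in> SL2Z" "d \<in> D" "mat (1 / of_nat n) ** g = \<gamma>' ** d ** \<gamma>" "moebius \<gamma> (snd y) \<in> Box M"
      using D(4) unfolding lscal_def by (metis tubeE)
    have "g = mat (of_nat n) ** (\<gamma>' ** d ** \<gamma>)" using n by (simp add: mat_scal_cancel flip: dec(4))
    then have "g = \<gamma>' ** (mat (of_nat n) ** d) ** \<gamma>" by (metis matrix_mul_assoc mat_commute_rat)
    then show "(g, y) \<in> tube ((\<lambda>d. mat (of_nat n) ** d) ` D) (Box M)"
      using dec supp[OF nz] by (intro tubeI) auto
  next
    show "continuous_on AH (lscal n f g)" for g
      unfolding lscal_def by (rule hecke_funs_continuous[OF f])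
  next
    fix \<gamma> g :: "rat^2^2" and y assume \<gamma>: "\<gamma> \<in> SL2Z"
    have "mat (1 / of_nat n) ** (\<gamma> ** g) = \<gamma> ** (mat (1 / of_nat n) ** g)" by (metis matrix_mul_assoc mat_commute_rat)
    then show "lscal n f (\<gamma> ** g) y = lscal n f g y" using \<gamma> by (simp add: lscal_def hecke_funs_left[OF f])
    show "lscal n f (g ** \<gamma>) y = lscal n f g (act \<gamma> y)" using \<gamma> by (simp add: lscal_def matrix_mul_assoc hecke_funs_right[OF f])
  qed (use D n supp in auto)
qed

text \<open>The guard in \<open>rscal\<close> matters for the support: n y may be integral although
  y is not. In \<open>lscal\<close> no guard occurs, because integrality of (1/n) g y already
  implies that of g y.\<close>

lemma rscal_hecke_funs:
  assumes f: "f \<in> hecke_funs" and n: "n > 0"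
  shows "rscal n f \<in> hecke_funs"
proof -
  obtain D M where D: "finite D" "D \<subseteq> GL2Qp" "1 \<le> M" "\<And>g y. f g y \<noteq> 0 \<Longrightarrow> (g, y) \<in> tube D (Box M)"
    using hecke_funs_tube[OF f] by blast
  have supp: "(g, y) \<in> U_space" if "rscal n f g y \<noteq> 0" for g y
  proof -
    have u: "(g ** mat (1 / of_nat n), act (mat (of_nat n)) y) \<in> U_space" "fst y \<in> M2R"
      using that hecke_funs_supp[OF f] by (auto simp: rscal_def split: if_splits)
    show ?thesis
      using u n U_space_mult[of "mat (of_nat n)" g y] by (simp add: matrix_inv_mat_rat)
  qed
  show ?thesis
  proof (rule hecke_funsI[where D = "(\<lambda>d. mat (of_nat n) ** d) ` D" and M = M])
    fix g y assume nz: "rscal n f g y \<noteq> 0"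
    then have "f (g ** mat (1 / of_nat n)) (act (mat (of_nat n)) y) \<noteq> 0" by (auto simp: rscal_def split: if_splits)
    then obtain \<gamma> \<gamma>' d where dec: "\<gamma> \<in> SL2Z" "\<gamma>' \<in> SL2Z" "d \<in> D" "g ** mat (1 / of_nat n) = \<gamma>' ** d ** \<gamma>" "moebius \<gamma> (snd (act (mat (of_nat n)) y)) \<in> Box M"
      using D(4) by (metis tubeE)
    have "g = (\<gamma>' ** d ** \<gamma>) ** mat (of_nat n)" using n by (simp add: mat_scal_cancel flip: dec(4))
    then have "g = \<gamma>' ** (mat (of_nat n) ** d) ** \<gamma>" by (metis matrix_mul_assoc mat_commute_rat)
    then show "(g, y) \<in> tube ((\<lambda>d. mat (of_nat n) ** d) ` D) (Box M)"
      using dec supp[OF nz] n by (intro tubeI) (auto simp: act_mat)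
  next
    fix g show "continuous_on AH (rscal n f g)"
    proof (cases "g \<in> GL2Qp")
      case True
      have "continuous_on AH (\<lambda>y. f (g ** mat (1 / of_nat n)) (act (mat (of_nat n)) y))"
        using n by (intro continuous_on_compose_act hecke_funs_continuous[OF f]) auto
      then have "continuous_on {y. (g, y) \<in> U_space} (\<lambda>y. f (g ** mat (1 / of_nat n)) (act (mat (of_nat n)) y))"
        by (rule continuous_on_subset) (auto simp: U_space_iff)
      then have "continuous_on {y. (g, y) \<in> U_space} (rscal n f g)"
        by (rule continuous_on_eq) (auto simp: rscal_def U_space_iff)
      then show ?thesis using True supp by (intro continuous_on_AH_extend) auto
    next
      case False
      then have "rscal n f g = (\<lambda>_. 0)" using supp by (auto simp: U_space_iff fun_eq_iff)
      then show ?thesis by simp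
    qed
  next
    fix \<gamma> g y assume \<gamma>: "\<gamma> \<in> SL2Z"
    show "rscal n f (\<gamma> ** g) y = rscal n f g y"
      using \<gamma> by (simp add: rscal_def hecke_funs_left[OF f] flip: matrix_mul_assoc)
    have "g ** \<gamma> ** mat (1 / of_nat n) = g ** mat (1 / of_nat n) ** \<gamma>"
      by (metis matrix_mul_assoc mat_commute_rat)
    moreover have "act \<gamma> (act (mat (of_nat n)) y) = act (mat (of_nat n)) (act \<gamma> y)"
      using n mat_commute[of "adele_of_rat (of_nat n)" "amat \<gamma>"] by (simp add: act_mat act_def[of \<gamma>] matrix_mul_assoc)
    moreover have "fst (act \<gamma> y) \<in> M2R \<longleftrightarrow> fst y \<in> M2R" using \<gamma> by (simp add: act_def M2R_SL2Z_mult)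
    ultimately show "rscal n f (g ** \<gamma>) y = rscal n f g (act \<gamma> y)"
      using \<gamma> by (simp add: rscal_def hecke_funs_right[OF f])
  qed (use D n supp in auto)
qed

text \<open>With u the characteristic function of Gamma n this is f1 (u f2) = (f1 u) f2, the double
  centralizer identity; it is the substitution h -> n h in the convolution sum.\<close>

lemma conv_lscal:
  assumes f: "f\<^sub>1 \<in> hecke_funs" "f\<^sub>2 \<in> hecke_funs" and n: "n > 0"
  shows "conv f\<^sub>1 (lscal n f\<^sub>2) = conv (rscal n f\<^sub>1) f\<^sub>2"
proof (intro ext)
  fix g y
  show "conv f\<^sub>1 (lscal n f\<^sub>2) g y = conv (rscal n f\<^sub>1) f\<^sub>2 g y"
  proof (cases "y \<in> AH")
    case True
    define G where "G h = f\<^sub>1 (g ** matrix_inv h) (act h y) * lscal n f\<^sub>2 h y" for h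
    have l: "lscal n f\<^sub>2 \<in> hecke_funs" by (rule lscal_hecke_funs[OF f(2) n])
    have G: "SL2Z_invariant G"
      unfolding G_def using f(1) l True hecke_funs_GL2Qp[OF l] by (intro SL2Z_invariant_kernel SL2Z_invariant_hecke) auto
    have "conv f\<^sub>1 (lscal n f\<^sub>2) g y = coset_sum (\<lambda>h. G (h ** mat (of_nat n)))"
    proof -
      have "conv f\<^sub>1 (lscal n f\<^sub>2) g y = coset_sum G" unfolding conv_eq[OF f(1) l] G_def ..
      then show ?thesis using n coset_sum_shift[OF G, of "mat (of_nat n)"] by simp
    qed
    also have "\<dots> = conv (rscal n f\<^sub>1) f\<^sub>2 g y"
      unfolding conv_eq[OF rscal_hecke_funs[OF f(1) n] f(2)]
    proof (rule coset_sum_cong)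
      fix h assume h: "h \<in> GL2Qp"
      have "h ** mat (of_nat n) = mat (of_nat n) ** h" by (simp add: mat_commute_rat)
      moreover have "matrix_inv (mat (of_nat n) ** h) = matrix_inv h ** mat (1 / of_nat n)"
        using h n by (simp add: GL2Qp_matrix_inv_mult matrix_inv_mat_rat)
      moreover have "act (mat (of_nat n) ** h) y = act (mat (of_nat n)) (act h y)"
        using h n True by (simp add: act_mult)
      moreover have "fst (act h y) \<in> M2R" if "f\<^sub>2 h y \<noteq> 0"
        using hecke_funs_supp[OF f(2) that] by (simp add: U_space_iff act_def)
      ultimately show "G (h ** mat (of_nat n)) = rscal n f\<^sub>1 (g ** matrix_inv h) (act h y) * f\<^sub>2 h y"
        using n by (cases "f\<^sub>2 h y = 0") (auto simp: G_def lscal_def rscal_def mat_scal_cancel matrix_mul_assoc[symmetric])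
    qed
    finally show ?thesis .
  next
    case False
    then have "conv f\<^sub>1 (lscal n f\<^sub>2) g y = 0" "conv (rscal n f\<^sub>1) f\<^sub>2 g y = 0"
      using hecke_funs_AH conv_hecke_funs f lscal_hecke_funs[OF f(2) n] rscal_hecke_funs[OF f(1) n] by blast+
    then show ?thesis by simp
  qed
qed

text \<open>The isometry relation star(u) u = 1, in the form star(u f) u = star(f).\<close>

lemma rscal_hadj_lscal:
  assumes f: "f \<in> hecke_funs" and n: "n > 0"
  shows "rscal n (hadj (lscal n f)) = hadj f"
proof (intro ext)
  fix g y
  have l: "lscal n f \<in> hecke_funs" by (rule lscal_hecke_funs[OF f n])
  show "rscal n (hadj (lscal n f)) g y = hadj f g y"
  proof (cases "g \<in> GL2Qp \<and> y \<in> AH \<and> fst y \<in> M2R")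
    case True
    have "matrix_inv (g ** mat (1 / of_nat n)) = mat (of_nat n) ** matrix_inv g"
      using True n by (simp add: GL2Qp_matrix_inv_mult matrix_inv_mat_rat)
    moreover have "act (g ** mat (1 / of_nat n)) (act (mat (of_nat n)) y) = act g y"
      using True n by (simp add: act_AH mat_scal_cancel flip: act_mult)
    ultimately show ?thesis
      using True n by (simp add: rscal_def hadj_eq[OF l]) (simp add: hadj_eq[OF f] lscal_def mat_scal_cancel)
  next
    case False
    then have "rscal n (hadj (lscal n f)) g y = 0" "hadj f g y = 0"
      using hecke_funs_supp[OF rscal_hecke_funs[OF hadj_hecke_funs[OF l] n], of g y]
        hecke_funs_supp[OF hadj_hecke_funs[OF f], of g y] by (auto simp: U_space_iff)
    then show ?thesis by simp
  qed
qed

text \<open>The left side is u f star(u), since f star(u) = star(u star(f)). The two factors of n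
  cancel on g, and only the division of y by n remains.\<close>

lemma lscal_hadj_lscal_hadj:
  assumes f: "f \<in> hecke_funs" and n: "n > 0"
  shows "lscal n (hadj (lscal n (hadj f))) = rtrans (mat (adele_of_rat (1 / of_nat n))) f"
proof (intro ext)
  fix g y
  have h: "hadj f \<in> hecke_funs" by (rule hadj_hecke_funs[OF f])
  have l: "lscal n (hadj f) \<in> hecke_funs" by (rule lscal_hecke_funs[OF h n])
  have ll: "lscal n (hadj (lscal n (hadj f))) \<in> hecke_funs" by (intro lscal_hecke_funs hadj_hecke_funs h n)
  have y_eq: "ymult y (mat (adele_of_rat (1 / of_nat n))) = act (mat (1 / of_nat n)) y"
    using n by (simp add: act_mat ymult_def mat_commute)
  show "lscal n (hadj (lscal n (hadj f))) g y = rtrans (mat (adele_of_rat (1 / of_nat n))) f g y"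
  proof (cases "g \<in> GL2Qp \<and> y \<in> AH")
    case True
    define k where "k = mat (1 / of_nat n) ** g"
    have k: "k \<in> GL2Qp" using True n by (simp add: k_def)
    define z where "z = act k y"
    have 1: "lscal n (hadj (lscal n (hadj f))) g y = cnj (hadj f (mat (1 / of_nat n) ** matrix_inv k) (act k y))"
      using k by (simp add: lscal_def hadj_eq[OF l[unfolded lscal_def]] flip: k_def)
    have "matrix_inv (mat (1 / of_nat n) ** matrix_inv k) = k ** mat (of_nat n)"
      using k n by (simp add: GL2Qp_matrix_inv_mult GL2Qp_matrix_inv_inv matrix_inv_mat_rat)
    also have "\<dots> = mat (of_nat n) ** k" by (simp add: mat_commute_rat)
    also have "\<dots> = g" using n by (simp add: k_def mat_scal_cancel)
    finally have 2: "matrix_inv (mat (1 / of_nat n) ** matrix_inv k) = g" .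
    have 3: "act (mat (1 / of_nat n) ** matrix_inv k) (act k y) = act (mat (1 / of_nat n)) y"
      using k n True by (simp add: act_mult act_AH act_inv)
    show ?thesis unfolding 1 using k n 2 3 by (simp add: hadj_eq[OF f] rtrans_def y_eq)
  next
    case False
    have "f g (act (mat (1 / of_nat n)) y) = 0"
    proof (rule ccontr)
      assume "f g (act (mat (1 / of_nat n)) y) \<noteq> 0"
      then have "(g, act (mat (1 / of_nat n)) y) \<in> U_space" by (rule hecke_funs_supp[OF f])
      then show False using False n by (auto simp: U_space_iff act_AH)
    qed
    moreover have "lscal n (hadj (lscal n (hadj f))) g y = 0"
      using False hecke_funs_GL2Qp[OF ll] hecke_funs_AH[OF ll] by blast
    ultimately show ?thesis by (simp add: rtrans_def y_eq)
  qed
qed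

section \<open>Norm estimates\<close>

text \<open>As with \<open>coset_sum\<close>, the supremum runs over cosets in all of GL_2^+(Q),
  which makes norms for different y comparable and shifts h -> h k isometric.\<close>

definition coset_l2norm :: "(rat^2^2 \<Rightarrow> complex) \<Rightarrow> ennreal" where
  "coset_l2norm \<xi> = (SUP F\<in>{F. finite F \<and> F \<subseteq> left_cosets GL2Qp}.
     ennreal (L2_set (\<lambda>C. cmod (\<xi> (coset_rep C))) F))"

lemma coset_l2norm_mono:
  assumes "\<And>h. h \<in> GL2Qp \<Longrightarrow> cmod (\<xi> h) \<le> cmod (\<eta> h)"
  shows "coset_l2norm \<xi> \<le> coset_l2norm \<eta>"
  unfolding coset_l2norm_def
proof (rule SUP_mono, rule bexI)
  fix F assume F: "F \<in> {F. finite F \<and> F \<subseteq> left_cosets GL2Qp}"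
  have "cmod (\<xi> (coset_rep C)) \<le> cmod (\<eta> (coset_rep C))" if C: "C \<in> F" for C
  proof -
    obtain h where "h \<in> GL2Qp" "C = gcoset h" using F C by (auto simp: left_cosets_eq)
    then have "coset_rep C \<in> GL2Qp" by (metis coset_rep_gcoset GL2Qp_mult SL2Z_GL2Qp)
    then show ?thesis by (rule assms)
  qed
  then show "ennreal (L2_set (\<lambda>C. cmod (\<xi> (coset_rep C))) F) \<le> ennreal (L2_set (\<lambda>C. cmod (\<eta> (coset_rep C))) F)"
    by (intro ennreal_leI L2_set_mono) auto
qed auto

lemma coset_l2norm_cong:
  assumes "\<And>h. h \<in> GL2Qp \<Longrightarrow> cmod (\<xi> h) = cmod (\<eta> h)"
  shows "coset_l2norm \<xi> = coset_l2norm \<eta>"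
  using assms by (intro antisym coset_l2norm_mono) auto

lemma coset_l2norm_shift:
  assumes \<xi>: "SL2Z_invariant \<xi>" and k: "k \<in> GL2Qp"
  shows "coset_l2norm (\<lambda>h. \<xi> (h ** k)) = coset_l2norm \<xi>"
proof -
  \<comment> \<open>One inequality for all k and \<xi> is enough; applied to the shifted function
    and the inverse of k it gives the other.\<close>
  have le: "coset_l2norm (\<lambda>h. \<xi> (h ** k)) \<le> coset_l2norm \<xi>" if \<xi>: "SL2Z_invariant \<xi>" and k: "k \<in> GL2Qp" for \<xi> k
    unfolding coset_l2norm_def
  proof (rule SUP_mono)
    fix F assume F: "F \<in> {F. finite F \<and> F \<subseteq> left_cosets GL2Qp}"
    let ?s = "(`) (\<lambda>x. x ** k)"
    have bij: "bij_betw ?s (left_cosets GL2Qp) (left_cosets GL2Qp)" by (rule bij_betw_left_cosets_mult[OF k])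
    have "inj_on ?s F" using bij F by (auto simp: bij_betw_def intro: inj_on_subset)
    then have "L2_set (\<lambda>C. cmod (\<xi> (coset_rep C))) (?s ` F) = L2_set (\<lambda>C. cmod (\<xi> (coset_rep (?s C)))) F"
      by (simp add: L2_set_def sum.reindex)
    also have "\<dots> = L2_set (\<lambda>C. cmod (\<xi> (coset_rep C ** k))) F"
      using F by (intro L2_set_cong refl arg_cong[where f = cmod] SL2Z_invariant_image_mult[OF \<xi>]) auto
    finally have "ennreal (L2_set (\<lambda>C. cmod (\<xi> (coset_rep C ** k))) F) \<le> ennreal (L2_set (\<lambda>C. cmod (\<xi> (coset_rep C))) (?s ` F))"
      by simp
    moreover have "?s ` F \<in> {F. finite F \<and> F \<subseteq> left_cosets GL2Qp}"
      using F bij by (auto simp: bij_betw_def)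
    ultimately show "\<exists>G\<in>{F. finite F \<and> F \<subseteq> left_cosets GL2Qp}.
      ennreal (L2_set (\<lambda>C. cmod (\<xi> (coset_rep C ** k))) F) \<le> ennreal (L2_set (\<lambda>C. cmod (\<xi> (coset_rep C))) G)" by blast
  qed
  have "coset_l2norm \<xi> = coset_l2norm (\<lambda>h. \<xi> (h ** matrix_inv k ** k))" using k by (simp add: GL2Qp_mult_cancel)
  also have "\<dots> \<le> coset_l2norm (\<lambda>h. \<xi> (h ** k))"
    using le[OF SL2Z_invariant_shift[OF \<xi>, of k], of "matrix_inv k"] k by simp
  finally show ?thesis using le[OF \<xi> k] by simp
qed

lemma G_at_iff: "y \<in> Y_space \<Longrightarrow> g \<in> G_at y \<longleftrightarrow> (g, y) \<in> U_space"
  by (simp add: U_space_def)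

lemma l2norm_eq:
  assumes "SL2Z_invariant \<xi>" "\<And>h. h \<notin> G_at y \<Longrightarrow> \<xi> h = 0"
  shows "l2norm y \<xi> = coset_l2norm \<xi>"
proof (rule antisym)
  have "left_cosets (G_at y) \<subseteq> left_cosets GL2Qp" by (auto simp: left_cosets_eq G_at_def)
  then show "l2norm y \<xi> \<le> coset_l2norm \<xi>"
    unfolding l2norm_def coset_l2norm_def by (intro SUP_subset_mono) auto
  show "coset_l2norm \<xi> \<le> l2norm y \<xi>"
    unfolding l2norm_def coset_l2norm_def
  proof (rule SUP_mono)
    fix F assume F: "F \<in> {F. finite F \<and> F \<subseteq> left_cosets GL2Qp}"
    have "\<xi> (coset_rep C) = 0" if C: "C \<in> F - left_cosets (G_at y)" for C
    proof -
      obtain h where h: "C = gcoset h" using F C by (auto simp: left_cosets_eq)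
      then have "h \<notin> G_at y" using C by (auto simp: left_cosets_eq)
      then show ?thesis using h assms by (simp add: SL2Z_invariant_coset_rep)
    qed
    then have "L2_set (\<lambda>C. cmod (\<xi> (coset_rep C))) F = L2_set (\<lambda>C. cmod (\<xi> (coset_rep C))) (F \<inter> left_cosets (G_at y))"
      unfolding L2_set_def using F by (intro arg_cong[where f = sqrt] sum.mono_neutral_right) auto
    then show "\<exists>G\<in>{F. finite F \<and> F \<subseteq> left_cosets (G_at y)}.
      ennreal (L2_set (\<lambda>C. cmod (\<xi> (coset_rep C))) F) \<le> ennreal (L2_set (\<lambda>C. cmod (\<xi> (coset_rep C))) G)"
      using F by (intro bexI[of _ "F \<inter> left_cosets (G_at y)"]) auto
  qed
qed

lemma l2space_zero: "\<xi> \<in> l2space y \<Longrightarrow> h \<notin> G_at y \<Longrightarrow> \<xi> h = 0"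
  by (simp add: l2space_def)

lemma l2space_invariant:
  assumes "\<xi> \<in> l2space y" "y \<in> Y_space"
  shows "SL2Z_invariant \<xi>"
  unfolding SL2Z_invariant_def
proof (intro ballI allI)
  fix \<gamma> h assume \<gamma>: "\<gamma> \<in> SL2Z"
  show "\<xi> (\<gamma> ** h) = \<xi> h"
  proof (cases "h \<in> G_at y")
    case False
    then have "\<gamma> ** h \<notin> G_at y" using \<gamma> assms(2) by (simp add: G_at_iff U_space_SL2Z_left)
    then show ?thesis using False assms(1) by (simp add: l2space_zero)
  qed (use assms \<gamma> in \<open>simp add: l2space_def\<close>)
qed

lemma l2spaceI:
  assumes "SL2Z_invariant \<xi>" "\<And>h. h \<notin> G_at y \<Longrightarrow> \<xi> h = 0" "coset_l2norm \<xi> < \<infinity>"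
  shows "\<xi> \<in> l2space y"
  using assms l2norm_eq[OF assms(1,2)] by (simp add: l2space_def SL2Z_invariantD)

lemma l2space_norm: "\<xi> \<in> l2space y \<Longrightarrow> y \<in> Y_space \<Longrightarrow> l2norm y \<xi> = coset_l2norm \<xi>"
  by (intro l2norm_eq l2space_invariant l2space_zero)

lemma pi_rep_eq:
  assumes f: "f \<in> hecke_funs" and y: "y \<in> Y_space" and \<xi>: "\<xi> \<in> l2space y"
  shows "pi_rep y f \<xi> g = coset_sum (\<lambda>h. f (g ** matrix_inv h) (act h y) * \<xi> h)"
proof (cases "g \<in> G_at y")
  case True
  have "(\<Sum>\<^sub>\<infinity>C\<in>left_cosets (G_at y). f (g ** matrix_inv (coset_rep C)) (act (coset_rep C) y) * \<xi> (coset_rep C))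
     = coset_sum (\<lambda>h. f (g ** matrix_inv h) (act h y) * \<xi> h)"
  proof (rule coset_sum_restrict)
    show "SL2Z_invariant (\<lambda>h. f (g ** matrix_inv h) (act h y) * \<xi> h)"
      using f y l2space_zero[OF \<xi>] by (intro SL2Z_invariant_kernel l2space_invariant[OF \<xi>]) (auto simp: Y_space_iff G_at_def)
    fix h assume "f (g ** matrix_inv h) (act h y) * \<xi> h \<noteq> 0"
    then show "gcoset h \<in> gcoset ` G_at y" using l2space_zero[OF \<xi>, of h] by auto
  qed (auto simp: G_at_def)
  then show ?thesis using True by (simp add: pi_rep_def)
next
  case False
  have "coset_sum (\<lambda>h. f (g ** matrix_inv h) (act h y) * \<xi> h) = 0"
  proof (rule coset_sum_0, rule ccontr)
    fix h assume h: "h \<in> GL2Qp" "f (g ** matrix_inv h) (act h y) * \<xi> h \<noteq> 0"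
    then have u: "(g ** matrix_inv h, act h y) \<in> U_space" using hecke_funs_supp[OF f] by auto
    have "(g, y) \<in> U_space" by (rule U_space_mult[OF h(1) u]) (use y in \<open>simp add: Y_space_iff\<close>)
    then show False using False y by (simp add: G_at_iff)
  qed
  then show ?thesis using False by (simp add: pi_rep_def)
qed

lemma pi_rep_invariant:
  assumes f: "f \<in> hecke_funs" and y: "y \<in> Y_space" and \<xi>: "\<xi> \<in> l2space y"
  shows "SL2Z_invariant (pi_rep y f \<xi>)"
  unfolding SL2Z_invariant_def pi_rep_eq[OF assms]
  by (simp add: hecke_funs_left[OF f] flip: matrix_mul_assoc)

lemma l2norm_pi_rep:
  assumes f: "f \<in> hecke_funs" and y: "y \<in> Y_space" and \<xi>: "\<xi> \<in> l2space y"
  shows "l2norm y (pi_rep y f \<xi>) = coset_l2norm (pi_rep y f \<xi>)"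
  by (rule l2norm_eq[OF pi_rep_invariant[OF assms]]) (simp add: pi_rep_def)

lemma hnorm_bound:
  assumes f: "f \<in> hecke_funs" and y: "y \<in> Y_space" and \<xi>: "\<xi> \<in> l2space y" and "coset_l2norm \<xi> \<le> 1"
  shows "coset_l2norm (pi_rep y f \<xi>) \<le> hnorm f"
proof -
  have "\<xi> \<in> {\<xi> \<in> l2space y. l2norm y \<xi> \<le> 1}" using assms by (simp add: l2space_norm)
  then have "l2norm y (pi_rep y f \<xi>) \<le> hnorm f"
    unfolding hnorm_def using y by (intro SUP_upper2[of y] SUP_upper2[of \<xi>]) auto
  then show ?thesis using l2norm_pi_rep[OF f y \<xi>] by simp
qed

lemma hnorm_leI:
  assumes f: "f \<in> hecke_funs"
    and "\<And>y \<xi>. y \<in> Y_space \<Longrightarrow> \<xi> \<in> l2space y \<Longrightarrow> coset_l2norm \<xi> \<le> 1 \<Longrightarrow> coset_l2norm (pi_rep y f \<xi>) \<le> c"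
  shows "hnorm f \<le> c"
  unfolding hnorm_def
  by (intro SUP_least) (auto simp: l2space_norm l2norm_pi_rep[OF f] intro: assms(2))

text \<open>If \<open>n x\<close> is integral, then \<open>\<pi>\<^sub>y (\<theta>\<^sub>x f)\<close> is the compression of \<open>\<pi>\<^sub>z f\<close>, \<open>z = n y x\<close>, along
  the map \<open>\<Gamma>\<backslash>G\<^sub>z \<rightarrow> \<Gamma>\<backslash>G\<^sub>y\<close> given by multiplication by \<open>n\<close>.\<close>

lemma hnorm_rtrans:
  assumes f: "f \<in> hecke_funs" and x: "integral_inverse x"
  shows "hnorm (rtrans x f) \<le> hnorm f"
proof (rule hnorm_leI[OF rtrans_hecke_funs[OF f x]])
  fix y \<xi> assume y: "y \<in> Y_space" and \<xi>: "\<xi> \<in> l2space y" and le: "coset_l2norm \<xi> \<le> 1"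
  obtain n :: int where n: "n > 0" "mat (of_int n) ** x \<in> M2R" by (rule denominator_adele_matrix)
  define c :: "rat^2^2" where "c = mat (of_int n)"
  have c: "c \<in> GL2Qp" using n by (simp add: c_def)
  define z where "z = act c (ymult y x)"
  have AH: "y \<in> AH" and \<rho>: "fst y \<in> M2R" using y by (auto simp: Y_space_iff)
  have "fst z = fst y ** (mat (of_int n) ** x)"
    using mat_commute[of "of_int n" "fst y"] by (simp add: z_def c_def act_def ymult_def amat_mat adele_of_rat_of_int matrix_mul_assoc)
  then have z: "z \<in> Y_space" using \<rho> n AH c by (simp add: Y_space_iff M2R_mult) (simp add: z_def act_AH)
  \<comment> \<open>For k in G_z, cancelling x shows that k n lies in G_y. The converse may fail, so
    \<eta> is a truncation of the shifted \<xi> and only an inequality of norms remains; the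
    truncated values are multiplied by zeros of f.\<close>
  define \<eta> where "\<eta> k = (if k \<in> G_at z then \<xi> (k ** c) else 0)" for k
  have \<xi>i: "SL2Z_invariant \<xi>" by (rule l2space_invariant[OF \<xi> y])
  have \<eta>i: "SL2Z_invariant \<eta>"
    using z SL2Z_invariantD[OF \<xi>i]
    by (auto simp: SL2Z_invariant_def \<eta>_def G_at_iff U_space_SL2Z_left simp flip: matrix_mul_assoc)
  have "coset_l2norm \<eta> \<le> coset_l2norm (\<lambda>k. \<xi> (k ** c))"
    by (rule coset_l2norm_mono) (simp add: \<eta>_def)
  also have "\<dots> = coset_l2norm \<xi>" by (rule coset_l2norm_shift[OF \<xi>i c])
  finally have \<eta>n: "coset_l2norm \<eta> \<le> 1" using le by simp
  have \<eta>: "\<eta> \<in> l2space z"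
    using \<eta>i \<eta>n by (intro l2spaceI) (auto simp: \<eta>_def le_less_trans[OF \<eta>n])
  \<comment> \<open>Substitute h = k n: then g h^-1 = (g n^-1) k^-1 and h y x = k z.\<close>
  have "pi_rep y (rtrans x f) \<xi> g = pi_rep z f \<eta> (g ** matrix_inv c)" for g
  proof -
    define S where "S h = rtrans x f (g ** matrix_inv h) (act h y) * \<xi> h" for h
    have "SL2Z_invariant S"
      unfolding S_def using AH l2space_zero[OF \<xi>]
      by (intro SL2Z_invariant_kernel rtrans_hecke_funs f x \<xi>i) (auto simp: G_at_def)
    have "pi_rep y (rtrans x f) \<xi> g = coset_sum S"
      unfolding pi_rep_eq[OF rtrans_hecke_funs[OF f x] y \<xi>] S_def ..
    also have "\<dots> = coset_sum (\<lambda>k. S (k ** c))" by (rule coset_sum_shift[symmetric]) fact+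
    also have "\<dots> = pi_rep z f \<eta> (g ** matrix_inv c)"
      unfolding pi_rep_eq[OF f z \<eta>]
    proof (rule coset_sum_cong)
      fix k assume k: "k \<in> GL2Qp"
      have 1: "S (k ** c) = f (g ** matrix_inv c ** matrix_inv k) (act k z) * \<xi> (k ** c)"
        using k c AH by (simp add: S_def rtrans_def GL2Qp_matrix_inv_mult matrix_mul_assoc act_mult z_def act_AH flip: act_ymult)
      have "f (g ** matrix_inv c ** matrix_inv k) (act k z) = 0" if "k \<notin> G_at z"
      proof (rule ccontr)
        assume "f (g ** matrix_inv c ** matrix_inv k) (act k z) \<noteq> 0"
        then have "act k z \<in> Y_space" using hecke_funs_supp[OF f] by (auto simp: U_space_def)
        then show False using that k by (simp add: G_at_def)
      qed
      then show "S (k ** c) = f (g ** matrix_inv c ** matrix_inv k) (act k z) * \<eta> k"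
        unfolding 1 by (auto simp: \<eta>_def)
    qed
    finally show ?thesis .
  qed
  then have "coset_l2norm (pi_rep y (rtrans x f) \<xi>) = coset_l2norm (\<lambda>g. pi_rep z f \<eta> (g ** matrix_inv c))"
    by (simp add: fun_eq_iff[symmetric] cong: coset_l2norm_cong)
  also have "\<dots> = coset_l2norm (pi_rep z f \<eta>)"
    using c by (intro coset_l2norm_shift pi_rep_invariant f z \<eta>) auto
  also have "\<dots> \<le> hnorm f" by (rule hnorm_bound[OF f z \<eta> \<eta>n])
  finally show "coset_l2norm (pi_rep y (rtrans x f) \<xi>) \<le> hnorm f" .
qed

section \<open>The time evolution on functions\<close>

definition det_powr :: "real \<Rightarrow> rat^2^2 \<Rightarrow> complex" where
  "det_powr t g = complex_of_real (real_of_rat (det g)) powr (\<i> * complex_of_real t)"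

definition evol_fun :: "real \<Rightarrow> hfun \<Rightarrow> hfun" where
  "evol_fun t f = (\<lambda>g y. det_powr t g * f g y)"

lemma det_powr_mult:
  assumes "g \<in> GL2Qp" "h \<in> GL2Qp"
  shows "det_powr t (g ** h) = det_powr t g * det_powr t h"
  using assms by (simp add: det_powr_def det_mul of_rat_mult powr_times_real GL2Qp_def)

lemma det_powr_uminus: "g \<in> GL2Qp \<Longrightarrow> det_powr t g * det_powr (- t) g = 1"
  by (simp add: det_powr_def GL2Qp_def flip: powr_add)

lemma det_powr_matrix_inv:
  assumes "g \<in> GL2Qp"
  shows "det_powr t (matrix_inv g) = det_powr (- t) g"
proof -
  have "det_powr t g * det_powr t (matrix_inv g) = det_powr t (mat 1)"
    using assms by (simp add: GL2Qp_inv flip: det_powr_mult)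
  then have "det_powr (- t) g * det_powr t g * det_powr t (matrix_inv g) = det_powr (- t) g"
    by (simp add: det_powr_def)
  then show ?thesis using det_powr_uminus[OF assms, of t] by (simp add: mult.commute)
qed

lemma norm_det_powr: "g \<in> GL2Qp \<Longrightarrow> cmod (det_powr t g) = 1"
  by (simp add: det_powr_def GL2Qp_def norm_powr_real_powr)

lemma det_powr_SL2Z: "\<gamma> \<in> SL2Z \<Longrightarrow> det_powr t (\<gamma> ** g) = det_powr t g" "\<gamma> \<in> SL2Z \<Longrightarrow> det_powr t (g ** \<gamma>) = det_powr t g"
  by (simp_all add: det_powr_def det_mul SL2Z_det)

lemma evol_fun_hecke_funs: "f \<in> hecke_funs \<Longrightarrow> evol_fun t f \<in> hecke_funs"
  unfolding evol_fun_def by (rule mult_hecke_funs) (auto simp: det_powr_SL2Z)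

text \<open>In each representation, evolving f conjugates its operator by the diagonal unitary with
  entries det(h)^(it); \<eta> is \<xi> multiplied by the inverse unitary.\<close>

lemma hnorm_evol_fun:
  assumes f: "f \<in> hecke_funs"
  shows "hnorm (evol_fun t f) \<le> hnorm f"
proof (rule hnorm_leI[OF evol_fun_hecke_funs[OF f]])
  fix y \<xi> assume y: "y \<in> Y_space" and \<xi>: "\<xi> \<in> l2space y" and le: "coset_l2norm \<xi> \<le> 1"
  define \<eta> where "\<eta> h = det_powr (- t) h * \<xi> h" for h
  have "coset_l2norm \<eta> = coset_l2norm \<xi>"
    by (rule coset_l2norm_cong) (simp add: \<eta>_def norm_mult norm_det_powr)
  then have \<eta>n: "coset_l2norm \<eta> \<le> 1" using le by simp
  have \<eta>: "\<eta> \<in> l2space y"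
  proof (rule l2spaceI)
    show "SL2Z_invariant \<eta>"
      using l2space_invariant[OF \<xi> y] by (simp add: SL2Z_invariant_def \<eta>_def det_powr_SL2Z)
    show "coset_l2norm \<eta> < \<infinity>" using \<eta>n by (auto intro: le_less_trans)
  qed (simp add: \<eta>_def l2space_zero[OF \<xi>])
  have eq: "pi_rep y (evol_fun t f) \<xi> g = det_powr t g * pi_rep y f \<eta> g" if g: "g \<in> GL2Qp" for g
  proof -
    have "coset_sum (\<lambda>h. evol_fun t f (g ** matrix_inv h) (act h y) * \<xi> h)
      = coset_sum (\<lambda>h. det_powr t g * (f (g ** matrix_inv h) (act h y) * \<eta> h))"
      by (rule coset_sum_cong) (simp add: evol_fun_def \<eta>_def det_powr_mult[OF g] det_powr_matrix_inv)
    also have "\<dots> = det_powr t g * coset_sum (\<lambda>h. f (g ** matrix_inv h) (act h y) * \<eta> h)"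
      unfolding coset_sum_def by (rule infsum_cmult_right')
    finally show ?thesis
      unfolding pi_rep_eq[OF f y \<eta>] pi_rep_eq[OF evol_fun_hecke_funs[OF f] y \<xi>] .
  qed
  have "coset_l2norm (pi_rep y (evol_fun t f) \<xi>) = coset_l2norm (pi_rep y f \<eta>)"
    by (rule coset_l2norm_cong) (simp add: eq norm_mult norm_det_powr)
  also have "\<dots> \<le> hnorm f" by (rule hnorm_bound[OF f y \<eta> \<eta>n])
  finally show "coset_l2norm (pi_rep y (evol_fun t f) \<xi>) \<le> hnorm f" .
qed

lemma rtrans_evol_fun: "rtrans x (evol_fun t f) = evol_fun t (rtrans x f)"
  by (simp add: rtrans_def evol_fun_def)

text \<open>The scalar matrix n has determinant n^2, so u is an eigenvector of the evolution with
  eigenvalue (n^2)^(it). The conjugated form matches the first component of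
  \<open>m_evol\<close>.\<close>

lemma evol_lscal:
  assumes f: "f \<in> hecke_funs" and n: "n > 0"
  shows "evol_fun t (lscal n (evol_fun (- t) f)) =
    (\<lambda>g y. complex_of_real (real n ^ 2) powr (\<i> * complex_of_real t) * lscal n f g y)"
proof (intro ext)
  fix g :: "rat^2^2" and y
  define k where "k = mat (1 / of_nat n) ** g"
  have g: "g = mat (of_nat n) ** k" using n by (simp add: k_def mat_scal_cancel)
  have "det_powr t g * (det_powr (- t) k * f k y) = det_powr t (mat (of_nat n)) * f k y"
  proof (cases "f k y = 0")
    case False
    then have k: "k \<in> GL2Qp" by (rule hecke_funs_GL2Qp[OF f])
    have "det_powr t g = det_powr t (mat (of_nat n)) * det_powr t k"
      unfolding g using n k by (simp add: det_powr_mult)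
    then show ?thesis using det_powr_uminus[OF k, of t] by (simp add: ac_simps)
  qed simp
  moreover have "det_powr t (mat (of_nat n)) = complex_of_real (real n ^ 2) powr (\<i> * complex_of_real t)"
    by (simp add: det_powr_def det_mat_rat of_rat_mult power2_eq_square)
  ultimately show "evol_fun t (lscal n (evol_fun (- t) f)) g y =
    complex_of_real (real n ^ 2) powr (\<i> * complex_of_real t) * lscal n f g y"
    by (simp add: evol_fun_def lscal_def k_def)
qed

lemma evol_rscal:
  assumes f: "f \<in> hecke_funs" and n: "n > 0"
  shows "evol_fun t (rscal n (evol_fun (- t) f)) =
    (\<lambda>g y. complex_of_real (real n ^ 2) powr (\<i> * complex_of_real t) * rscal n f g y)"
proof (intro ext)
  fix g :: "rat^2^2" and y
  define k where "k = g ** mat (1 / of_nat n)"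
  define z where "z = act (mat (of_nat n)) y"
  have g: "g = k ** mat (of_nat n)" using n by (simp add: k_def mat_scal_cancel)
  have "det_powr t g * (det_powr (- t) k * f k z) = det_powr t (mat (of_nat n)) * f k z"
  proof (cases "f k z = 0")
    case False
    then have k: "k \<in> GL2Qp" by (rule hecke_funs_GL2Qp[OF f])
    have "det_powr t g = det_powr t (mat (of_nat n)) * det_powr t k"
      unfolding g using n k by (simp add: det_powr_mult)
    then show ?thesis using det_powr_uminus[OF k, of t] by (simp add: ac_simps)
  qed simp
  moreover have "det_powr t (mat (of_nat n)) = complex_of_real (real n ^ 2) powr (\<i> * complex_of_real t)"
    by (simp add: det_powr_def det_mat_rat of_rat_mult power2_eq_square)
  ultimately show "evol_fun t (rscal n (evol_fun (- t) f)) g y =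
    complex_of_real (real n ^ 2) powr (\<i> * complex_of_real t) * rscal n f g y"
    by (simp add: evol_fun_def rscal_def k_def z_def)
qed

section \<open>C*-algebras and double centralizers\<close>

lemma star_zero [simp]: "star (0 :: 'a::cstar_algebra) = 0"
  using star_add[of "0 :: 'a" 0] by simp

lemma star_minus: "star (- x :: 'a::cstar_algebra) = - star x"
  using star_add[of x "- x"] by (simp add: eq_neg_iff_add_eq_0 add.commute)

lemma star_diff: "star (x - y :: 'a::cstar_algebra) = star x - star y"
  using star_add[of x "- y"] by (simp add: star_minus)

lemma norm_star: "norm (star x :: 'a::cstar_algebra) = norm x"
proof -
  have le: "norm x \<le> norm (star x)" for x :: 'a
  proof (cases "x = 0")
    case False
    have "norm x ^ 2 \<le> norm (star x) * norm x"
      using norm_mult_ineq[of "star x" x] by (simp add: cstar_identity)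
    then show ?thesis using False by (simp add: power2_eq_square)
  qed simp
  from le[of x] le[of "star x"] show ?thesis by (simp add: star_star)
qed

lemma norm_mult_star: "norm (x * star x :: 'a::cstar_algebra) = norm x ^ 2"
  using cstar_identity[of "star x"] by (simp add: star_star norm_star)

lemma scaleC_minus1: "(-1) *\<^sub>C x = - (x :: 'a::cstar_algebra)"
  using scaleC_of_real[of "-1" x] by simp

lemma scaleC_diff: "c *\<^sub>C (x - y) = c *\<^sub>C x - c *\<^sub>C (y :: 'a::cstar_algebra)"
  using scaleC_add_right[of c "x - y" y] by simp

lemma continuous_on_star [continuous_intros]:
  fixes f :: "'b::topological_space \<Rightarrow> 'a::cstar_algebra"
  assumes "continuous_on S f"
  shows "continuous_on S (\<lambda>x. star (f x))"
proof -
  have "continuous_on UNIV (star :: 'a \<Rightarrow> 'a)"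
    unfolding continuous_on_iff dist_norm by (metis norm_star star_diff)
  from continuous_on_compose2[OF this assms] show ?thesis by simp
qed

lemma continuous_on_scaleC [continuous_intros]:
  fixes f :: "'b::topological_space \<Rightarrow> 'a::cstar_algebra"
  assumes "continuous_on S f"
  shows "continuous_on S (\<lambda>x. c *\<^sub>C f x)"
proof -
  have "(cmod c)-lipschitz_on UNIV (\<lambda>x :: 'a. c *\<^sub>C x)"
    by (rule lipschitz_onI) (simp_all add: dist_norm norm_scaleC flip: scaleC_diff)
  then have "continuous_on UNIV (\<lambda>x :: 'a. c *\<^sub>C x)" by (rule lipschitz_on_continuous_on)
  from continuous_on_compose2[OF this assms] show ?thesis by simp
qed

lemma left_mult_eqI:
  fixes x y :: "'a::cstar_algebra"
  assumes "\<And>a. a * x = a * y"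
  shows "x = y"
proof -
  have "star (x - y) * (x - y) = 0" using assms[of "star (x - y)"] by (simp add: right_diff_distrib)
  then show ?thesis using cstar_identity[of "x - y"] by simp
qed

lemma right_mult_eqI:
  fixes x y :: "'a::cstar_algebra"
  assumes "\<And>b. x * b = y * b"
  shows "x = y"
proof -
  have "(x - y) * star (x - y) = 0" using assms[of "star (x - y)"] by (simp add: left_diff_distrib)
  then show ?thesis using norm_mult_star[of "x - y"] by simp
qed

text \<open>Both sides agree after multiplication by an arbitrary element, and a C*-algebra has no
  nonzero annihilators.\<close>

lemma double_centralizer_mult:
  fixes L R :: "'a::cstar_algebra \<Rightarrow> 'a"
  assumes "\<And>a b. a * L b = R a * b"
  shows "L (a * b) = L a * b" "R (a * b) = a * R b"
proof -
  show "L (a * b) = L a * b"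
    by (rule left_mult_eqI) (simp add: assms flip: mult.assoc)
  show "R (a * b) = a * R b"
    by (rule right_mult_eqI) (metis assms mult.assoc)
qed

text \<open>For u = (L, R) the product x star(u) equals star(u star(x)), so u x star(u) is
  expressible through L and \<open>star\<close> alone.\<close>

lemma conj_double_centralizer:
  fixes L R :: "'a::cstar_algebra \<Rightarrow> 'a"
  assumes LR: "\<And>a b. a * L b = R a * b"
    and \<phi>: "\<And>x. \<phi> x = L (star (L (star x)))"
  shows "m_of (\<phi> x) = m_mult (m_mult (L, R) (m_of x)) (m_star (L, R))"
proof -
  \<comment> \<open>The double centralizer identity for \<open>m_star (L, R)\<close>.\<close>
  have adj: "a * star (R (star b)) = star (L (star a)) * b" for a b
  proof -
    have "star (a * star (R (star b))) = star (star (L (star a)) * b)"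
      by (simp add: star_mult star_star LR)
    then show ?thesis by (metis star_star)
  qed
  note mult = double_centralizer_mult[OF LR] double_centralizer_mult[OF adj]
  have "\<phi> x * b = L (x * star (R (star b)))" for b
    by (simp add: \<phi> adj mult(1))
  moreover have "b * \<phi> x = star (L (star (R b * x)))" for b
    by (simp add: \<phi> LR mult(4))
  ultimately show ?thesis
    by (simp add: m_of_def m_mult_def m_star_def fun_eq_iff)
qed

section \<open>Operators on the completion\<close>

locale hecke_completion =
  fixes \<iota> :: "hfun \<Rightarrow> 'a::cstar_algebra"
  assumes completion: "is_completion \<iota>"
begin

lemma iota_add: "f\<^sub>1 \<in> hecke_funs \<Longrightarrow> f\<^sub>2 \<in> hecke_funs \<Longrightarrow> \<iota> (\<lambda>g y. f\<^sub>1 g y + f\<^sub>2 g y) = \<iota> f\<^sub>1 + \<iota> f\<^sub>2"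
  using completion unfolding is_completion_def Cc_Z_eq by blast

lemma iota_scale: "f \<in> hecke_funs \<Longrightarrow> \<iota> (\<lambda>g y. c * f g y) = c *\<^sub>C \<iota> f"
  using completion unfolding is_completion_def Cc_Z_eq by blast

lemma iota_conv: "f\<^sub>1 \<in> hecke_funs \<Longrightarrow> f\<^sub>2 \<in> hecke_funs \<Longrightarrow> \<iota> (conv f\<^sub>1 f\<^sub>2) = \<iota> f\<^sub>1 * \<iota> f\<^sub>2"
  using completion unfolding is_completion_def Cc_Z_eq by blast

lemma iota_hadj: "f \<in> hecke_funs \<Longrightarrow> \<iota> (hadj f) = star (\<iota> f)"
  using completion unfolding is_completion_def Cc_Z_eq by blast

lemma iota_norm: "f \<in> hecke_funs \<Longrightarrow> ennreal (norm (\<iota> f)) = hnorm f"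
  using completion unfolding is_completion_def Cc_Z_eq by blast

lemma iota_dense: "closure (\<iota> ` hecke_funs) = UNIV"
  using completion unfolding is_completion_def Cc_Z_eq by blast

lemma scale_hecke_funs: "f \<in> hecke_funs \<Longrightarrow> (\<lambda>g y. c * f g y) \<in> hecke_funs"
  by (rule mult_hecke_funs) auto

lemma dense_eq:
  fixes \<Phi> \<Psi> :: "'a \<Rightarrow> 'b::t2_space"
  assumes "continuous_on UNIV \<Phi>" "continuous_on UNIV \<Psi>" "\<And>f. f \<in> hecke_funs \<Longrightarrow> \<Phi> (\<iota> f) = \<Psi> (\<iota> f)"
  shows "\<Phi> x = \<Psi> x"
proof -
  have "closure (\<iota> ` hecke_funs) \<subseteq> {x. \<Phi> x = \<Psi> x}"
    using assms by (intro closure_minimal closed_Collect_eq) auto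
  then show ?thesis by (auto simp: iota_dense)
qed

text \<open>Contractivity is measured through \<iota> rather than through \<open>hnorm\<close>,
  since for \<open>lscal\<close> and \<open>rscal\<close> it is derived from the C*-identity in the
  completion.\<close>

definition bounded_op :: "(hfun \<Rightarrow> hfun) \<Rightarrow> bool" where
  "bounded_op T \<longleftrightarrow> (\<forall>f\<in>hecke_funs. T f \<in> hecke_funs) \<and>
     (\<forall>f\<^sub>1\<in>hecke_funs. \<forall>f\<^sub>2\<in>hecke_funs. T (\<lambda>g y. f\<^sub>1 g y + f\<^sub>2 g y) = (\<lambda>g y. T f\<^sub>1 g y + T f\<^sub>2 g y)) \<and>
     (\<forall>c. \<forall>f\<in>hecke_funs. T (\<lambda>g y. c * f g y) = (\<lambda>g y. c * T f g y)) \<and>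
     (\<forall>f\<in>hecke_funs. norm (\<iota> (T f)) \<le> norm (\<iota> f))"

lemma bounded_opD:
  assumes "bounded_op T" "f \<in> hecke_funs"
  shows "T f \<in> hecke_funs" "f' \<in> hecke_funs \<Longrightarrow> T (\<lambda>g y. f g y + f' g y) = (\<lambda>g y. T f g y + T f' g y)"
    "T (\<lambda>g y. c * f g y) = (\<lambda>g y. c * T f g y)" "norm (\<iota> (T f)) \<le> norm (\<iota> f)"
  using assms unfolding bounded_op_def by blast+

text \<open>Linearity and contractivity make T descend to a 1-Lipschitz map on the dense image of
  \<iota>, which extends by completeness. Uniqueness of continuous extensions from a dense set then
  evaluates the \<open>THE\<close> in \<open>extension\<close>.\<close>

lemma bounded_op_extension:
  assumes T: "bounded_op T"
  shows "continuous_on UNIV (extension \<iota> T) \<and> (\<forall>f\<in>hecke_funs. extension \<iota> T (\<iota> f) = \<iota> (T f))"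
proof -
  note T' = bounded_opD[OF T]
  have lip: "norm (\<iota> (T f\<^sub>1) - \<iota> (T f\<^sub>2)) \<le> norm (\<iota> f\<^sub>1 - \<iota> f\<^sub>2)" if f: "f\<^sub>1 \<in> hecke_funs" "f\<^sub>2 \<in> hecke_funs" for f\<^sub>1 f\<^sub>2
  proof -
    \<comment> \<open>The negative is written as a multiple by -1 so that the additivity and
      homogeneity clauses apply to differences.\<close>
    define m where "m = (\<lambda>g y. (-1) * f\<^sub>2 g y)"
    have m: "m \<in> hecke_funs" "\<iota> m = - \<iota> f\<^sub>2" "T m = (\<lambda>g y. (-1) * T f\<^sub>2 g y)"
      unfolding m_def using f by (simp_all only: scale_hecke_funs iota_scale scaleC_minus1 T'(3))
    have "\<iota> (T m) = - \<iota> (T f\<^sub>2)"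
      unfolding m(3) using f by (simp only: iota_scale T'(1) scaleC_minus1)
    then have "\<iota> (T (\<lambda>g y. f\<^sub>1 g y + m g y)) = \<iota> (T f\<^sub>1) - \<iota> (T f\<^sub>2)"
      unfolding T'(2)[OF f(1) m(1)] using iota_add[OF T'(1)[OF f(1)] T'(1)[OF m(1)]] by simp
    moreover have "\<iota> (\<lambda>g y. f\<^sub>1 g y + m g y) = \<iota> f\<^sub>1 - \<iota> f\<^sub>2"
      using f m by (simp add: iota_add)
    ultimately show ?thesis using T'(4)[OF add_hecke_funs[OF f(1) m(1)]] by simp
  qed
  \<comment> \<open>An arbitrary preimage under \<iota> is chosen; \<open>lip\<close> makes the
    value independent of that choice.\<close>
  define h where "h x = \<iota> (T (SOME f. f \<in> hecke_funs \<and> \<iota> f = x))" for x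
  have h: "h (\<iota> f) = \<iota> (T f)" if f: "f \<in> hecke_funs" for f
  proof -
    define f' where "f' = (SOME f'. f' \<in> hecke_funs \<and> \<iota> f' = \<iota> f)"
    have "f' \<in> hecke_funs \<and> \<iota> f' = \<iota> f" 
      unfolding f'_def using f by (intro someI[where P = "\<lambda>f'. f' \<in> hecke_funs \<and> \<iota> f' = \<iota> f" and x = f]) simp
    then show ?thesis using lip[of f' f] f by (simp add: h_def flip: f'_def)
  qed
  have "1-lipschitz_on (\<iota> ` hecke_funs) h"
    by (rule lipschitz_onI) (auto simp: h dist_norm lip)
  then have "uniformly_continuous_on (\<iota> ` hecke_funs) h" by (rule lipschitz_on_uniformly_continuous)
  then obtain \<Phi> where \<Phi>: "uniformly_continuous_on UNIV \<Phi>" "\<And>x. x \<in> \<iota> ` hecke_funs \<Longrightarrow> h x = \<Phi> x"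
    using uniformly_continuous_on_extension_on_closure[of "\<iota> ` hecke_funs" h] unfolding iota_dense by metis
  have P: "continuous_on UNIV \<Phi> \<and> (\<forall>f\<in>hecke_funs. \<Phi> (\<iota> f) = \<iota> (T f))"
    using \<Phi> h by (auto intro: uniformly_continuous_imp_continuous)
  have "\<Psi> = \<Phi>" if "continuous_on UNIV \<Psi> \<and> (\<forall>f\<in>hecke_funs. \<Psi> (\<iota> f) = \<iota> (T f))" for \<Psi>
    by (rule ext, rule dense_eq[of \<Psi> \<Phi>]) (use that P in auto)
  then have "extension \<iota> T = \<Phi>"
    unfolding extension_def Cc_Z_eq using P by (intro the_equality) blast+
  then show ?thesis using P by simp
qed

lemma extension_continuous: "bounded_op T \<Longrightarrow> continuous_on S (extension \<iota> T)"
  using bounded_op_extension continuous_on_subset by blast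

lemma extension_iota: "bounded_op T \<Longrightarrow> f \<in> hecke_funs \<Longrightarrow> extension \<iota> T (\<iota> f) = \<iota> (T f)"
  using bounded_op_extension by blast

lemma continuous_on_extension [continuous_intros]:
  assumes "bounded_op T" "continuous_on S f"
  shows "continuous_on S (\<lambda>x. extension \<iota> T (f x))"
  using continuous_on_compose2[OF extension_continuous[OF assms(1)] assms(2)] by blast

lemma extension_cong:
  assumes "\<And>f. f \<in> hecke_funs \<Longrightarrow> T f = T' f"
  shows "extension \<iota> T = extension \<iota> T'"
  unfolding extension_def Cc_Z_eq using assms by simp

text \<open>Density is applied to one variable at a time, first x, then y; the same scheme serves
  for products.\<close>

lemma extension_add:
  assumes T: "bounded_op T"
  shows "extension \<iota> T (x + y) = extension \<iota> T x + extension \<iota> T y"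
proof (rule dense_eq[of "\<lambda>x. extension \<iota> T (x + y)" "\<lambda>x. extension \<iota> T x + extension \<iota> T y"])
  fix f assume f: "f \<in> hecke_funs"
  show "extension \<iota> T (\<iota> f + y) = extension \<iota> T (\<iota> f) + extension \<iota> T y"
  proof (rule dense_eq[of "\<lambda>y. extension \<iota> T (\<iota> f + y)" "\<lambda>y. extension \<iota> T (\<iota> f) + extension \<iota> T y"])
    fix f' assume f': "f' \<in> hecke_funs"
    show "extension \<iota> T (\<iota> f + \<iota> f') = extension \<iota> T (\<iota> f) + extension \<iota> T (\<iota> f')"
      using f f' extension_iota[OF T add_hecke_funs[OF f f']]
      by (simp add: iota_add extension_iota[OF T] bounded_opD[OF T])
  qed (intro continuous_intros T)+
qed (intro continuous_intros T)+

lemma extension_scaleC: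
  assumes T: "bounded_op T"
  shows "extension \<iota> T (c *\<^sub>C x) = c *\<^sub>C extension \<iota> T x"
proof (rule dense_eq[of "\<lambda>x. extension \<iota> T (c *\<^sub>C x)" "\<lambda>x. c *\<^sub>C extension \<iota> T x"])
  fix f assume f: "f \<in> hecke_funs"
  show "extension \<iota> T (c *\<^sub>C \<iota> f) = c *\<^sub>C extension \<iota> T (\<iota> f)"
    using f extension_iota[OF T scale_hecke_funs[OF f]]
    by (simp add: iota_scale extension_iota[OF T] bounded_opD[OF T])
qed (intro continuous_intros T)+

lemma extension_mult:
  assumes T: "bounded_op T"
    and mult: "\<And>f\<^sub>1 f\<^sub>2. f\<^sub>1 \<in> hecke_funs \<Longrightarrow> f\<^sub>2 \<in> hecke_funs \<Longrightarrow> T (conv f\<^sub>1 f\<^sub>2) = conv (T f\<^sub>1) (T f\<^sub>2)"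
  shows "extension \<iota> T (x * y) = extension \<iota> T x * extension \<iota> T y"
proof (rule dense_eq[of "\<lambda>x. extension \<iota> T (x * y)" "\<lambda>x. extension \<iota> T x * extension \<iota> T y"])
  fix f assume f: "f \<in> hecke_funs"
  show "extension \<iota> T (\<iota> f * y) = extension \<iota> T (\<iota> f) * extension \<iota> T y"
  proof (rule dense_eq[of "\<lambda>y. extension \<iota> T (\<iota> f * y)" "\<lambda>y. extension \<iota> T (\<iota> f) * extension \<iota> T y"])
    fix f' assume f': "f' \<in> hecke_funs"
    show "extension \<iota> T (\<iota> f * \<iota> f') = extension \<iota> T (\<iota> f) * extension \<iota> T (\<iota> f')"
      using f f' extension_iota[OF T conv_hecke_funs[OF f f']]
      by (simp add: iota_conv extension_iota[OF T] bounded_opD[OF T] mult)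
  qed (intro continuous_intros T)+
qed (intro continuous_intros T)+

lemma extension_star:
  assumes T: "bounded_op T" and adj: "\<And>f. f \<in> hecke_funs \<Longrightarrow> T (hadj f) = hadj (T f)"
  shows "extension \<iota> T (star x) = star (extension \<iota> T x)"
proof (rule dense_eq[of "\<lambda>x. extension \<iota> T (star x)" "\<lambda>x. star (extension \<iota> T x)"])
  fix f assume f: "f \<in> hecke_funs"
  show "extension \<iota> T (star (\<iota> f)) = star (extension \<iota> T (\<iota> f))"
    using f extension_iota[OF T hadj_hecke_funs[OF f]]
    by (simp add: iota_hadj extension_iota[OF T] bounded_opD[OF T] adj)
qed (intro continuous_intros T)+

lemma iota_norm_mono: "f \<in> hecke_funs \<Longrightarrow> f' \<in> hecke_funs \<Longrightarrow> hnorm f' \<le> hnorm f \<Longrightarrow> norm (\<iota> f') \<le> norm (\<iota> f)"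
  by (metis iota_norm ennreal_le_iff norm_ge_zero)

lemma bounded_op_rtrans: "integral_inverse x \<Longrightarrow> bounded_op (rtrans x)"
  unfolding bounded_op_def
  by (auto simp: rtrans_hecke_funs intro!: iota_norm_mono hnorm_rtrans) (simp_all add: rtrans_def)

lemma bounded_op_evol_fun: "bounded_op (evol_fun t)"
  unfolding bounded_op_def
  by (auto simp: evol_fun_hecke_funs intro!: iota_norm_mono hnorm_evol_fun) (simp_all add: evol_fun_def fun_eq_iff algebra_simps)

text \<open>The C*-identity with star(u) u = 1: star(u f) (u f) = star(f) f.\<close>

lemma norm_iota_lscal:
  assumes f: "f \<in> hecke_funs" and n: "n > 0"
  shows "norm (\<iota> (lscal n f)) = norm (\<iota> f)"
proof -
  have l: "lscal n f \<in> hecke_funs" by (rule lscal_hecke_funs[OF f n])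
  have "norm (\<iota> (lscal n f)) ^ 2 = norm (\<iota> (conv (hadj (lscal n f)) (lscal n f)))"
    using l by (simp add: iota_conv iota_hadj hadj_hecke_funs cstar_identity)
  also have "conv (hadj (lscal n f)) (lscal n f) = conv (hadj f) f"
    using conv_lscal[OF hadj_hecke_funs[OF l] f n] by (simp add: rscal_hadj_lscal[OF f n])
  also have "norm (\<iota> (conv (hadj f) f)) = norm (\<iota> f) ^ 2"
    using f by (simp add: iota_conv iota_hadj hadj_hecke_funs cstar_identity)
  finally show ?thesis by simp
qed

text \<open>With h = star(f u), the square of the norm of f u is the norm of (f u) h = f (u h), and
  u h has the norm of f u. Only an inequality results, since u star(u) is in general a proper
  projection.\<close>

lemma norm_iota_rscal:
  assumes f: "f \<in> hecke_funs" and n: "n > 0"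
  shows "norm (\<iota> (rscal n f)) \<le> norm (\<iota> f)"
proof (cases "\<iota> (rscal n f) = 0")
  case False
  have r: "rscal n f \<in> hecke_funs" by (rule rscal_hecke_funs[OF f n])
  define h where "h = hadj (rscal n f)"
  have h: "h \<in> hecke_funs" "\<iota> h = star (\<iota> (rscal n f))"
    unfolding h_def using r by (simp_all add: hadj_hecke_funs iota_hadj)
  have "norm (\<iota> (rscal n f)) ^ 2 = norm (\<iota> (rscal n f) * \<iota> h)" by (simp add: h norm_mult_star)
  also have "\<dots> = norm (\<iota> f * \<iota> (lscal n h))"
    using conv_lscal[OF f h(1) n] iota_conv[OF r h(1)] iota_conv[OF f lscal_hecke_funs[OF h(1) n]] by simp
  also have "\<dots> \<le> norm (\<iota> f) * norm (\<iota> (rscal n f))"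
    using norm_mult_ineq[of "\<iota> f" "\<iota> (lscal n h)"] by (simp add: norm_iota_lscal[OF h(1) n] h(2) norm_star)
  finally show ?thesis using False by (simp add: power2_eq_square)
qed simp

lemma bounded_op_lscal: "n > 0 \<Longrightarrow> bounded_op (lscal n)"
  unfolding bounded_op_def
  by (auto simp: lscal_hecke_funs norm_iota_lscal) (simp_all add: lscal_def)

lemma bounded_op_rscal: "n > 0 \<Longrightarrow> bounded_op (rscal n)"
  unfolding bounded_op_def
  by (auto simp: rscal_hecke_funs norm_iota_rscal) (auto simp: rscal_def fun_eq_iff)

lemma evol_eq: "evol \<iota> t = extension \<iota> (evol_fun t)"
  by (simp add: evol_def evol_fun_def[abs_def] det_powr_def)

section \<open>The endomorphisms of the completion given by right translation\<close>

definition theta :: "adele^2^2 \<Rightarrow> 'a \<Rightarrow> 'a" where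
  "theta x = extension \<iota> (rtrans x)"

lemma theta_Endo:
  assumes x: "integral_inverse x"
  shows "theta x \<in> Endo (evol \<iota>)"
proof -
  note T = bounded_op_rtrans[OF x] and E = bounded_op_evol_fun
  have "star_hom (theta x)"
    unfolding star_hom_def theta_def
    by (simp add: extension_add[OF T] extension_scaleC[OF T] extension_mult[OF T] extension_star[OF T]
        rtrans_conv rtrans_hadj x)
  moreover have "theta x (evol \<iota> t a) = evol \<iota> t (theta x a)" for t a
  proof (rule dense_eq[of "\<lambda>a. theta x (evol \<iota> t a)" "\<lambda>a. evol \<iota> t (theta x a)"])
    fix f assume f: "f \<in> hecke_funs"
    then show "theta x (evol \<iota> t (\<iota> f)) = evol \<iota> t (theta x (\<iota> f))"
      by (simp add: theta_def evol_eq extension_iota T E evol_fun_hecke_funs rtrans_hecke_funs x rtrans_evol_fun)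
  qed (unfold theta_def evol_eq, (intro continuous_intros T E)+)
  ultimately show ?thesis by (auto simp: Endo_def)
qed

lemma integral_inverse_mult:
  assumes "integral_inverse x" "integral_inverse z"
  shows "integral_inverse (x ** z)"
proof -
  have inv: "invertible x" "invertible z" using assms by (auto simp: integral_inverse_def)
  have "x ** z ** (matrix_inv z ** matrix_inv x) = x ** (z ** matrix_inv z) ** matrix_inv x"
    "matrix_inv z ** matrix_inv x ** (x ** z) = matrix_inv z ** (matrix_inv x ** x) ** z"
    by (simp_all add: matrix_mul_assoc)
  then have "matrix_inv (x ** z) = matrix_inv z ** matrix_inv x"
    using inv by (intro matrix_inv_unique) (simp_all add: invertible_matrix_inv)
  then show ?thesis using assms inv by (simp add: integral_inverse_def invertible_mult M2R_mult)
qed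

lemma theta_comp:
  assumes x: "integral_inverse x" and z: "integral_inverse z"
  shows "theta x \<circ> theta z = theta (x ** z)"
proof (rule ext, unfold o_apply)
  fix a
  note T = bounded_op_rtrans[OF x] bounded_op_rtrans[OF z] bounded_op_rtrans[OF integral_inverse_mult[OF x z]]
  show "theta x (theta z a) = theta (x ** z) a"
  proof (rule dense_eq[of "\<lambda>a. theta x (theta z a)" "\<lambda>a. theta (x ** z) a"])
    fix f assume f: "f \<in> hecke_funs"
    then show "theta x (theta z (\<iota> f)) = theta (x ** z) (\<iota> f)"
      by (simp add: theta_def extension_iota T rtrans_hecke_funs z rtrans_rtrans)
  qed (unfold theta_def, (intro continuous_intros T)+)
qed

lemma integral_inverse_scalar:
  assumes "n > 0"
  shows "integral_inverse (mat (adele_of_rat (1 / of_nat n)))"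
proof -
  have "mat (adele_of_rat (1 / of_nat n)) ** amat (mat (of_nat n)) = mat 1"
    "amat (mat (of_nat n)) ** mat (adele_of_rat (1 / of_nat n)) = mat 1"
    using assms by (simp_all add: mat_mult_rat flip: amat_mat amat_mult)
  then show ?thesis
    using matrix_inv_unique[of "mat (adele_of_rat (1 / of_nat n))" "amat (mat (of_nat n))"]
    by (auto simp: integral_inverse_def invertible_def mat_of_nat_M2R)
qed

text \<open>The pair (L, R) of extended multiplications by u is the required isometry. All of its
  properties are closed conditions, checked on the dense image of \<iota> with the identities for
  \<open>lscal\<close> and \<open>rscal\<close>.\<close>

lemma theta_scalar_Inner:
  assumes n: "n > 0"
  shows "theta (mat (adele_of_rat (1 / of_nat n))) \<in> Inner (evol \<iota>)"
proof -
  define x :: "adele^2^2" where "x = mat (adele_of_rat (1 / of_nat n))"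
  have x: "integral_inverse x" unfolding x_def by (rule integral_inverse_scalar[OF n])
  define L where "L = extension \<iota> (lscal n)"
  define R where "R = extension \<iota> (rscal n)"
  note TL = bounded_op_lscal[OF n] and TR = bounded_op_rscal[OF n] and TE = bounded_op_evol_fun
    and TX = bounded_op_rtrans[OF x]
  have cL: "continuous_on UNIV (\<lambda>a. L (h a))" and cR: "continuous_on UNIV (\<lambda>a. R (h a))"
    if "continuous_on UNIV h" for h :: "'a \<Rightarrow> 'a"
    using that by (auto simp: L_def R_def intro!: continuous_intros TL TR)
  have L: "L (\<iota> f) = \<iota> (lscal n f)" and R: "R (\<iota> f) = \<iota> (rscal n f)" if "f \<in> hecke_funs" for f
    using that by (simp_all add: L_def R_def extension_iota TL TR)
  have LR: "a * L b = R a * b" for a b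
  proof (rule dense_eq[of "\<lambda>a. a * L b" "\<lambda>a. R a * b"])
    fix f assume f: "f \<in> hecke_funs"
    show "\<iota> f * L b = R (\<iota> f) * b"
    proof (rule dense_eq[of "\<lambda>b. \<iota> f * L b" "\<lambda>b. R (\<iota> f) * b"])
      fix f' assume f': "f' \<in> hecke_funs"
      show "\<iota> f * L (\<iota> f') = R (\<iota> f) * \<iota> f'"
        using f f' conv_lscal[OF f f' n]
        by (simp add: L R lscal_hecke_funs rscal_hecke_funs n flip: iota_conv)
    qed (intro continuous_intros cL)+
  qed (intro continuous_intros cR)+
  have iso: "R (star (L b)) = star b" for b
  proof (rule dense_eq[of "\<lambda>b. R (star (L b))" star])
    fix f assume f: "f \<in> hecke_funs"
    then show "R (star (L (\<iota> f))) = star (\<iota> f)"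
      by (simp add: L R lscal_hecke_funs hadj_hecke_funs rscal_hadj_lscal n flip: iota_hadj)
  qed (intro continuous_intros cR cL)+
  have \<theta>: "theta x a = L (star (L (star a)))" for a
  proof (rule dense_eq[of "theta x" "\<lambda>a. L (star (L (star a)))"])
    fix f assume f: "f \<in> hecke_funs"
    then show "theta x (\<iota> f) = L (star (L (star (\<iota> f))))"
      using lscal_hadj_lscal_hadj[OF f n]
      by (simp add: L lscal_hecke_funs hadj_hecke_funs n theta_def extension_iota TX flip: iota_hadj x_def)
  qed (unfold theta_def, (intro continuous_intros cL extension_continuous TX)+)
  define c where "c t = complex_of_real (real n ^ 2) powr (\<i> * complex_of_real t)" for t
  have eL: "evol \<iota> t (L (evol \<iota> (- t) a)) = c t *\<^sub>C L a" for t a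
  proof (rule dense_eq[of "\<lambda>a. evol \<iota> t (L (evol \<iota> (- t) a))" "\<lambda>a. c t *\<^sub>C L a"])
    fix f assume f: "f \<in> hecke_funs"
    then show "evol \<iota> t (L (evol \<iota> (- t) (\<iota> f))) = c t *\<^sub>C L (\<iota> f)"
      by (simp add: L evol_eq extension_iota TE evol_fun_hecke_funs lscal_hecke_funs n evol_lscal iota_scale c_def)
  qed (unfold evol_eq, (intro continuous_intros cL TE)+)
  have eR: "evol \<iota> t (R (evol \<iota> (- t) a)) = c t *\<^sub>C R a" for t a
  proof (rule dense_eq[of "\<lambda>a. evol \<iota> t (R (evol \<iota> (- t) a))" "\<lambda>a. c t *\<^sub>C R a"])
    fix f assume f: "f \<in> hecke_funs"
    then show "evol \<iota> t (R (evol \<iota> (- t) (\<iota> f))) = c t *\<^sub>C R (\<iota> f)"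
      by (simp add: R evol_eq extension_iota TE evol_fun_hecke_funs rscal_hecke_funs n evol_rscal iota_scale c_def)
  qed (unfold evol_eq, (intro continuous_intros cR TE)+)
  have "(L, R) \<in> multipliers" using LR by (simp add: multipliers_def)
  moreover have "m_mult (m_star (L, R)) (L, R) = m_one"
  proof -
    have "star (R (star (L a))) = a" "R (star (L (star a))) = a" for a
      by (simp_all add: iso star_star)
    then show ?thesis by (simp add: m_mult_def m_star_def m_one_def fun_eq_iff)
  qed
  \<comment> \<open>The eigenvalue base is n^2, the determinant of the scalar matrix n.\<close>
  moreover have "\<exists>l>0. \<forall>t. m_evol (evol \<iota>) t (L, R) = m_scale (complex_of_real l powr (\<i> * complex_of_real t)) (L, R)"
    using n by (intro exI[of _ "real n ^ 2"]) (simp add: m_evol_def m_scale_def fun_eq_iff eL eR c_def)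
  moreover have "\<forall>a. m_of (theta x a) = m_mult (m_mult (L, R) (m_of a)) (m_star (L, R))"
    using conj_double_centralizer[OF LR \<theta>] by blast
  ultimately have "theta x \<in> Inner (evol \<iota>)"
    unfolding Inner_def using theta_Endo[OF x] by blast
  then show ?thesis by (simp add: x_def)
qed

lemma theta_one: "theta (mat 1) = id"
proof (rule ext)
  fix a
  have "integral_inverse (mat 1)" using integral_inverse_scalar[of 1] by (simp add: adele_of_rat_1)
  then have T: "bounded_op (rtrans (mat 1))" by (rule bounded_op_rtrans)
  show "theta (mat 1) a = id a"
  proof (rule dense_eq[of "theta (mat 1)" id])
    fix f assume f: "f \<in> hecke_funs"
    then show "theta (mat 1) (\<iota> f) = id (\<iota> f)"
      by (simp add: theta_def extension_iota T) (simp add: rtrans_def ymult_def)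
  qed (unfold theta_def, auto intro: extension_continuous T)
qed

text \<open>\<open>-1 \<in> \<Gamma>\<close> is central, so it acts trivially on the functions on \<open>Z\<close>.\<close>

lemma theta_minus: "theta (mat (-1) ** x) = theta x"
  unfolding theta_def
proof (rule extension_cong)
  fix f assume f: "f \<in> hecke_funs"
  have m: "mat (-1) \<in> SL2Z"
    unfolding SL2Z_def by (auto simp: vec_eq_iff mat_def det_2 intro!: exI[of _ "mat (-1)"])
  show "rtrans (mat (-1) ** x) f = rtrans x f"
  proof (intro ext)
    fix g y
    have "ymult y (mat (-1) ** x) = act (mat (-1)) (ymult y x)"
      using mat_commute[of "-1" "fst y"]
      by (simp add: act_mat ymult_def matrix_mul_assoc adele_of_rat_minus adele_of_rat_1)
    then have "rtrans (mat (-1) ** x) f g y = f (g ** mat (-1)) (ymult y x)"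
      using hecke_funs_right[OF f m] by (simp add: rtrans_def)
    also have "\<dots> = f g (ymult y x)"
      using hecke_funs_left[OF f m, of g] by (simp flip: mat_commute_rat)
    finally show "rtrans (mat (-1) ** x) f g y = rtrans x f g y" by (simp add: rtrans_def)
  qed
qed

text \<open>Write q = a/d or q = -a/d with a, d positive. Then (1/a) q x and (1/d) x agree up to
  sign, so the inner endomorphisms attached to a and to d equalize the two sides.\<close>

lemma eq_mod_inner_theta_scalar:
  assumes x: "integral_inverse x" and x': "integral_inverse (mat (adele_of_rat q) ** x)" and q: "q \<noteq> 0"
  shows "eq_mod_inner (evol \<iota>) (theta x) (theta (mat (adele_of_rat q) ** x))"
proof -
  obtain p b where pb: "q = Fract p b" "b > 0" by (cases q) auto
  define a where "a = nat \<bar>p\<bar>"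
  define d where "d = nat b"
  have ad: "a > 0" "d > 0" using pb q by (auto simp: a_def d_def rat_number_collapse)
  let ?s = "\<lambda>n. mat (adele_of_rat (1 / of_nat n)) :: adele^2^2"
  have q_eq: "q = of_int p / of_nat d" using pb by (simp add: Fract_of_int_quotient d_def)
  have "(?s a) ** (mat (adele_of_rat q) ** x) = mat (adele_of_rat (1 / of_nat a * q)) ** x"
    by (simp add: matrix_mul_assoc mat_mult_mat flip: adele_of_rat_mult)
  \<comment> \<open>Dividing by a = |p| leaves the sign of p, which \<open>theta_minus\<close>
    absorbs.\<close>
  also have "1 / of_nat a * q = (if p > 0 then 1 / of_nat d else - (1 / of_nat d))"
    using ad by (auto simp: q_eq a_def)
  finally have "theta (?s a ** (mat (adele_of_rat q) ** x)) = theta (?s d ** x)"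
  proof (cases "p > 0")
    case False
    assume *: "?s a ** (mat (adele_of_rat q) ** x) = mat (adele_of_rat (if p > 0 then 1 / of_nat d else - (1 / of_nat d))) ** x"
    have "mat (adele_of_rat (- (1 / of_nat d))) = mat (-1) ** ?s d"
      by (simp add: mat_mult_mat adele_of_rat_minus)
    then have "?s a ** (mat (adele_of_rat q) ** x) = mat (-1) ** (?s d ** x)"
      using * False by (simp add: matrix_mul_assoc)
    then show ?thesis by (simp add: theta_minus)
  qed simp
  then have "theta (?s d) \<circ> theta x = theta (?s a) \<circ> theta (mat (adele_of_rat q) ** x)"
    by (simp add: theta_comp integral_inverse_scalar ad x x')
  then show ?thesis
    unfolding eq_mod_inner_def
    using theta_scalar_Inner[OF ad(1)] theta_scalar_Inner[OF ad(2)] theta_Endo[OF x] theta_Endo[OF x'] by blast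
qed

end

section \<open>Representatives of the classes in S\<close>

lemma carrier_S_group: "carrier S_group = S_class ` {x. invertible x}"
  by (auto simp: S_group_def FactGroup_def RCOSETS_def S_class_def GL2Af_def)

lemma S_class_mult:
  assumes "invertible x" "invertible z"
  shows "S_class x \<otimes>\<^bsub>S_group\<^esub> S_class z = S_class (x ** z)"
  using normal.rcos_sum[OF Qstar_normal, of x z] assms
  by (simp add: S_group_def S_class_def GL2Af_def FactGroup_def)

lemma S_class_eq: "S_class x = {mat (adele_of_rat q) ** x | q. q \<noteq> 0}"
  by (auto simp: S_class_def r_coset_def GL2Af_def Qstar_def)

lemma S_class_eqD:
  assumes "S_class x = S_class z"
  obtains q where "q \<noteq> 0" "z = mat (adele_of_rat q) ** x"
proof -
  have "z = mat (adele_of_rat 1) ** z" by (simp add: adele_of_rat_1)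
  then have "z \<in> S_class z" unfolding S_class_eq by (intro CollectI exI[of _ 1]) simp
  then have "z \<in> S_class x" by (simp only: assms)
  then show ?thesis using that unfolding S_class_eq by blast
qed

lemma S_class_scalar:
  assumes "q \<noteq> 0"
  shows "S_class (mat (adele_of_rat q) ** x) = S_class x"
proof (rule equalityI; rule subsetI)
  fix z assume "z \<in> S_class (mat (adele_of_rat q) ** x)"
  then obtain r where "r \<noteq> 0" "z = mat (adele_of_rat r) ** (mat (adele_of_rat q) ** x)" by (auto simp: S_class_eq)
  then have "r * q \<noteq> 0" "z = mat (adele_of_rat (r * q)) ** x"
    using assms by (auto simp: matrix_mul_assoc mat_mult_mat adele_of_rat_mult)
  then show "z \<in> S_class x" unfolding S_class_eq by blast
next
  fix z assume "z \<in> S_class x"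
  then obtain r where "r \<noteq> 0" "z = mat (adele_of_rat r) ** x" by (auto simp: S_class_eq)
  then have "r / q \<noteq> 0" "z = mat (adele_of_rat (r / q)) ** (mat (adele_of_rat q) ** x)"
    using assms by (auto simp: matrix_mul_assoc mat_mult_mat simp flip: adele_of_rat_mult)
  then show "z \<in> S_class (mat (adele_of_rat q) ** x)" unfolding S_class_eq by blast
qed

text \<open>If n clears the denominators of the inverse of x, then x/n lies in the same class and
  has the integral inverse n x^-1.\<close>

lemma S_class_rep:
  assumes "s \<in> carrier S_group"
  obtains x where "integral_inverse x" "S_class x = s"
proof -
  obtain x where x: "invertible x" "s = S_class x" using assms by (auto simp: carrier_S_group)
  obtain n :: int where n: "n > 0" "mat (of_int n) ** matrix_inv x \<in> M2R" by (rule denominator_adele_matrix)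
  define q where "q = 1 / rat_of_int n"
  have q: "q \<noteq> 0" "adele_of_rat q * of_int n = 1" "of_int n * adele_of_rat q = 1"
    using n by (simp_all add: q_def adele_of_rat_1 flip: adele_of_rat_of_int adele_of_rat_mult)
  let ?y = "mat (adele_of_rat q) ** x" and ?z = "mat (of_int n) ** matrix_inv x"
  have "?y ** ?z = mat (adele_of_rat q) ** (x ** mat (of_int n)) ** matrix_inv x" by (simp add: matrix_mul_assoc)
  also have "\<dots> = mat (adele_of_rat q) ** mat (of_int n) ** (x ** matrix_inv x)"
    by (metis mat_commute matrix_mul_assoc)
  also have "\<dots> = mat 1" using x by (simp add: mat_mult_mat q invertible_matrix_inv)
  finally have 1: "?y ** ?z = mat 1" .
  have "?z ** ?y = mat (of_int n) ** (matrix_inv x ** mat (adele_of_rat q)) ** x" by (simp add: matrix_mul_assoc)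
  also have "\<dots> = mat (of_int n) ** mat (adele_of_rat q) ** (matrix_inv x ** x)"
    by (metis mat_commute matrix_mul_assoc)
  also have "\<dots> = mat 1" using x by (simp add: mat_mult_mat q invertible_matrix_inv)
  finally have 2: "?z ** ?y = mat 1" .
  have "matrix_inv ?y = ?z" by (rule matrix_inv_unique[OF 1 2])
  then have "integral_inverse ?y" using 1 2 n by (auto simp: integral_inverse_def invertible_def)
  moreover have "S_class ?y = s" using x q by (simp add: S_class_scalar)
  ultimately show ?thesis using that by blast
qed

lemma integral_inverse_zhat:
  fixes \<gamma> :: "zhat^2^2"
  assumes "invertible \<gamma>"
  shows "integral_inverse (map_matrix adele_of_zhat \<gamma>)"
proof -
  have hom: "map_matrix adele_of_zhat (a ** b) = map_matrix adele_of_zhat a ** map_matrix adele_of_zhat b" for a b :: "zhat^2^2"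
    by (simp add: vec_eq_iff matrix_matrix_mult_def sum_2 adele_of_zhat_def adele_frac_add adele_frac_mult)
  have "adele_of_zhat 1 = 1" "adele_of_zhat 0 = 0"
    using of_int_eq_adele_frac[of 1] of_int_eq_adele_frac[of 0] by (simp_all add: adele_of_zhat_def)
  then have one: "map_matrix adele_of_zhat (mat 1 :: zhat^2^2) = mat 1" by (simp add: vec_eq_iff mat_def)
  obtain \<delta> where "\<gamma> ** \<delta> = mat 1" "\<delta> ** \<gamma> = mat 1" using assms by (auto simp: invertible_def)
  then have "map_matrix adele_of_zhat \<gamma> ** map_matrix adele_of_zhat \<delta> = mat 1"
    "map_matrix adele_of_zhat \<delta> ** map_matrix adele_of_zhat \<gamma> = mat 1"
    by (simp_all add: one flip: hom)
  then show ?thesis using matrix_inv_unique by (auto simp: integral_inverse_def invertible_def M2R_def)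
qed

text \<open>\<open>mtilde m\<close> is the adjugate of m, written l below; this accounts for its
  integrality and for its inverse m / det m.\<close>

lemma mtilde_inverse:
  fixes m :: "int^2^2"
  assumes "det m > 0"
  shows "mtilde m \<in> M2R"
    and "mtilde m ** (mat (adele_of_rat (1 / of_int (det m))) ** map_matrix of_int m) = mat 1"
    and "(mat (adele_of_rat (1 / of_int (det m))) ** map_matrix of_int m) ** mtilde m = mat 1"
proof -
  define M :: "adele^2^2" where "M = map_matrix of_int m"
  define l :: "int^2^2" where "l = vector [vector [m$2$2, - m$1$2], vector [- m$2$1, m$1$1]]"
  have l: "l $ 1 $ 1 = m$2$2" "l $ 1 $ 2 = - m$1$2" "l $ 2 $ 1 = - m$2$1" "l $ 2 $ 2 = m$1$1"
    by (simp_all add: l_def)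
  define N :: "adele^2^2" where "N = map_matrix of_int l"
  let ?d = "mat (of_int (det m)) :: adele^2^2" and ?e = "mat (adele_of_rat (1 / of_int (det m))) :: adele^2^2"
  have ml: "m ** l = mat (det m)" "l ** m = mat (det m)"
    by (auto simp: vec_eq_iff matrix_matrix_mult_def sum_2 forall_2 mat_def det_2 l algebra_simps)
  have d: "map_matrix of_int (mat (det m) :: int^2^2) = ?d" by (simp add: vec_eq_iff mat_def)
  have MN: "M ** N = ?d" "N ** M = ?d"
    unfolding M_def N_def by (simp_all add: ml d flip: of_int_matrix_mult)
  have de: "?e ** ?d = mat 1"
    using assms by (simp add: mat_mult_mat adele_of_rat_1 flip: adele_of_rat_of_int adele_of_rat_mult)
  have inv1: "M ** (?e ** N) = mat 1"
  proof -
    have "M ** (?e ** N) = ?e ** (M ** N)" by (metis mat_commute matrix_mul_assoc)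
    then show ?thesis by (simp add: MN de)
  qed
  have inv2: "?e ** N ** M = mat 1" by (simp add: MN de flip: matrix_mul_assoc)
  have "matrix_inv M = ?e ** N" by (rule matrix_inv_unique[OF inv1 inv2])
  then have mt: "mtilde m = N"
    using de mat_commute[of "of_int (det m)" ?e] by (simp add: mtilde_def M_def[symmetric] matrix_mul_assoc)
  show "mtilde m \<in> M2R" unfolding mt N_def by (simp add: M2R_iff of_int_range_zhat)
  have "N ** (?e ** M) = ?e ** (N ** M)" by (metis mat_commute matrix_mul_assoc)
  then show "mtilde m ** (?e ** map_matrix of_int m) = mat 1" by (simp add: mt MN de flip: M_def)
  show "?e ** map_matrix of_int m ** mtilde m = mat 1" by (simp add: mt MN de flip: M_def matrix_mul_assoc)
qed

section \<open>The two given actions and the action of S\<close>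

context hecke_completion
begin

lemma theta_GL2R_eq: "theta_GL2R \<iota> \<gamma> = theta (map_matrix adele_of_zhat \<gamma>)"
proof -
  have "(\<lambda>f g (\<rho>, \<tau>). f g (\<rho> ** map_matrix adele_of_zhat \<gamma>, \<tau>)) = rtrans (map_matrix adele_of_zhat \<gamma>)"
    by (auto simp: fun_eq_iff rtrans_def ymult_def)
  then show ?thesis by (simp add: theta_GL2R_def theta_def)
qed

text \<open>The case distinction in \<open>theta_M2Z\<close> is automatic: if \<rho> is not in R_m,
  then \<rho> X is not integral for X = m / det m, and f vanishes there because it is supported in
  U.\<close>

lemma theta_M2Z_eq:
  assumes "det m > 0"
  shows "theta_M2Z \<iota> m = theta (mat (adele_of_rat (1 / of_int (det m))) ** map_matrix of_int m)"
    and "integral_inverse (mat (adele_of_rat (1 / of_int (det m))) ** map_matrix of_int m)"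
proof -
  define X :: "adele^2^2" where "X = mat (adele_of_rat (1 / of_int (det m))) ** map_matrix of_int m"
  note inv = mtilde_inverse[OF assms, folded X_def]
  have X: "matrix_inv (mtilde m) = X" "matrix_inv X = mtilde m"
    using inv by (auto intro: matrix_inv_unique)
  show "integral_inverse (mat (adele_of_rat (1 / of_int (det m))) ** map_matrix of_int m)"
    using inv X(2) by (auto simp: integral_inverse_def invertible_def simp flip: X_def)
  have "theta_M2Z \<iota> m = theta X"
    unfolding theta_M2Z_def theta_def
  proof (rule extension_cong)
    fix f assume f: "f \<in> hecke_funs"
    have e: "extend0 f = f" using hecke_funs_supp[OF f] by (auto simp: extend0_def fun_eq_iff)
    have "f g (\<rho> ** X, \<tau>) = 0" if "\<rho> \<notin> R_ideal m" for g \<rho> \<tau>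
    proof (rule ccontr)
      assume "f g (\<rho> ** X, \<tau>) \<noteq> 0"
      then have "\<rho> ** X \<in> M2R" using hecke_funs_supp[OF f] by (auto simp: U_space_iff)
      moreover have "\<rho> = (\<rho> ** X) ** mtilde m" using inv(3) by (simp flip: matrix_mul_assoc)
      ultimately show False using that by (auto simp: R_ideal_def)
    qed
    then show "(\<lambda>g (\<rho>, \<tau>). if \<rho> \<in> R_ideal m then extend0 f g (\<rho> ** matrix_inv (mtilde m), \<tau>) else 0) = rtrans X f"
      by (auto simp: fun_eq_iff rtrans_def ymult_def e X(1))
  qed
  then show "theta_M2Z \<iota> m = theta (mat (adele_of_rat (1 / of_int (det m))) ** map_matrix of_int m)"
    by (simp add: X_def)
qed

text \<open>The representative is an arbitrary choice in each class. The chosen representatives need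
  not be multiplicative, so neither need \<open>alpha\<close> be, except modulo inner
  endomorphisms.\<close>

definition alpha :: "(adele^2^2) set \<Rightarrow> 'a \<Rightarrow> 'a" where
  "alpha s = theta (SOME x. integral_inverse x \<and> S_class x = s)"

lemma eq_mod_inner_alpha:
  assumes x: "integral_inverse x"
  shows "eq_mod_inner (evol \<iota>) (alpha (S_class x)) (theta x)"
proof -
  define z where "z = (SOME z. integral_inverse z \<and> S_class z = S_class x)"
  have z: "integral_inverse z \<and> S_class z = S_class x"
    unfolding z_def using x
    by (intro someI[where P = "\<lambda>z. integral_inverse z \<and> S_class z = S_class x" and x = x]) simp
  then have "S_class z = S_class x" by simp
  then obtain q where q: "q \<noteq> 0" "x = mat (adele_of_rat q) ** z" by (rule S_class_eqD)
  then have "eq_mod_inner (evol \<iota>) (theta z) (theta (mat (adele_of_rat q) ** z))"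
    using z x by (intro eq_mod_inner_theta_scalar) auto
  then show ?thesis by (simp add: alpha_def q(2)[symmetric] flip: z_def)
qed

lemma alpha_eq:
  assumes "s \<in> carrier S_group"
  obtains x where "integral_inverse x" "S_class x = s" "alpha s = theta x"
proof -
  obtain x where "integral_inverse x" "S_class x = s" using assms by (rule S_class_rep)
  then have "integral_inverse (SOME x. integral_inverse x \<and> S_class x = s) \<and>
    S_class (SOME x. integral_inverse x \<and> S_class x = s) = s"
    by (intro someI[where P = "\<lambda>x. integral_inverse x \<and> S_class x = s"]) blast
  then show ?thesis using that by (auto simp: alpha_def)
qed

lemma symmetry_action_alpha: "symmetry_action (evol \<iota>) S_group alpha"
  unfolding symmetry_action_def
proof (intro conjI ballI)
  show "group S_group" by (rule group_S)
next
  fix s assume "s \<in> carrier S_group"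
  then show "alpha s \<in> Endo (evol \<iota>)" by (metis alpha_eq theta_Endo)
next
  have "\<one>\<^bsub>S_group\<^esub> = S_class (mat 1)"
    using group.coset_mult_one[OF group_GL2Af Qstar_subset]
    by (simp add: S_group_def FactGroup_def S_class_def) (simp add: GL2Af_def)
  moreover have "integral_inverse (mat 1)" using integral_inverse_scalar[of 1] by (simp add: adele_of_rat_1)
  ultimately show "eq_mod_inner (evol \<iota>) (alpha \<one>\<^bsub>S_group\<^esub>) id"
    using eq_mod_inner_alpha theta_one by metis
next
  fix s t assume "s \<in> carrier S_group" "t \<in> carrier S_group"
  then obtain x z where x: "integral_inverse x" "S_class x = s" "alpha s = theta x"
    and z: "integral_inverse z" "S_class z = t" "alpha t = theta z" by (metis alpha_eq)
  \<comment> \<open>The product of the two chosen representatives again has integral inverse; it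
    need not be the one chosen for the product class, but \<open>eq_mod_inner_alpha\<close> compares
    them.\<close>
  have "s \<otimes>\<^bsub>S_group\<^esub> t = S_class (x ** z)"
    using x z S_class_mult[of x z] by (simp add: integral_inverse_def)
  then show "eq_mod_inner (evol \<iota>) (alpha (s \<otimes>\<^bsub>S_group\<^esub> t)) (alpha s \<circ> alpha t)"
    using eq_mod_inner_alpha[OF integral_inverse_mult[OF x(1) z(1)]] by (simp add: x z theta_comp)
qed

end

theorem proposition1p34:
  fixes \<iota> :: "hfun \<Rightarrow> 'a::cstar_algebra"
  assumes "is_completion \<iota>"
  shows "\<exists>\<alpha>. symmetry_action (evol \<iota>) S_group \<alpha> \<and>
    (\<forall>\<gamma> :: zhat^2^2. invertible \<gamma> \<longrightarrow>
      eq_mod_inner (evol \<iota>) (\<alpha> (S_class (map_matrix adele_of_zhat \<gamma>))) (theta_GL2R \<iota> \<gamma>)) \<and>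
    (\<forall>m :: int^2^2. det m > 0 \<longrightarrow>
      eq_mod_inner (evol \<iota>) (\<alpha> (S_class (map_matrix of_int m))) (theta_M2Z \<iota> m))"
proof -
  interpret hecke_completion \<iota> by unfold_locales (rule assms)
  have "eq_mod_inner (evol \<iota>) (alpha (S_class (map_matrix of_int m))) (theta_M2Z \<iota> m)"
    if m: "det m > 0" for m :: "int^2^2"
  proof -
    \<comment> \<open>The endomorphism attached to m is right translation by m / det m, which has
      the same class in S as m.\<close>
    have "S_class (mat (adele_of_rat (1 / of_int (det m))) ** map_matrix of_int m) = S_class (map_matrix of_int m)"
      using m by (intro S_class_scalar) simp
    then show ?thesis using eq_mod_inner_alpha[OF theta_M2Z_eq(2)[OF m]] by (simp add: theta_M2Z_eq(1)[OF m])
  qed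
  then show ?thesis
    using symmetry_action_alpha eq_mod_inner_alpha integral_inverse_zhat
    by (intro exI[of _ alpha]) (auto simp: theta_GL2R_eq)
qed

end
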